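(* A Lax operator $\mathcal L$ (depending on the time variables $\mathbf q$) satisfies the equations of the Extended Toda Hierarchy $$\partial_{n,1}\mathcal L=\epsilon^{-1}\Bigl[\Bigl(\tfrac{\mathcal L^{n+1}}{(n+1)!}\Bigr)_+,\mathcal L\Bigr],\qquad \partial_{n,0}\mathcal L=2\epsilon^{-1}\Bigl[\Bigl(\tfrac{\mathcal L^n}{n!}(\log\mathcal L-\mathcal C_n)\Bigr)_+,\mathcal L\Bigr]\qquad(n\ge0)$$ if and only if there is a pair of dressing operators $\mathcal P_L,\mathcal P_R$ of $\mathcal L$ satisfying, for all $n\ge0$, $$\partial_{n,1}\mathcal P_L=-\Bigl(\tfrac{\mathcal L^{n+1}}{\epsilon(n+1)!}\Bigr)_-\mathcal P_L,\qquad \partial_{n,0}\mathcal P_L=-\Bigl(\tfrac{2\mathcal L^n}{\epsilon\,n!}(\log\mathcal L-\mathcal C_n)\Bigr)_-\mathcal P_L,$$ $$\partial_{n,1}\mathcal P_R^\#=\Bigl(\tfrac{\mathcal L^{n+1}}{\epsilon(n+1)!}\Bigr)_+\mathcal P_R^\#,\qquad \partial_{n,0}\mathcal P_R^\#=\Bigl(\tfrac{2\mathcal L^n}{\epsilon\,n!}(\log\mathcal L-\mathcal C_n)\Bigr)_+\mathcal P_R^\#.$$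
   Context: One works over the field $\mathbb C((\epsilon))$. $Q$ is a nonzero constant (with fixed $\log Q$). The time variables are $\mathbf q=(q_{n,i})_{n\ge0,\ i=0,1}$ and $\partial_{n,i}=\partial/\partial q_{n,i}$. $\Lambda=e^{\epsilon\partial_x}$ is the shift operator, $\Lambda a(x)=a(x+\epsilon)\Lambda$ as operators. $\#$ is the antiinvolution acting on formal series in $\Lambda^{\pm1}$ by $x^\#=x$, $\Lambda^\#=Q\Lambda^{-1}$, and on differential operators in $x$ by $(\epsilon\partial_x)^\#=-\epsilon\partial_x+\log Q$, $x^\#=x$. For $B=\sum_kB_k\Lambda^k$ put $B_+=\sum_{k\ge0}B_k\Lambda^k$, $B_-=\sum_{k<0}B_k\Lambda^k$. $\mathcal C_0=\tfrac12\log Q$, $\mathcal C_n=\mathcal C_{n-1}+\tfrac1n$. A Lax operator is $\mathcal L=\Lambda+u+Qe^v\Lambda^{-1}$, with $u=u_0(x)+u_1(x)\epsilon+u_2(x)\epsilon^2+\dots$, $v=v_1(x)\epsilon+v_2(x)\epsilon^2+\dots$, all coefficients infinitely differentiable in $x$. A pair of dressing operators of $\mathcal L$ is a pair $$\mathcal P_L=1+w_1\Lambda^{-1}+w_2\Lambda^{-2}+\dots,\qquad \mathcal P_R=\tilde w_0+\Lambda^{-1}\tilde w_1+\Lambda^{-2}\tilde w_2+\dots$$ such that $\mathcal L=\mathcal P_L\Lambda\mathcal P_L^{-1}=(\mathcal P_R^{-1}\Lambda\mathcal P_R)^\#$. The logarithm (independent of the choice of dressing pair) is $$\log\mathcal L=\tfrac12\bigl(\mathcal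 P_L\,\epsilon\partial_x\,\mathcal P_L^{-1}+(\mathcal P_R^{-1}\epsilon\partial_x\mathcal P_R)^\#\bigr)=\tfrac12\Bigl(\log Q+\epsilon\bigl(\mathcal P_R^{-1}\tfrac{\partial\mathcal P_R}{\partial x}\bigr)^\#-\epsilon\tfrac{\partial\mathcal P_L}{\partial x}\mathcal P_L^{-1}\Bigr),$$ a Laurent series in $\Lambda$ possibly infinite in both directions. *)

theory Defs
  imports
    "HOL-Analysis.Analysis"
    "HOL-Library.Multiset"
    "HOL-Computational_Algebra.Formal_Laurent_Series"
begin

section \<open>Coefficients: smooth functions of \<open>x\<close>, Laurent in \<open>\<epsilon>\<close>, formal in \<open>q\<close>\<close>

definition smooth :: "(real \<Rightarrow> complex) \<Rightarrow> bool" where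
  "smooth f \<longleftrightarrow>
     (\<forall>n x. ((\<lambda>g t. vector_derivative g (at t)) ^^ n) f differentiable (at x))"

context
begin

private abbreviation D :: "(real \<Rightarrow> complex) \<Rightarrow> real \<Rightarrow> complex" where
  "D \<equiv> \<lambda>g t. vector_derivative g (at t)"

private definition Ck :: "nat \<Rightarrow> (real \<Rightarrow> complex) \<Rightarrow> bool" where
  "Ck n f \<longleftrightarrow> (\<forall>k\<le>n. \<forall>x. (D ^^ k) f differentiable (at x))"

private lemma Ck_0: "Ck 0 f \<longleftrightarrow> (\<forall>x. f differentiable (at x))"
  by (simp add: Ck_def)

private lemma Ck_Suc: "Ck (Suc n) f \<longleftrightarrow> (\<forall>x. f differentiable (at x)) \<and> Ck n (D f)"
proof
  assume A: "Ck (Suc n) f"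
  have "f differentiable (at x)" for x
    using A[unfolded Ck_def, rule_format, of 0 x] by simp
  moreover have "Ck n (D f)"
    unfolding Ck_def
  proof (intro allI impI)
    fix k x assume "k \<le> n"
    then show "(D ^^ k) (D f) differentiable (at x)"
      using A[unfolded Ck_def, rule_format, of "Suc k" x] by (simp only: funpow_Suc_right o_apply)
  qed
  ultimately show "(\<forall>x. f differentiable (at x)) \<and> Ck n (D f)" by blast
next
  assume A: "(\<forall>x. f differentiable (at x)) \<and> Ck n (D f)"
  show "Ck (Suc n) f"
    unfolding Ck_def
  proof (intro allI impI)
    fix k x assume k: "k \<le> Suc n"
    show "(D ^^ k) f differentiable (at x)"
    proof (cases k)
      case 0 then show ?thesis using A by simp
    next
      case (Suc j)
      then have "(D ^^ j) (D f) differentiable (at x)" using A k by (auto simp: Ck_def)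
      then show ?thesis by (simp only: Suc funpow_Suc_right o_apply)
    qed
  qed
qed

private lemma Ck_SucD: "Ck (Suc n) f \<Longrightarrow> Ck n f"
  by (auto simp: Ck_def)

private lemma Ck_const: "Ck n (\<lambda>x. c)"
proof (induction n arbitrary: c)
  case (Suc n) show ?case using Suc[of 0] by (simp add: Ck_Suc)
qed (simp add: Ck_0)

private lemma Ck_add: "Ck n f \<Longrightarrow> Ck n g \<Longrightarrow> Ck n (\<lambda>x. f x + g x)"
proof (induction n arbitrary: f g)
  case (Suc n)
  have "D (\<lambda>x. f x + g x) = (\<lambda>x. D f x + D g x)"
    using Suc.prems by (auto simp: Ck_Suc)
  then show ?case using Suc by (auto simp: Ck_Suc)
qed (auto simp: Ck_0)

private lemma Ck_mult: "Ck n f \<Longrightarrow> Ck n g \<Longrightarrow> Ck n (\<lambda>x. f x * g x)"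
proof (induction n arbitrary: f g)
  case (Suc n)
  have "D (\<lambda>x. f x * g x) = (\<lambda>x. f x * D g x + D f x * g x)"
    using Suc.prems by (auto simp: Ck_Suc)
  moreover have "Ck n (\<lambda>x. f x * D g x + D f x * g x)"
    using Suc.prems Suc.prems[THEN Ck_SucD] by (intro Ck_add Suc.IH) (auto simp: Ck_Suc)
  ultimately show ?case using Suc.prems by (auto simp: Ck_Suc)
qed (auto simp: Ck_0)

private lemma smooth_Ck: "smooth f \<longleftrightarrow> (\<forall>n. Ck n f)"
  by (auto simp: smooth_def Ck_def)

lemma smooth_const: "smooth (\<lambda>x. c)"
  by (simp add: smooth_Ck Ck_const)

lemma smooth_add: "smooth f \<Longrightarrow> smooth g \<Longrightarrow> smooth (\<lambda>x. f x + g x)"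
  by (simp add: smooth_Ck Ck_add)

lemma smooth_mult: "smooth f \<Longrightarrow> smooth g \<Longrightarrow> smooth (\<lambda>x. f x * g x)"
  by (simp add: smooth_Ck Ck_mult)

lemma smooth_vector_derivative: "smooth f \<Longrightarrow> smooth (\<lambda>t. vector_derivative f (at t))"
  using Ck_Suc unfolding smooth_Ck by blast

end

lemma smooth_uminus: "smooth f \<Longrightarrow> smooth (\<lambda>x. - f x)"
  using smooth_mult[OF smooth_const[of "-1"]] by simp

lemma smooth_diff: "smooth f \<Longrightarrow> smooth g \<Longrightarrow> smooth (\<lambda>x. f x - g x)"
  using smooth_add[OF _ smooth_uminus] by simp

typedef smooth_fun = "{f. smooth f}"
  using smooth_const by blast

setup_lifting type_definition_smooth_fun

instantiation smooth_fun :: comm_ring_1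
begin

lift_definition zero_smooth_fun :: smooth_fun is "\<lambda>x. 0" by (rule smooth_const)
lift_definition one_smooth_fun :: smooth_fun is "\<lambda>x. 1" by (rule smooth_const)
lift_definition plus_smooth_fun :: "smooth_fun \<Rightarrow> smooth_fun \<Rightarrow> smooth_fun"
  is "\<lambda>f g x. f x + g x" by (rule smooth_add)
lift_definition minus_smooth_fun :: "smooth_fun \<Rightarrow> smooth_fun \<Rightarrow> smooth_fun"
  is "\<lambda>f g x. f x - g x" by (rule smooth_diff)
lift_definition uminus_smooth_fun :: "smooth_fun \<Rightarrow> smooth_fun"
  is "\<lambda>f x. - f x" by (rule smooth_uminus)
lift_definition times_smooth_fun :: "smooth_fun \<Rightarrow> smooth_fun \<Rightarrow> smooth_fun"
  is "\<lambda>f g x. f x * g x" by (rule smooth_mult)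

instance
  by standard (transfer; simp add: fun_eq_iff algebra_simps)+

end

lift_definition smooth_const_fun :: "complex \<Rightarrow> smooth_fun" is "\<lambda>c x. c"
  by (rule smooth_const)

lift_definition smooth_deriv :: "smooth_fun \<Rightarrow> smooth_fun"
  is "\<lambda>f t. vector_derivative f (at t)"
  by (rule smooth_vector_derivative)

lemma smooth_deriv_0 [simp]: "smooth_deriv 0 = 0"
  by transfer simp

lift_definition fls_dx :: "smooth_fun fls \<Rightarrow> smooth_fun fls"
  is "\<lambda>f n. smooth_deriv (f n)"
  by (auto elim: eventually_mono)

text \<open>
  \<open>fls_translate k f\<close> is \<open>f(x + k\<epsilon>)\<close>, the Taylor expansion of \<open>e\<^bsup>k\<epsilon>\<partial>\<^sub>x\<^esup> f\<close>. The coefficient of each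
  power of \<open>\<epsilon>\<close> is a finite sum because \<open>f\<close> has only finitely many negative powers.
\<close>
lift_definition fls_translate :: "int \<Rightarrow> smooth_fun fls \<Rightarrow> smooth_fun fls"
  is "\<lambda>k f n. \<Sum>j | f (n - int j) \<noteq> 0.
        smooth_const_fun (of_int k ^ j / fact j) * (smooth_deriv ^^ j) (f (n - int j))"
proof -
  fix k :: int and f :: "int \<Rightarrow> smooth_fun"
  assume "\<forall>\<^sub>\<infinity>n. f (- int n) = 0"
  then obtain N where N: "\<And>n. n > N \<Longrightarrow> f (- int n) = 0"
    by (auto simp: MOST_nat)
  have "f (- int n - int j) = 0" if "n > N" for n j
    using N[of "n + j"] that by simp
  then show "\<forall>\<^sub>\<infinity>n. (\<Sum>j | f (- int n - int j) \<noteq> 0.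
        smooth_const_fun (of_int k ^ j / fact j) * (smooth_deriv ^^ j) (f (- int n - int j))) = 0"
    unfolding MOST_nat by (intro exI[of _ N]) simp
qed

text \<open>\<open>T0 n\<close> and \<open>T1 n\<close> index the time variables \<open>q\<^bsub>n,0\<^esub>\<close> and \<open>q\<^bsub>n,1\<^esub>\<close>.\<close>
datatype time_var = T0 nat | T1 nat

text \<open>
  Formal power series in the infinitely many variables \<open>q\<close>; a monomial is the multiset of its
  variables. The order of the pole in \<open>\<epsilon>\<close> may grow with the degree in \<open>q\<close>. This is essential:
  the flow of \<open>\<P>\<^sub>R\<close> along \<open>q\<^bsub>0,1\<^esub>\<close> for \<open>\<L> = \<Lambda> + c + Q\<Lambda>\<inverse>\<close> multiplies the leading coefficient by
  \<open>exp (c q\<^bsub>0,1\<^esub> / \<epsilon>)\<close>.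
\<close>
typedef 'a qseries = "UNIV :: (time_var multiset \<Rightarrow> 'a) set"
  morphisms qcoeff Abs_qseries ..

setup_lifting type_definition_qseries

lemma finite_submultisets: "finite {a. a \<subseteq># (m :: 'b multiset)}"
proof (induction m)
  case (add b m)
  have "{a. a \<subseteq># add_mset b m} \<subseteq> {a. a \<subseteq># m} \<union> add_mset b ` {a. a \<subseteq># m}"
  proof
    fix a assume a: "a \<in> {a. a \<subseteq># add_mset b m}"
    show "a \<in> {a. a \<subseteq># m} \<union> add_mset b ` {a. a \<subseteq># m}"
    proof (cases "b \<in># a")
      case True
      then obtain c where "a = add_mset b c" by (meson multi_member_split)
      then show ?thesis using a by auto
    next
      case False
      then have "a \<subseteq># m"
        using a by (simp add: inter_add_left1 subset_mset.inf.absorb_iff2)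
      then show ?thesis by blast
    qed
  qed
  then show ?case using add by (meson finite_Un finite_imageI finite_subset)
qed simp

lemma submultiset_split:
  assumes "a \<subseteq># m" "b \<subseteq># a"
  shows "b \<subseteq># m" "a - b \<subseteq># m - b" "b + (a - b) = a" "m - b - (a - b) = m - a"
  using assms by (metis diff_diff_add_mset subset_mset.add_diff_inverse
    subset_mset.diff_add subset_mset.dual_order.trans subset_mset.le_diff_conv2)+

lemma submultiset_merge: "b \<subseteq># m \<Longrightarrow> c \<subseteq># m - b \<Longrightarrow> b + c \<subseteq># m"
  by (simp add: add.commute subset_mset.le_diff_conv2)

lemma submultiset_compl: "b \<subseteq># m \<Longrightarrow> m - (m - b) = (b :: 'b multiset)"
  by (metis add_diff_cancel_left' subset_mset.diff_add)

instantiation qseries :: (ab_group_add) ab_group_add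
begin

lift_definition zero_qseries :: "'a qseries" is "\<lambda>m. 0" .
lift_definition plus_qseries :: "'a qseries \<Rightarrow> 'a qseries \<Rightarrow> 'a qseries" is "\<lambda>f g m. f m + g m" .
lift_definition minus_qseries :: "'a qseries \<Rightarrow> 'a qseries \<Rightarrow> 'a qseries" is "\<lambda>f g m. f m - g m" .
lift_definition uminus_qseries :: "'a qseries \<Rightarrow> 'a qseries" is "\<lambda>f m. - f m" .

instance
  by standard (transfer; simp add: fun_eq_iff algebra_simps)+

end

instantiation qseries :: (comm_ring_1) comm_ring_1
begin

lift_definition one_qseries :: "'a qseries" is "\<lambda>m. if m = {#} then 1 else 0" .
lift_definition times_qseries :: "'a qseries \<Rightarrow> 'a qseries \<Rightarrow> 'a qseries"
  is "\<lambda>f g m. \<Sum>a | a \<subseteq># m. f a * g (m - a)" .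

instance
proof
  fix f g h :: "'a qseries"
  show "f * g * h = f * (g * h)"
  proof transfer
    fix f g h :: "time_var multiset \<Rightarrow> 'a"
    have "(\<Sum>a | a \<subseteq># m. (\<Sum>b | b \<subseteq># a. f b * g (a - b)) * h (m - a)) =
          (\<Sum>b | b \<subseteq># m. f b * (\<Sum>c | c \<subseteq># m - b. g c * h (m - b - c)))" for m
    proof -
      have "(\<Sum>a | a \<subseteq># m. (\<Sum>b | b \<subseteq># a. f b * g (a - b)) * h (m - a)) =
        (\<Sum>(a,b) \<in> (SIGMA a:{a. a \<subseteq># m}. {b. b \<subseteq># a}). f b * g (a - b) * h (m - a))"
        by (simp add: sum_distrib_right sum.Sigma finite_submultisets)
      also have "\<dots> = (\<Sum>(b,c) \<in> (SIGMA b:{b. b \<subseteq># m}. {c. c \<subseteq># m - b}).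
          f b * g c * h (m - b - c))"
        by (rule sum.reindex_bij_witness[where j = "\<lambda>(a,b). (b, a - b)" and i = "\<lambda>(b,c). (b + c, b)"])
          (auto simp: submultiset_split submultiset_merge)
      also have "\<dots> = (\<Sum>b | b \<subseteq># m. f b * (\<Sum>c | c \<subseteq># m - b. g c * h (m - b - c)))"
        by (simp add: sum_distrib_left sum.Sigma finite_submultisets mult.assoc)
      finally show ?thesis .
    qed
    then show "(\<lambda>m. \<Sum>a | a \<subseteq># m. (\<Sum>b | b \<subseteq># a. f b * g (a - b)) * h (m - a)) =
      (\<lambda>m. \<Sum>a | a \<subseteq># m. f a * (\<Sum>b | b \<subseteq># m - a. g b * h (m - a - b)))" by blast
  qed
  show "f * g = g * f"
  proof transfer
    fix f g :: "time_var multiset \<Rightarrow> 'a"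
    have "(\<Sum>a | a \<subseteq># m. f a * g (m - a)) = (\<Sum>a | a \<subseteq># m. g a * f (m - a))" for m
      by (rule sum.reindex_bij_witness[where j = "\<lambda>a. m - a" and i = "\<lambda>a. m - a"])
        (auto simp: mult.commute submultiset_compl)
    then show "(\<lambda>m. \<Sum>a | a \<subseteq># m. f a * g (m - a)) = (\<lambda>m. \<Sum>a | a \<subseteq># m. g a * f (m - a))"
      by blast
  qed
  show "1 * f = f"
  proof transfer
    fix f :: "time_var multiset \<Rightarrow> 'a"
    have "(\<Sum>a | a \<subseteq># m. (if a = {#} then 1 else 0) * f (m - a)) = f m" for m
    proof -
      have "(\<Sum>a | a \<subseteq># m. (if a = {#} then 1 else 0) * f (m - a)) =
            (\<Sum>a | a \<subseteq># m. if a = {#} then f m else 0)"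
        by (rule sum.cong) auto
      then show ?thesis by (simp add: finite_submultisets)
    qed
    then show "(\<lambda>m. \<Sum>a | a \<subseteq># m. (if a = {#} then 1 else 0) * f (m - a)) = f" by blast
  qed
  show "(f + g) * h = f * h + g * h"
    by transfer (simp add: fun_eq_iff algebra_simps sum.distrib)
  show "(0 :: 'a qseries) \<noteq> 1"
    by transfer (auto simp: fun_eq_iff)
qed

end

lift_definition qmap :: "('a \<Rightarrow> 'b) \<Rightarrow> 'a qseries \<Rightarrow> 'b qseries" is "\<lambda>h f m. h (f m)" .

lift_definition qconst :: "'a::zero \<Rightarrow> 'a qseries" is "\<lambda>c m. if m = {#} then c else 0" .

text \<open>\<open>qderiv t\<close> is the partial derivative with respect to the time variable \<open>t\<close>.\<close>
lift_definition qderiv :: "time_var \<Rightarrow> 'a::semiring_1 qseries \<Rightarrow> 'a qseries"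
  is "\<lambda>t f m. of_nat (count m t + 1) * f (add_mset t m)" .

type_synonym coef = "smooth_fun fls qseries"

definition cconst :: "complex \<Rightarrow> coef" where
  "cconst c = qconst (fls_const (smooth_const_fun c))"

definition eps :: coef where
  "eps = qconst fls_X"

definition eps_inv :: coef where
  "eps_inv = qconst fls_X_inv"

definition translate :: "int \<Rightarrow> coef \<Rightarrow> coef" where
  "translate k = qmap (fls_translate k)"

text \<open>\<open>eps_order_ge k f\<close>: \<open>f\<close> has the form \<open>f\<^sub>k(x,q) \<epsilon>\<^sup>k + f\<^bsub>k+1\<^esub>(x,q) \<epsilon>\<^bsup>k+1\<^esup> + \<dots>\<close>\<close>
definition eps_order_ge :: "int \<Rightarrow> coef \<Rightarrow> bool" where
  "eps_order_ge k f \<longleftrightarrow> (\<forall>m. \<forall>n<k. fls_nth (qcoeff f m) n = 0)"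

text \<open>
  \<open>exp_coef v\<close> is \<open>e\<^sup>v\<close>, for \<open>v\<close> with \<open>eps_order_ge 1 v\<close>: then \<open>v\<^sup>k\<close> is divisible by \<open>\<epsilon>\<^sup>k\<close>, so only the
  terms \<open>v\<^sup>k / k!\<close> with \<open>k \<le> n\<close> contribute to the coefficient of \<open>\<epsilon>\<^sup>n\<close>.
\<close>
definition exp_coef :: "coef \<Rightarrow> coef" where
  "exp_coef v = Abs_qseries (\<lambda>m. Abs_fls (\<lambda>n.
     if n < 0 then 0 else fls_nth (qcoeff (\<Sum>k\<le>nat n. cconst (1 / fact k) * v ^ k) m) n))"


section \<open>Formal series in the shift operator\<close>

text \<open>Series \<open>\<Sum>\<^sub>k B\<^sub>k \<Lambda>\<^sup>k\<close>, possibly infinite in both directions, with coefficients on the left.\<close>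
typedef lam_series = "UNIV :: (int \<Rightarrow> coef) set"
  morphisms lam_coeff Abs_lam_series ..

setup_lifting type_definition_lam_series

instantiation lam_series :: ab_group_add
begin

lift_definition zero_lam_series :: lam_series is "\<lambda>k. 0" .
lift_definition plus_lam_series :: "lam_series \<Rightarrow> lam_series \<Rightarrow> lam_series"
  is "\<lambda>A B k. A k + B k" .
lift_definition minus_lam_series :: "lam_series \<Rightarrow> lam_series \<Rightarrow> lam_series"
  is "\<lambda>A B k. A k - B k" .
lift_definition uminus_lam_series :: "lam_series \<Rightarrow> lam_series" is "\<lambda>A k. - A k" .

instance
  by standard (transfer; simp add: fun_eq_iff algebra_simps)+

end

text \<open>
  Composition, with \<open>\<Lambda>\<^sup>i a(x) = a(x + i\<epsilon>) \<Lambda>\<^sup>i\<close>. It is meaningful if every coefficient receives only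
  finitely many nonzero contributions, e.g. if both series are bounded on the same side or one of
  them is a Laurent polynomial in \<open>\<Lambda>\<close>. Otherwise the infinite sums default to 0, so that there is
  no ring structure on the whole type.
\<close>
instantiation lam_series :: power
begin

lift_definition one_lam_series :: lam_series is "\<lambda>k. if k = 0 then 1 else 0" .
lift_definition times_lam_series :: "lam_series \<Rightarrow> lam_series \<Rightarrow> lam_series"
  is "\<lambda>A B k. \<Sum>i | A i \<noteq> 0 \<and> B (k - i) \<noteq> 0. A i * translate i (B (k - i))" .

instance ..

end

definition commutator :: "lam_series \<Rightarrow> lam_series \<Rightarrow> lam_series" where
  "commutator A B = A * B - B * A"

text \<open>\<open>lmonom a n\<close> is \<open>a \<Lambda>\<^sup>n\<close>.\<close>
definition lmonom :: "coef \<Rightarrow> int \<Rightarrow> lam_series" where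
  "lmonom a n = Abs_lam_series (\<lambda>k. if k = n then a else 0)"

definition lscale :: "coef \<Rightarrow> lam_series \<Rightarrow> lam_series" where
  "lscale a B = Abs_lam_series (\<lambda>k. a * lam_coeff B k)"

lift_definition plus_part :: "lam_series \<Rightarrow> lam_series" is "\<lambda>B k. if k \<ge> 0 then B k else 0" .

lift_definition minus_part :: "lam_series \<Rightarrow> lam_series" is "\<lambda>B k. if k < 0 then B k else 0" .

lift_definition lam_dx :: "lam_series \<Rightarrow> lam_series" is "\<lambda>B k. qmap fls_dx (B k)" .

lift_definition time_deriv :: "time_var \<Rightarrow> lam_series \<Rightarrow> lam_series" is "\<lambda>t B k. qderiv t (B k)" .

text \<open>The antiinvolution: \<open>(\<Sum>\<^sub>k B\<^sub>k(x) \<Lambda>\<^sup>k)\<^sup># = \<Sum>\<^sub>k Q\<^sup>k \<Lambda>\<^bsup>-k\<^esup> B\<^sub>k(x) = \<Sum>\<^sub>k Q\<^sup>k B\<^sub>k(x - k\<epsilon>) \<Lambda>\<^bsup>-k\<^esup>\<close>.\<close>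
lift_definition sharp :: "complex \<Rightarrow> lam_series \<Rightarrow> lam_series"
  is "\<lambda>Q B k. cconst (Q powi (- k)) * translate k (B (- k))" .

text \<open>Series \<open>\<Sum>\<^bsub>k\<le>0\<^esub> B\<^sub>k \<Lambda>\<^sup>k\<close>; equivalently, series \<open>\<Sum>\<^bsub>k\<ge>0\<^esub> \<Lambda>\<^bsup>-k\<^esup> b\<^sub>k\<close> with coefficients on the right.\<close>
definition lower :: "lam_series \<Rightarrow> bool" where
  "lower A \<longleftrightarrow> (\<forall>k>0. lam_coeff A k = 0)"

definition lower_invertible :: "lam_series \<Rightarrow> bool" where
  "lower_invertible A \<longleftrightarrow> (\<exists>B. lower B \<and> A * B = 1 \<and> B * A = 1)"

definition lower_inv :: "lam_series \<Rightarrow> lam_series" where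
  "lower_inv A = (THE B. lower B \<and> A * B = 1 \<and> B * A = 1)"


section \<open>The extended Toda hierarchy\<close>

text \<open>The Lax operator \<open>\<Lambda> + u + Q e\<^sup>v \<Lambda>\<inverse>\<close>.\<close>
definition lax_operator :: "complex \<Rightarrow> lam_series \<Rightarrow> bool" where
  "lax_operator Q L \<longleftrightarrow> (\<exists>u v. eps_order_ge 0 u \<and> eps_order_ge 1 v \<and>
     L = lmonom 1 1 + lmonom u 0 + lmonom (cconst Q * exp_coef v) (- 1))"

text \<open>
  Invertibility of \<open>\<P>\<^sub>R\<close>, i.e. of its leading coefficient, is implicit in the use of the inverse
  of \<open>\<P>\<^sub>R\<close>; for \<open>\<P>\<^sub>L\<close> it is automatic.
\<close>
definition dressing_pair :: "complex \<Rightarrow> lam_series \<Rightarrow> lam_series \<Rightarrow> lam_series \<Rightarrow> bool" where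
  "dressing_pair Q L PL PR \<longleftrightarrow>
     lower PL \<and> lam_coeff PL 0 = 1 \<and>
     lower PR \<and> lower_invertible PR \<and>
     L = PL * lmonom 1 1 * lower_inv PL \<and>
     L = sharp Q (lower_inv PR * lmonom 1 1 * PR)"

definition dressing_log ::
  "complex \<Rightarrow> complex \<Rightarrow> lam_series \<Rightarrow> lam_series \<Rightarrow> lam_series" where
  "dressing_log Q logQ PL PR = lscale (cconst (1 / 2))
     (lmonom (cconst logQ) 0
      + lscale eps (sharp Q (lower_inv PR * lam_dx PR))
      - lscale eps (lam_dx PL * lower_inv PL))"

text \<open>A dressing pair exists for every Lax operator, and the value does not depend on the pair.\<close>
definition lax_log :: "complex \<Rightarrow> complex \<Rightarrow> lam_series \<Rightarrow> lam_series" where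
  "lax_log Q logQ L = (THE l. \<exists>PL PR. dressing_pair Q L PL PR \<and> l = dressing_log Q logQ PL PR)"

primrec C_const :: "complex \<Rightarrow> nat \<Rightarrow> complex" where
  "C_const logQ 0 = logQ / 2"
| "C_const logQ (Suc n) = C_const logQ n + 1 / of_nat (Suc n)"

fun toda_op :: "complex \<Rightarrow> complex \<Rightarrow> lam_series \<Rightarrow> time_var \<Rightarrow> lam_series" where
  "toda_op Q logQ L (T1 n) = lscale (cconst (1 / fact (n + 1))) (L ^ (n + 1))"
| "toda_op Q logQ L (T0 n) = lscale (cconst (1 / fact n)) (L ^ n)
     * (lax_log Q logQ L - lmonom (cconst (C_const logQ n)) 0)"

definition extended_toda :: "complex \<Rightarrow> complex \<Rightarrow> lam_series \<Rightarrow> bool" where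
  "extended_toda Q logQ L \<longleftrightarrow> (\<forall>n.
     time_deriv (T1 n) L =
       lscale eps_inv (commutator (plus_part (toda_op Q logQ L (T1 n))) L) \<and>
     time_deriv (T0 n) L =
       lscale (2 * eps_inv) (commutator (plus_part (toda_op Q logQ L (T0 n))) L))"

definition dressing_flows ::
  "complex \<Rightarrow> complex \<Rightarrow> lam_series \<Rightarrow> lam_series \<Rightarrow> lam_series \<Rightarrow> bool" where
  "dressing_flows Q logQ L PL PR \<longleftrightarrow> (\<forall>n.
     let H1 = lscale eps_inv (toda_op Q logQ L (T1 n));
         H0 = lscale (2 * eps_inv) (toda_op Q logQ L (T0 n))
     in time_deriv (T1 n) PL = - (minus_part H1 * PL) \<and>
        time_deriv (T0 n) PL = - (minus_part H0 * PL) \<and>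
        time_deriv (T1 n) (sharp Q PR) = plus_part H1 * sharp Q PR \<and>
        time_deriv (T0 n) (sharp Q PR) = plus_part H0 * sharp Q PR)"

end

theory Submission
  imports Defs
begin

text \<open>
  Each half of a dressing pair dresses \<open>\<L>\<close> in the same way, \<open>\<L> = P Z P\<inverse>\<close>: in series bounded above
  with \<open>P = \<P>\<^sub>L\<close>, \<open>Z = \<Lambda>\<close>, and in series bounded below with \<open>P = \<P>\<^sub>R\<^sup>#\<close>, \<open>Z = \<Lambda>\<^sup># = Q\<Lambda>\<inverse>\<close>. Let \<open>H\<^sub>t\<close> be the
  operator that generates the flow of the time variable \<open>t\<close>. It commutes with \<open>\<L>\<close>, so
  with \<open>M\<^sub>t = (H\<^sub>t)\<^sub>-\<close> in the first ring and \<open>M\<^sub>t = - (H\<^sub>t)\<^sub>+\<close> in the second, the hierarchy reads \<open>\<partial>\<^sub>t \<L> = [\<L>, M\<^sub>t]\<close> and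
  the flows of the dressing operators read \<open>\<partial>\<^sub>t P = - M\<^sub>t P\<close>. Differentiating \<open>\<L> = P Z P\<inverse>\<close> gives one
  direction (\<open>lax_equations_if_dressing_flows\<close>).

  For the other one, a dressing pair exists by solving difference equations
  (\<open>dressing_pair_exists\<close>), but it need not satisfy the flows. Its value at \<open>q = 0\<close> is transported to
  all \<open>q\<close> by solving \<open>\<partial>\<^sub>t P = - M\<^sub>t P\<close> (\<open>flat_section_exists\<close>). Then \<open>\<L> P\<close> and \<open>P Z\<close> satisfy the same linear
  equations and agree at \<open>q = 0\<close>, so they are equal (\<open>flat_section_dresses\<close>).

  What has to be shown is that the connection \<open>\<partial>\<^sub>t + M\<^sub>t\<close> is flat (\<open>zero_curvature\<close>). The difficulty is that
  \<open>log \<L>\<close> is infinite in both directions and cannot be multiplied with itself. But \<open>2 log \<L>\<close> is the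
  sum of \<open>\<P>\<^sub>L \<epsilon>\<partial>\<^sub>x \<P>\<^sub>L\<inverse>\<close> and \<open>log Q - \<P>\<^sub>R\<^sup># \<epsilon>\<partial>\<^sub>x (\<P>\<^sub>R\<^sup>#)\<inverse>\<close>, and accordingly \<open>H\<^sub>t = X\<^sub>t - Y\<^sub>t\<close> with differential
  operators \<open>X\<^sub>t = A\<^sub>t + K\<^sub>t \<epsilon>\<partial>\<^sub>x\<close> in the first ring and \<open>Y\<^sub>t = B\<^sub>t + K\<^sub>t \<epsilon>\<partial>\<^sub>x\<close> in the second, where \<open>K\<^sub>t\<close> is a multiple
  of a power of \<open>\<L>\<close>. The \<open>X\<^sub>t\<close> commute with each other and with the lower connection \<open>\<partial>\<^sub>t + (H\<^sub>t)\<^sub>-\<close>, the \<open>Y\<^sub>t\<close>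
  with each other and with the upper connection \<open>\<partial>\<^sub>t - (H\<^sub>t)\<^sub>+\<close>. Hence the lower connection has the
  curvature of \<open>\<partial>\<^sub>t + (H\<^sub>t)\<^sub>- - X\<^sub>t\<close>, the upper one that of \<open>\<partial>\<^sub>t - (H\<^sub>t)\<^sub>+ - Y\<^sub>t\<close>; and these two are the same
  connection, because \<open>X\<^sub>t - (H\<^sub>t)\<^sub>- = Y\<^sub>t + (H\<^sub>t)\<^sub>+\<close>. So the two curvatures agree. One contains only negative
  powers of \<open>\<Lambda>\<close>, the other only nonnegative ones, and both vanish.
\<close>

section \<open>Smooth coefficient functions\<close>

lemma smooth_differentiable: "smooth f \<Longrightarrow> f differentiable (at x)"
  unfolding smooth_def by (metis funpow_0)

lemma smooth_deriv_add: "smooth_deriv (f + g) = smooth_deriv f + smooth_deriv g"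
  by transfer (auto simp: fun_eq_iff smooth_differentiable)

lemma smooth_deriv_mult: "smooth_deriv (f * g) = smooth_deriv f * g + f * smooth_deriv g"
  by transfer (auto simp: fun_eq_iff smooth_differentiable)

lemma smooth_deriv_const [simp]: "smooth_deriv (smooth_const_fun c) = 0"
  by transfer simp

lemma smooth_const_fun_simps [simp]:
  "smooth_const_fun 0 = 0" "smooth_const_fun 1 = 1"
  by (transfer; simp)+

lemma smooth_const_fun_mult: "smooth_const_fun (a * b) = smooth_const_fun a * smooth_const_fun b"
  by transfer simp

lemma smooth_const_fun_add: "smooth_const_fun (a + b) = smooth_const_fun a + smooth_const_fun b"
  by transfer simp

lemma smooth_const_fun_sum: "smooth_const_fun (sum f A) = (\<Sum>a\<in>A. smooth_const_fun (f a))"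
  by (induction A rule: infinite_finite_induct) (simp_all add: smooth_const_fun_add)

lemma of_nat_smooth_fun: "of_nat n = smooth_const_fun (of_nat n)"
  by (induction n) (simp_all add: smooth_const_fun_add)

lemma smooth_deriv_sum: "smooth_deriv (sum f A) = (\<Sum>a\<in>A. smooth_deriv (f a))"
  by (induction A rule: infinite_finite_induct) (simp_all add: smooth_deriv_add)

lemma smooth_if_deriv:
  assumes "\<And>x. (f has_vector_derivative g x) (at x)" and "smooth g"
  shows "smooth f"
  unfolding smooth_def
proof (intro allI)
  fix n x
  have D: "(\<lambda>t. vector_derivative f (at t)) = g"
    using assms(1) by (auto intro: vector_derivative_at)
  show "((\<lambda>g t. vector_derivative g (at t)) ^^ n) f differentiable (at x)"
  proof (cases n)
    case 0
    then show ?thesis using assms(1) differentiableI_vector by auto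
  next
    case (Suc m)
    then show ?thesis using assms(2) unfolding smooth_def by (simp only: funpow_Suc_right o_apply D)
  qed
qed

lemma smooth_deriv_surj: "\<exists>g. smooth_deriv g = f"
proof transfer
  fix f :: "real \<Rightarrow> complex" assume f: "smooth f"
  have "\<exists>F. \<forall>x::real. -\<infinity> < ereal x \<longrightarrow> ereal x < \<infinity> \<longrightarrow> (F has_vector_derivative f x) (at x)"
    using differentiable_imp_continuous_within[OF smooth_differentiable[OF f]]
    by (intro einterval_antiderivative) auto
  then obtain F where F: "\<And>x. (F has_vector_derivative f x) (at x)" by auto
  show "\<exists>g\<in>{f. smooth f}. (\<lambda>t. vector_derivative g (at t)) = f"
    using smooth_if_deriv[OF F f] F by (intro bexI[of _ F]) (auto intro: vector_derivative_at)
qed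

text \<open>By induction, every derivative of \<open>E\<close> is a smooth function times \<open>E\<close> itself.\<close>
lemma smooth_exponential:
  assumes "smooth a" and E: "\<And>x. (E has_vector_derivative a x * E x) (at x)"
  shows "smooth E"
  unfolding smooth_def
proof (intro allI)
  fix n x
  let ?D = "\<lambda>g t. vector_derivative g (at t)"
  have dE: "E differentiable (at x)" for x using E differentiableI_vector by blast
  have "\<exists>p. smooth p \<and> (?D ^^ n) E = (\<lambda>x. p x * E x)"
  proof (induction n)
    case 0
    show ?case using smooth_const[of 1] by (intro exI[of _ "\<lambda>x. 1"]) auto
  next
    case (Suc n)
    then obtain p where p: "smooth p" "(?D ^^ n) E = (\<lambda>x. p x * E x)" by blast
    have "(?D ^^ Suc n) E = ?D (\<lambda>x. p x * E x)" by (simp add: p)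
    also have "\<dots> = (\<lambda>x. (?D p x + p x * a x) * E x)"
      using E[THEN vector_derivative_at] smooth_differentiable[OF p(1)] dE
      by (auto simp: algebra_simps)
    finally show ?case
      using smooth_add[OF smooth_vector_derivative[OF p(1)] smooth_mult[OF p(1) assms(1)]] by blast
  qed
  then obtain p where p: "smooth p" "(?D ^^ n) E = (\<lambda>x. p x * E x)" by blast
  then show "(?D ^^ n) E differentiable (at x)"
    using smooth_differentiable[OF p(1)] dE by (auto intro: differentiable_mult)
qed

text \<open>The integrating factor \<open>e\<^bsup>\<integral>a\<^esup>\<close>.\<close>
lemma smooth_integrating_factor:
  "\<exists>E E'. E * E' = 1 \<and> smooth_deriv E = a * E"
proof -
  obtain G where "smooth_deriv G = a" using smooth_deriv_surj by blast
  then show ?thesis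
  proof (transfer)
    fix G a :: "real \<Rightarrow> complex"
    assume G: "smooth G" and a: "smooth a" and eq: "(\<lambda>t. vector_derivative G (at t)) = a"
    have dG: "(G has_vector_derivative a x) (at x)" for x
      using smooth_differentiable[OF G, of x] unfolding vector_derivative_works eq[symmetric] by auto
    have dE: "((\<lambda>x. exp (c * G x)) has_vector_derivative (c * a x) * exp (c * G x)) (at x)" for c x
      using field_vector_diff_chain_at[OF has_vector_derivative_mult_right[OF dG] DERIV_exp, of c]
      by (simp add: o_def mult.commute)
    have sE: "smooth (\<lambda>x. exp (c * G x))" for c
      by (rule smooth_exponential[OF smooth_mult[OF smooth_const[of c] a] dE])
    show "\<exists>E\<in>{f. smooth f}. \<exists>E'\<in>{f. smooth f}.
      (\<lambda>x. E x * E' x) = (\<lambda>x. 1) \<and> (\<lambda>t. vector_derivative E (at t)) = (\<lambda>x. a x * E x)"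
    proof (rule rev_bexI[of "\<lambda>x. exp (1 * G x)"])
      show "\<exists>E'\<in>{f. smooth f}. (\<lambda>x. exp (1 * G x) * E' x) = (\<lambda>x. 1) \<and>
        (\<lambda>t. vector_derivative (\<lambda>x. exp (1 * G x)) (at t)) = (\<lambda>x. a x * exp (1 * G x))"
        using sE[of "-1"] dE[THEN vector_derivative_at, of 1]
        by (intro rev_bexI[of "\<lambda>x. exp (-1 * G x)"]) (auto simp: fun_eq_iff simp flip: exp_add)
    qed (use sE[of 1] in simp)
  qed
qed

lemma smooth_linear_ode_surj: "\<exists>g. smooth_deriv g - a * g = f"
proof -
  obtain E E' where E: "E * E' = 1" "smooth_deriv E = a * E"
    using smooth_integrating_factor by blast
  obtain h where h: "smooth_deriv h = E' * f" using smooth_deriv_surj by blast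
  have "smooth_deriv (E * h) - a * (E * h) = (E * E') * f"
    by (simp add: smooth_deriv_mult E(2) h algebra_simps)
  then show ?thesis using E(1) by (intro exI[of _ "E * h"]) simp
qed

section \<open>The translation automorphisms\<close>

text \<open>The \<open>j\<close>-th Taylor coefficient \<open>k\<^sup>j f\<^bsup>(j)\<^esup> / j!\<close>; with the power of \<open>k\<close> and the factorial inside,
  both the Leibniz rule and the group law of translations become plain convolutions.\<close>
definition taylor :: "int \<Rightarrow> nat \<Rightarrow> smooth_fun \<Rightarrow> smooth_fun" where
  "taylor k j f = smooth_const_fun (of_int k ^ j / fact j) * (smooth_deriv ^^ j) f"

lemma smooth_deriv_funpow_add: "(smooth_deriv ^^ j) (f + g) = (smooth_deriv ^^ j) f + (smooth_deriv ^^ j) g"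
  by (induction j) (simp_all add: smooth_deriv_add)

lemma smooth_deriv_funpow_0 [simp]: "(smooth_deriv ^^ j) 0 = 0"
  by (induction j) simp_all

lemma smooth_deriv_funpow_const_mult:
  "(smooth_deriv ^^ j) (smooth_const_fun c * f) = smooth_const_fun c * (smooth_deriv ^^ j) f"
  by (induction j) (simp_all add: smooth_deriv_mult)

lemma taylor_simps [simp]: "taylor k 0 f = f" "taylor k j 0 = 0" "taylor 0 (Suc j) f = 0"
  "taylor k (Suc 0) f = smooth_const_fun (of_int k) * smooth_deriv f"
  by (simp_all add: taylor_def)

lemma taylor_add: "taylor k j (f + g) = taylor k j f + taylor k j g"
  by (simp add: taylor_def smooth_deriv_funpow_add algebra_simps)

lemma taylor_sum: "taylor k j (sum f A) = (\<Sum>a\<in>A. taylor k j (f a))"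
  by (induction A rule: infinite_finite_induct) (simp_all add: taylor_add)

lemma taylor_Suc:
  "smooth_const_fun (of_nat (Suc j)) * taylor k (Suc j) f = smooth_const_fun (of_int k) * smooth_deriv (taylor k j f)"
proof -
  have "(1 + of_nat j :: complex) \<noteq> 0" by (metis of_nat_Suc of_nat_neq_0)
  then show ?thesis
  by (simp add: taylor_def smooth_deriv_mult mult.assoc[symmetric] smooth_const_fun_mult[symmetric]
      del: smooth_const_fun_simps of_nat_Suc)
qed

lemma smooth_const_fun_cancel:
  assumes "smooth_const_fun c * f = smooth_const_fun c * g" "c \<noteq> 0"
  shows "f = g"
proof -
  have "smooth_const_fun (1/c) * (smooth_const_fun c * f) = smooth_const_fun (1/c) * (smooth_const_fun c * g)"
    using assms(1) by simp
  then show ?thesis using assms(2) by (simp add: mult.assoc[symmetric] smooth_const_fun_mult[symmetric])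
qed

lemma taylor_mult: "taylor k n (f * g) = (\<Sum>i\<le>n. taylor k i f * taylor k (n - i) g)"
proof (induction n)
  case (Suc n)
  let ?c = "\<lambda>n. smooth_const_fun (of_nat n)"
  let ?S = "\<lambda>F. \<Sum>i\<le>Suc n. F i * (taylor k i f * taylor k (Suc n - i) g)"
  have 1: "(\<Sum>i\<le>n. smooth_const_fun (of_int k) * (smooth_deriv (taylor k i f) * taylor k (n - i) g))
    = ?S ?c"
    by (simp add: sum.atMost_Suc_shift mult.assoc[symmetric] taylor_Suc del: sum.atMost_Suc of_nat_Suc)
  have 2: "(\<Sum>i\<le>n. smooth_const_fun (of_int k) * (taylor k i f * smooth_deriv (taylor k (n - i) g)))
    = ?S (\<lambda>i. ?c (Suc n - i))"
  proof -
    have "smooth_const_fun (of_int k) * (taylor k i f * smooth_deriv (taylor k (n - i) g)) =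
      ?c (Suc n - i) * (taylor k i f * taylor k (Suc n - i) g)" if "i \<le> n" for i
      using taylor_Suc[of "n - i" k g] that by (simp add: Suc_diff_le algebra_simps)
    then show ?thesis by simp
  qed
  have "?c (Suc n) * taylor k (Suc n) (f * g) = smooth_const_fun (of_int k) * smooth_deriv (taylor k n (f * g))"
    by (rule taylor_Suc)
  also have "\<dots> = (\<Sum>i\<le>n. smooth_const_fun (of_int k) * (smooth_deriv (taylor k i f) * taylor k (n - i) g))
     + (\<Sum>i\<le>n. smooth_const_fun (of_int k) * (taylor k i f * smooth_deriv (taylor k (n - i) g)))"
    by (simp add: Suc smooth_deriv_sum smooth_deriv_mult sum.distrib sum_distrib_left algebra_simps)
  also have "\<dots> = ?S (\<lambda>i. ?c i + ?c (Suc n - i))"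
    unfolding 1 2 by (simp add: sum.distrib[symmetric] distrib_right del: sum.atMost_Suc)
  also have "\<dots> = ?S (\<lambda>i. ?c (Suc n))"
    by (intro sum.cong refl) (simp add: smooth_const_fun_add[symmetric] of_nat_add[symmetric] del: of_nat_add of_nat_Suc)
  also have "\<dots> = ?c (Suc n) * (\<Sum>i\<le>Suc n. taylor k i f * taylor k (Suc n - i) g)"
    by (simp only: sum_distrib_left)
  finally show ?case by (rule smooth_const_fun_cancel) (metis of_nat_neq_0)
qed simp

lemma taylor_compose: "taylor (k + l) n f = (\<Sum>i\<le>n. taylor k i (taylor l (n - i) f))"
proof -
  have "taylor k i (taylor l (n - i) f) =
     smooth_const_fun (of_nat (n choose i) * of_int k ^ i * of_int l ^ (n - i) / fact n) * (smooth_deriv ^^ n) f"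
    if "i \<le> n" for i
  proof -
    have "(smooth_deriv ^^ i) ((smooth_deriv ^^ (n - i)) f) = (smooth_deriv ^^ n) f"
      using that by (metis funpow_add o_apply le_add_diff_inverse)
    then show ?thesis using that
      by (simp add: taylor_def smooth_deriv_funpow_const_mult mult.assoc[symmetric] smooth_const_fun_mult[symmetric] binomial_fact)
  qed
  then have "(\<Sum>i\<le>n. taylor k i (taylor l (n - i) f)) =
     smooth_const_fun (\<Sum>i\<le>n. of_nat (n choose i) * of_int k ^ i * of_int l ^ (n - i) / fact n) * (smooth_deriv ^^ n) f"
    by (simp add: smooth_const_fun_sum sum_distrib_right)
  then show ?thesis
    by (simp add: taylor_def binomial_ring sum_divide_distrib[symmetric])
qed

lemma taylor_const [simp]: "taylor k (Suc j) (smooth_const_fun c) = 0"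
  unfolding taylor_def funpow_Suc_right by simp

lemma taylor_deriv: "taylor k j (smooth_deriv f) = smooth_deriv (taylor k j f)"
  unfolding taylor_def by (simp add: smooth_deriv_mult funpow_swap1)


lemma fls_translate_nth:
  assumes "\<And>i. i < N \<Longrightarrow> fls_nth f i = 0"
  shows "fls_nth (fls_translate k f) n = (\<Sum>j\<le>nat (n - N). taylor k j (fls_nth f (n - int j)))"
proof -
  have "{j. fls_nth f (n - int j) \<noteq> 0} \<subseteq> {..nat (n - N)}"
  proof
    fix j assume "j \<in> {j. fls_nth f (n - int j) \<noteq> 0}"
    then have "\<not> n - int j < N" using assms by blast
    then show "j \<in> {..nat (n - N)}" by auto
  qed
  then show ?thesis unfolding fls_translate.rep_eq
    by (intro sum.mono_neutral_cong_left) (auto simp: taylor_def)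
qed

text \<open>Translations commute with powers of \<open>\<epsilon>\<close>, so the homomorphism and group laws can be checked on
  series without negative powers, where all sums run over \<open>{..n}\<close>.\<close>
definition fps_translate :: "int \<Rightarrow> smooth_fun fps \<Rightarrow> smooth_fun fps" where
  "fps_translate k F = Abs_fps (\<lambda>n. \<Sum>j\<le>n. taylor k j (fps_nth F (n - j)))"

lemma fls_translate_shift:
  "fls_translate k (fls_shift N (fps_to_fls F)) = fls_shift N (fps_to_fls (fps_translate k F))"
proof (rule fls_eqI)
  fix n
  have "fls_nth (fls_translate k (fls_shift N (fps_to_fls F))) n =
    (\<Sum>j\<le>nat (n + N). taylor k j (fls_nth (fls_shift N (fps_to_fls F)) (n - int j)))"
    using fls_translate_nth[of "-N" "fls_shift N (fps_to_fls F)" k n] by simp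
  also have "\<dots> = fls_nth (fls_shift N (fps_to_fls (fps_translate k F))) n"
  proof (cases "n + N < 0")
    case False
    then show ?thesis by (auto simp: fps_translate_def nat_diff_distrib' intro!: sum.cong arg_cong[of _ _ "taylor k _"] arg_cong[of _ _ "fps_nth F"])
  qed auto
  finally show "fls_nth (fls_translate k (fls_shift N (fps_to_fls F))) n =
    fls_nth (fls_shift N (fps_to_fls (fps_translate k F))) n" .
qed

lemma fls_as_shift: obtains N F where "f = fls_shift N (fps_to_fls F)"
  by (metis fls_conv_base_factor_to_fps_shift_subdegree)

lemma fps_translate_mult: "fps_translate k (F * G) = fps_translate k F * fps_translate k G"
proof (rule fps_ext)
  fix n
  let ?t = "taylor k"
  have "fps_nth (fps_translate k (F * G)) n =
    (\<Sum>j\<le>n. \<Sum>p\<le>n - j. \<Sum>r\<le>j. ?t r (fps_nth F p) * ?t (j - r) (fps_nth G (n - j - p)))"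
    by (simp add: fps_translate_def fps_mult_nth taylor_sum taylor_mult atLeast0AtMost)
  also have "\<dots> = (\<Sum>(j,p,r)\<in>(SIGMA j:{..n}. {..n - j} \<times> {..j}).
      ?t r (fps_nth F p) * ?t (j - r) (fps_nth G (n - j - p)))"
    by (simp add: sum.Sigma sum.cartesian_product split_def)
  also have "\<dots> = (\<Sum>(i,r,l)\<in>(SIGMA i:{..n}. {..i} \<times> {..n - i}).
      ?t r (fps_nth F (i - r)) * ?t l (fps_nth G (n - i - l)))"
    by (rule sum.reindex_bij_witness[where i = "\<lambda>(i,r,l). (r + l, i - r, r)" and j = "\<lambda>(j,p,r). (p + r, r, j - r)"])
      (auto intro!: arg_cong2[of _ _ _ _ "(*)"] arg_cong[of _ _ "?t _"] arg_cong[of _ _ "fps_nth G"])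
  also have "\<dots> = (\<Sum>i\<le>n. \<Sum>r\<le>i. \<Sum>l\<le>n - i. ?t r (fps_nth F (i - r)) * ?t l (fps_nth G (n - i - l)))"
    by (simp add: sum.Sigma sum.cartesian_product split_def)
  also have "\<dots> = fps_nth (fps_translate k F * fps_translate k G) n"
    by (simp add: fps_translate_def fps_mult_nth sum_product atLeast0AtMost)
  finally show "fps_nth (fps_translate k (F * G)) n = fps_nth (fps_translate k F * fps_translate k G) n" .
qed

lemma fps_translate_compose: "fps_translate k (fps_translate l F) = fps_translate (k + l) F"
proof (rule fps_ext)
  fix n
  have "fps_nth (fps_translate k (fps_translate l F)) n =
    (\<Sum>(a,b)\<in>(SIGMA a:{..n}. {..n-a}). taylor k a (taylor l b (fps_nth F (n - a - b))))"
    by (simp add: fps_translate_def taylor_sum sum.Sigma)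
  also have "\<dots> = (\<Sum>(c,a)\<in>(SIGMA c:{..n}. {..c}). taylor k a (taylor l (c - a) (fps_nth F (n - c))))"
    by (rule sum.reindex_bij_witness[where j = "\<lambda>(a,b). (a + b, a)" and i = "\<lambda>(c,a). (a, c - a)"]) auto
  also have "\<dots> = fps_nth (fps_translate (k + l) F) n"
    by (simp add: fps_translate_def taylor_compose sum.Sigma)
  finally show "fps_nth (fps_translate k (fps_translate l F)) n = fps_nth (fps_translate (k + l) F) n" .
qed

lemma fls_translate_mult: "fls_translate k (f * g) = fls_translate k f * fls_translate k g"
proof -
  obtain N F M G where "f = fls_shift N (fps_to_fls F)" "g = fls_shift M (fps_to_fls G)"
    by (metis fls_as_shift)
  then show ?thesis
    by (simp add: fls_translate_shift fps_translate_mult fls_times_both_shifted_simp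
        flip: fls_times_fps_to_fls)
qed

lemma fls_translate_compose: "fls_translate k (fls_translate l f) = fls_translate (k + l) f"
  by (rule fls_as_shift[of f]) (simp add: fls_translate_shift fps_translate_compose)

lemma fls_translate_add: "fls_translate k (f + g) = fls_translate k f + fls_translate k g"
proof (rule fls_eqI)
  fix n
  let ?N = "min (fls_subdegree f) (fls_subdegree g)"
  have "\<And>i. i < ?N \<Longrightarrow> fls_nth f i = 0" "\<And>i. i < ?N \<Longrightarrow> fls_nth g i = 0"
    by simp_all
  then show "fls_nth (fls_translate k (f + g)) n = fls_nth (fls_translate k f + fls_translate k g) n"
    by (subst fls_translate_nth[of ?N] | simp add: fls_translate_nth[of ?N f] fls_translate_nth[of ?N g] taylor_add sum.distrib)+
qed

lemma fls_translate_0 [simp]: "fls_translate 0 f = f"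
proof (rule fls_eqI)
  fix n
  have "(\<Sum>j\<le>m. taylor 0 j (F j)) = F 0" for F and m :: nat
    by (cases m) (simp_all add: sum.atMost_Suc_shift del: sum.atMost_Suc)
  then show "fls_nth (fls_translate 0 f) n = fls_nth f n"
    by (subst fls_translate_nth[of "fls_subdegree f"]) simp_all
qed

lemma fls_translate_zero [simp]: "fls_translate k 0 = 0"
  using fls_translate_add[of k 0 0] by simp

lemma fls_translate_const [simp]:
  assumes "\<And>n. \<exists>c. fls_nth f n = smooth_const_fun c"
  shows "fls_translate k f = f"
proof (rule fls_eqI)
  fix n
  obtain c where c: "\<And>n. fls_nth f n = smooth_const_fun (c n)" using assms by metis
  have "(\<Sum>j\<le>m. taylor k j (smooth_const_fun (c (n - int j)))) = smooth_const_fun (c n)" for m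
    by (cases m) (simp_all add: sum.atMost_Suc_shift del: sum.atMost_Suc taylor_simps(4))
  then show "fls_nth (fls_translate k f) n = fls_nth f n"
    by (subst fls_translate_nth[of "fls_subdegree f"]) (simp_all flip: c)
qed

lemma fls_dx_add: "fls_dx (f + g) = fls_dx f + fls_dx g"
  by (rule fls_eqI) (simp add: fls_dx.rep_eq smooth_deriv_add)

lemma fls_dx_mult: "fls_dx (f * g) = fls_dx f * g + f * fls_dx g"
proof -
  have shift: "fls_dx (fls_shift N (fps_to_fls F)) = fls_shift N (fps_to_fls (Abs_fps (\<lambda>n. smooth_deriv (fps_nth F n))))" for N F
    by (rule fls_eqI) (simp add: fls_dx.rep_eq)
  have mult: "Abs_fps (\<lambda>n. smooth_deriv (fps_nth (F * G) n)) =
     Abs_fps (\<lambda>n. smooth_deriv (fps_nth F n)) * G + F * Abs_fps (\<lambda>n. smooth_deriv (fps_nth G n))" for F G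
    by (rule fps_ext) (simp add: fps_mult_nth smooth_deriv_sum smooth_deriv_mult sum.distrib)
  obtain N F M G where "f = fls_shift N (fps_to_fls F)" "g = fls_shift M (fps_to_fls G)"
    by (metis fls_as_shift)
  then show ?thesis
    by (simp add: shift mult fls_times_both_shifted_simp flip: fls_times_fps_to_fls)
qed

lemma fls_translate_dx: "fls_translate k (fls_dx f) = fls_dx (fls_translate k f)"
proof (rule fls_eqI)
  fix n
  show "fls_nth (fls_translate k (fls_dx f)) n = fls_nth (fls_dx (fls_translate k f)) n"
    using fls_translate_nth[of "fls_subdegree f" "fls_dx f" k n]
      fls_translate_nth[of "fls_subdegree f" f k n]
    by (simp add: fls_dx.rep_eq smooth_deriv_sum taylor_deriv)
qed

text \<open>The lowest coefficient that depends on \<open>x\<close> would be seen one order higher in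
  \<open>f(x + \<epsilon>) - f(x)\<close>.\<close>
lemma fls_dx_0_if_translate_1:
  assumes "fls_translate 1 f = f"
  shows "fls_dx f = 0"
proof -
  define N where "N = fls_subdegree f"
  have N: "fls_nth f i = 0" if "i < N" for i using that by (simp add: N_def)
  have "smooth_deriv (fls_nth f (N + int i)) = 0" for i
  proof (induction i rule: less_induct)
    case (less i)
    have "fls_nth f (N + int i + 1) = (\<Sum>j\<le>Suc i. taylor 1 j (fls_nth f (N + int i + 1 - int j)))"
      using fls_translate_nth[of N f 1 "N + int i + 1"] N assms by (simp add: nat_add_distrib del: sum.atMost_Suc)
    also have "\<dots> = fls_nth f (N + int i + 1) + (\<Sum>j\<le>i. taylor 1 (Suc j) (fls_nth f (N + int i - int j)))"
      by (simp add: sum.atMost_Suc_shift add_diff_eq del: sum.atMost_Suc)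
    also have "(\<Sum>j\<le>i. taylor 1 (Suc j) (fls_nth f (N + int i - int j))) =
       (\<Sum>j\<in>{0}. taylor 1 (Suc j) (fls_nth f (N + int i - int j)))"
    proof (intro sum.mono_neutral_right ballI)
      fix j assume "j \<in> {..i} - {0}"
      then have "smooth_deriv (fls_nth f (N + int i - int j)) = 0"
        using less.IH[of "i - j"] by (simp add: of_nat_diff algebra_simps)
      then show "taylor 1 (Suc j) (fls_nth f (N + int i - int j)) = 0"
        by (simp add: taylor_def funpow_Suc_right del: funpow.simps)
    qed auto
    finally show ?case by simp
  qed
  then have "smooth_deriv (fls_nth f n) = 0" for n
    using N[of n] by (cases "n < N") (auto dest: zle_iff_zadd[THEN iffD1, OF leI])
  then show ?thesis by (intro fls_eqI) (simp add: fls_dx.rep_eq)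
qed

section \<open>Triangular systems\<close>

text \<open>The existence proofs below are recursions in which the equation at the index \<open>i\<close> determines
  the unknown at \<open>i\<close>, up to a surjective map \<open>d i\<close>, from the unknowns at smaller indices.\<close>
lemma triangular_surj:
  fixes T :: "('i \<Rightarrow> 'a::ab_group_add) \<Rightarrow> 'i \<Rightarrow> 'b::ab_group_add"
  assumes "wf R"
    and T: "\<And>i f g. (\<And>j. (j, i) \<in> R \<Longrightarrow> f j = g j) \<Longrightarrow> T f i - T g i = d i (f i - g i)"
    and surj: "\<And>i. surj (d i)"
  shows "\<exists>f. \<forall>i. T f i = h i"
proof -
  have "\<exists>f. \<forall>i. T (f(i := f i)) i = h i"
  proof (rule dependent_wf_choice[OF \<open>wf R\<close>, where P = "\<lambda>f i c. T (f(i := c)) i = h i"])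
    fix f g :: "'i \<Rightarrow> 'a" and i c
    assume "\<And>j. (j, i) \<in> R \<Longrightarrow> f j = g j"
    then have "T (f(i := c)) i - T (g(i := c)) i = d i (c - c)"
      using T[of i "f(i := c)" "g(i := c)"] \<open>wf R\<close> by (auto simp: wf_irrefl)
    moreover have "d i 0 = 0" using T[of i f f] by simp
    ultimately show "(T (f(i := c)) i = h i) = (T (g(i := c)) i = h i)" by simp
  next
    fix i and f :: "'i \<Rightarrow> 'a"
    obtain c where c: "h i - T f i = d i c" using surj by blast
    have "(f(i := f i + c)) j = f j" if "(j, i) \<in> R" for j
      using that \<open>wf R\<close> by auto
    from T[of i "f(i := f i + c)" f, OF this] have "T (f(i := f i + c)) i - T f i = d i c" by simp
    then show "\<exists>c. T (f(i := c)) i = h i" using c by (metis diff_add_cancel diff_eq_eq)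
  qed
  then show ?thesis by simp
qed

text \<open>\<open>g(x + \<epsilon>) - g(x)\<close> starts with \<open>\<epsilon> g'(x)\<close>: the coefficients of \<open>g\<close>, which starts one order below
  \<open>f\<close>, are found one after the other by integration.\<close>
lemma fls_difference_surj: "\<exists>g. fls_translate 1 g - g = f"
proof -
  define N where "N = fls_subdegree f"
  define mk where "mk s = fls_shift (1 - N) (fps_to_fls (Abs_fps s))" for s :: "nat \<Rightarrow> smooth_fun"
  define T where "T s i = fls_nth (fls_translate 1 (mk s) - mk s) (N + int i)" for s i
  have mk: "fls_nth (mk s) n = (if n \<ge> N - 1 then s (nat (n - N + 1)) else 0)" for s n
    by (simp add: mk_def algebra_simps)
  have tr: "fls_nth (fls_translate 1 (mk s)) n = (\<Sum>j\<le>nat (n - N + 1). taylor 1 j (fls_nth (mk s) (n - int j)))" for s n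
    using fls_translate_nth[of "N - 1" "mk s" 1 n] by (simp add: mk algebra_simps)
  have T_eq: "T s i = (\<Sum>j\<le>i. taylor 1 (Suc j) (s (i - j)))" for s i
    unfolding T_def by (simp add: tr mk nat_add_distrib sum.atMost_Suc_shift nat_diff_distrib' del: sum.atMost_Suc)
  have "\<exists>s. \<forall>i. T s i = fls_nth f (N + int i)"
  proof (rule triangular_surj[where R = less_than and d = "\<lambda>i. smooth_deriv"])
    fix i and s t :: "nat \<Rightarrow> smooth_fun" assume eq: "\<And>j. (j, i) \<in> less_than \<Longrightarrow> s j = t j"
    have "T s i - T t i = (\<Sum>j\<le>i. taylor 1 (Suc j) (s (i - j)) - taylor 1 (Suc j) (t (i - j)))"
      by (simp add: T_eq sum_subtractf)
    also have "\<dots> = (\<Sum>j\<in>{0}. taylor 1 (Suc j) (s (i - j)) - taylor 1 (Suc j) (t (i - j)))"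
      using eq by (intro sum.mono_neutral_right) auto
    also have "\<dots> = smooth_deriv (s i - t i)"
      using smooth_deriv_add[of "s i - t i" "t i"] by simp
    finally show "T s i - T t i = smooth_deriv (s i - t i)" .
  qed (auto simp: surj_def, metis smooth_deriv_surj)
  then obtain s where s: "\<And>i. T s i = fls_nth f (N + int i)" by blast
  have "fls_translate 1 (mk s) - mk s = f"
  proof (rule fls_eqI)
    fix n
    show "fls_nth (fls_translate 1 (mk s) - mk s) n = fls_nth f n"
    proof (cases "n < N")
      case True
      then show ?thesis by (simp add: N_def tr mk)
    next
      case False
      then show ?thesis using s[of "nat (n - N)"] by (simp add: T_def)
    qed
  qed
  then show ?thesis by blast
qed


section \<open>The coefficient ring\<close>

abbreviation cdx :: "coef \<Rightarrow> coef" where "cdx \<equiv> qmap fls_dx"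

lemma qseries_eqI: "(\<And>m. qcoeff f m = qcoeff g m) \<Longrightarrow> f = g"
  by (metis qcoeff_inject ext)

lemmas qcoeff_simps [simp] = zero_qseries.rep_eq plus_qseries.rep_eq minus_qseries.rep_eq
  uminus_qseries.rep_eq qmap.rep_eq

lemma qmap_add:
  "(\<And>a b. h (a + b) = h a + h b) \<Longrightarrow> qmap h (f + g) = qmap h f + qmap h g"
  by (rule qseries_eqI) simp

lemma qcoeff_mult: "qcoeff (f * g) m = (\<Sum>a | a \<subseteq># m. qcoeff f a * qcoeff g (m - a))"
  by (simp add: times_qseries.rep_eq)

lemma additive_sum:
  fixes h :: "'a::ab_group_add \<Rightarrow> 'b::ab_group_add"
  assumes "\<And>a b. h (a + b) = h a + h b"
  shows "h (sum f A) = (\<Sum>a\<in>A. h (f a))"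
proof -
  have "h 0 = 0" using assms[of 0 0] by simp
  then show ?thesis by (induction A rule: infinite_finite_induct) (simp_all add: assms)
qed

lemma translate_add: "translate k (f + g) = translate k f + translate k g"
  unfolding translate_def by (rule qmap_add) (rule fls_translate_add)

lemma translate_mult: "translate k (f * g) = translate k f * translate k g"
  unfolding translate_def
  by (rule qseries_eqI)
    (simp add: qcoeff_mult additive_sum[of "fls_translate k"] fls_translate_add fls_translate_mult)

lemma translate_compose: "translate k (translate l f) = translate (k + l) f"
  unfolding translate_def by (rule qseries_eqI) (simp add: fls_translate_compose)

lemma translate_0 [simp]: "translate 0 f = f"
  unfolding translate_def by (rule qseries_eqI) simp

lemma translate_zero [simp]: "translate k 0 = 0"
  unfolding translate_def by (rule qseries_eqI) simp

lemma translate_minus: "translate k (- f) = - translate k f"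
  using translate_add[of k f "- f"] by (simp add: minus_unique)

lemma translate_diff: "translate k (f - g) = translate k f - translate k g"
  using translate_add[of k f "- g"] by (simp add: translate_minus)

lemma translate_sum: "translate k (sum f A) = (\<Sum>a\<in>A. translate k (f a))"
  by (rule additive_sum) (rule translate_add)

lemma cdx_add: "cdx (f + g) = cdx f + cdx g"
  by (rule qmap_add) (rule fls_dx_add)

lemma cdx_mult: "cdx (f * g) = cdx f * g + f * cdx g"
  by (rule qseries_eqI)
    (simp add: qcoeff_mult additive_sum[of fls_dx] fls_dx_add fls_dx_mult sum.distrib)

lemma cdx_translate: "cdx (translate k f) = translate k (cdx f)"
  unfolding translate_def by (rule qseries_eqI) (simp add: fls_translate_dx)

lemma qderiv_add: "qderiv t (f + g) = qderiv t f + qderiv t g"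
  by transfer (simp add: fun_eq_iff algebra_simps)

lemma qderiv_mult:
  fixes f g :: "'a::comm_ring_1 qseries"
  shows "qderiv t (f * g) = qderiv t f * g + f * qderiv t g"
proof -
  have half: "(\<Sum>a | a \<subseteq># add_mset t m. of_nat (count a t) * (qcoeff f a * qcoeff g (add_mset t m - a))) =
    qcoeff (qderiv t f * g) m" for f g :: "'a qseries" and m
  proof -
    have "(\<Sum>a | a \<subseteq># add_mset t m. of_nat (count a t) * (qcoeff f a * qcoeff g (add_mset t m - a))) =
      (\<Sum>a | a \<subseteq># add_mset t m \<and> t \<in># a. of_nat (count a t) * (qcoeff f a * qcoeff g (add_mset t m - a)))"
      by (rule sum.mono_neutral_right[OF finite_submultisets]) (auto simp: not_in_iff)
    also have "\<dots> = (\<Sum>a | a \<subseteq># m. of_nat (count a t + 1) * (qcoeff f (add_mset t a) * qcoeff g (m - a)))"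
      by (rule sum.reindex_bij_witness[where i = "\<lambda>a. add_mset t a" and j = "\<lambda>a. a - {#t#}"])
        (auto simp: insert_DiffM subset_eq_diff_conv dest: multi_member_split)
    also have "\<dots> = qcoeff (qderiv t f * g) m"
      by (simp add: qcoeff_mult qderiv.rep_eq mult.assoc)
    finally show ?thesis .
  qed
  show ?thesis
  proof (rule qseries_eqI)
    fix m
    have "qcoeff (qderiv t (f * g)) m =
      (\<Sum>a | a \<subseteq># add_mset t m. of_nat (count (add_mset t m) t) * (qcoeff f a * qcoeff g (add_mset t m - a)))"
      by (simp add: qderiv.rep_eq qcoeff_mult sum_distrib_left)
    also have "\<dots> = (\<Sum>a | a \<subseteq># add_mset t m.
        of_nat (count a t) * (qcoeff f a * qcoeff g (add_mset t m - a)) +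
        of_nat (count (add_mset t m - a) t) * (qcoeff f a * qcoeff g (add_mset t m - a)))"
    proof (rule sum.cong[OF refl])
      fix a assume "a \<in> {a. a \<subseteq># add_mset t m}"
      then have "count (add_mset t m) t = count a t + count (add_mset t m - a) t"
        using subset_mset.add_diff_inverse[of a "add_mset t m"] by (metis count_union mem_Collect_eq)
      then show "of_nat (count (add_mset t m) t) * (qcoeff f a * qcoeff g (add_mset t m - a)) =
        of_nat (count a t) * (qcoeff f a * qcoeff g (add_mset t m - a)) +
        of_nat (count (add_mset t m - a) t) * (qcoeff f a * qcoeff g (add_mset t m - a))"
        by (simp only: of_nat_add distrib_right)
    qed
    also have "\<dots> = qcoeff (qderiv t f * g) m +
      (\<Sum>a | a \<subseteq># add_mset t m. of_nat (count (add_mset t m - a) t) * (qcoeff f a * qcoeff g (add_mset t m - a)))"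
      by (simp only: sum.distrib half)
    also have "(\<Sum>a | a \<subseteq># add_mset t m. of_nat (count (add_mset t m - a) t) * (qcoeff f a * qcoeff g (add_mset t m - a))) =
      (\<Sum>a | a \<subseteq># add_mset t m. of_nat (count a t) * (qcoeff g a * qcoeff f (add_mset t m - a)))"
      by (rule sum.reindex_bij_witness[where i = "\<lambda>a. add_mset t m - a" and j = "\<lambda>a. add_mset t m - a"])
        (auto simp: submultiset_compl mult.commute)
    also have "\<dots> = qcoeff (f * qderiv t g) m" by (simp only: half mult.commute[of f])
    finally show "qcoeff (qderiv t (f * g)) m = qcoeff (qderiv t f * g + f * qderiv t g) m" by simp
  qed
qed

lemma fls_dx_zero [simp]: "fls_dx 0 = 0"
  using fls_dx_add[of 0 0] by simp

lemma additive_of_nat_mult: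
  fixes h :: "'a::ring_1 \<Rightarrow> 'b::ring_1"
  assumes "\<And>a b. h (a + b) = h a + h b"
  shows "h (of_nat n * a) = of_nat n * h a"
proof -
  have "h 0 = 0" using assms[of 0 0] by simp
  then show ?thesis by (induction n) (simp_all add: assms distrib_right)
qed

lemma qderiv_translate: "qderiv t (translate k f) = translate k (qderiv t f)"
  unfolding translate_def
  by (rule qseries_eqI) (simp only: qderiv.rep_eq qmap.rep_eq additive_of_nat_mult[of "fls_translate k", OF fls_translate_add])

lemma qderiv_cdx: "qderiv t (cdx f) = cdx (qderiv t f)"
  by (rule qseries_eqI) (simp only: qderiv.rep_eq qmap.rep_eq additive_of_nat_mult[of "fls_dx", OF fls_dx_add])

lemma qderiv_commute:
  fixes f :: "'a::comm_ring_1 qseries"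
  shows "qderiv t (qderiv s f) = qderiv s (qderiv t f)"
  by (rule qseries_eqI) (cases "s = t"; simp add: qderiv.rep_eq add_mset_commute algebra_simps)

text \<open>Independence of \<open>x\<close> and \<open>q\<close>: such coefficients are central scalars for series in \<open>\<Lambda>\<close> and for all
  derivations.\<close>
definition const_coef :: "coef \<Rightarrow> bool" where
  "const_coef c \<longleftrightarrow> (\<forall>k. translate k c = c) \<and> cdx c = 0 \<and> (\<forall>t. qderiv t c = 0)"

lemma qcoeff_qconst: "qcoeff (qconst c) m = (if m = {#} then c else 0)"
  by (simp add: qconst.rep_eq)

lemma const_coef_qconst:
  assumes "\<And>n. \<exists>c. fls_nth f n = smooth_const_fun c"
  shows "const_coef (qconst f)"
proof -
  obtain c where c: "\<And>n. fls_nth f n = smooth_const_fun (c n)" using assms by metis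
  have "fls_dx f = 0" by (rule fls_eqI) (simp add: fls_dx.rep_eq c)
  then show ?thesis
    using fls_translate_const[OF assms]
    unfolding const_coef_def translate_def
    by (auto intro!: qseries_eqI simp: qcoeff_qconst qderiv.rep_eq)
qed

lemma const_coef_cconst: "const_coef (cconst c)"
  unfolding cconst_def
  by (rule const_coef_qconst) (metis fls_const_nth smooth_const_fun_simps(1))

lemma const_coef_eps: "const_coef eps"
  unfolding eps_def by (rule const_coef_qconst) (metis fls_X_nth smooth_const_fun_simps)

lemma const_coef_eps_inv: "const_coef eps_inv"
  unfolding eps_inv_def by (rule const_coef_qconst) (metis fls_X_inv_nth smooth_const_fun_simps)

lemma qmap_zero: "h 0 = 0 \<Longrightarrow> qmap h 0 = 0"
  by (rule qseries_eqI) simp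

lemma cdx_zero [simp]: "cdx 0 = 0" by (rule qmap_zero) simp

lemma qderiv_zero [simp]: "qderiv t 0 = 0"
  using qderiv_add[of t 0 0] by simp

lemma const_coef_mult: "const_coef a \<Longrightarrow> const_coef b \<Longrightarrow> const_coef (a * b)"
  by (simp add: const_coef_def translate_mult cdx_mult qderiv_mult)

lemma cconst_mult: "cconst (a * b) = cconst a * cconst b"
proof (rule qseries_eqI)
  fix m
  have "qcoeff (cconst a * cconst b) m =
    (\<Sum>x\<in>{a. a \<subseteq># m}. if x = {#} then qcoeff (cconst a) x * qcoeff (cconst b) (m - x) else 0)"
    unfolding qcoeff_mult by (rule sum.cong) (auto simp: cconst_def qcoeff_qconst)
  also have "\<dots> = qcoeff (cconst (a * b)) m"
    by (subst sum.delta) (auto simp: finite_submultisets cconst_def qcoeff_qconst fls_const_mult_const smooth_const_fun_mult)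
  finally show "qcoeff (cconst (a * b)) m = qcoeff (cconst a * cconst b) m" by simp
qed

lemma cconst_add: "cconst (a + b) = cconst a + cconst b"
  by (rule qseries_eqI) (auto simp: cconst_def qcoeff_qconst smooth_const_fun_add fls_plus_const)

lemma cconst_1 [simp]: "cconst 1 = 1"
  by (rule qseries_eqI) (simp add: cconst_def qcoeff_qconst one_qseries.rep_eq)

lemma cconst_0 [simp]: "cconst 0 = 0"
  by (rule qseries_eqI) (simp add: cconst_def qcoeff_qconst)

lemma cconst_numeral: "cconst (numeral n) = numeral n"
proof -
  have "cconst (of_nat n) = of_nat n" for n by (induction n) (simp_all add: cconst_add)
  from this[of "numeral n"] show ?thesis by simp
qed

lemma const_coef_simps [simp]: "const_coef 0" "const_coef 1" "const_coef (numeral n)"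
  using const_coef_cconst[of 0] const_coef_cconst[of 1] const_coef_cconst[of "numeral n"]
  by (simp_all add: cconst_numeral)

lemma translate_1 [simp]: "translate k 1 = 1"
  using const_coef_simps(2) unfolding const_coef_def by blast

lemma coef_difference_surj: "\<exists>g. translate 1 g - g = f"
proof -
  have "\<forall>m. \<exists>g. fls_translate 1 g - g = qcoeff f m"
    using fls_difference_surj by blast
  then obtain g where "\<And>m. fls_translate 1 (g m) - g m = qcoeff f m"
    unfolding choice_iff by blast
  then show ?thesis unfolding translate_def
    by (intro exI[of _ "Abs_qseries g"] qseries_eqI) (simp add: Abs_qseries_inverse)
qed

lemma cdx_0_if_translate_1:
  assumes "translate 1 f = f" shows "cdx f = 0"
proof (rule qseries_eqI)
  fix m
  show "qcoeff (cdx f) m = qcoeff 0 m"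
    using assms fls_dx_0_if_translate_1[of "qcoeff f m"] unfolding translate_def
    by (metis qmap.rep_eq zero_qseries.rep_eq)
qed

lemma wf_subset_mset: "wf {(a, b :: 'b multiset). a \<subset># b}"
  by (rule wf_subset[OF wf_measure[of size]]) (auto simp: mset_subset_size)

lemma qseries_unit:
  fixes f :: "'a::comm_ring_1 qseries"
  assumes "qcoeff f {#} * c = 1"
  shows "\<exists>g. f * g = 1"
proof -
  define T where "T s m = qcoeff (f * Abs_qseries s) m" for s m
  have "\<exists>s. \<forall>m. T s m = qcoeff 1 m"
  proof (rule triangular_surj[OF wf_subset_mset, where d = "\<lambda>m. (*) (qcoeff f {#})"])
    fix m and s t :: "time_var multiset \<Rightarrow> 'a"
    assume eq: "\<And>j. (j, m) \<in> {(a, b). a \<subset># b} \<Longrightarrow> s j = t j"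
    have "T s m - T t m = (\<Sum>a | a \<subseteq># m. qcoeff f a * (s (m - a) - t (m - a)))"
      by (simp add: T_def qcoeff_mult Abs_qseries_inverse right_diff_distrib sum_subtractf)
    also have "\<dots> = (\<Sum>a\<in>{{#}}. qcoeff f a * (s (m - a) - t (m - a)))"
    proof (intro sum.mono_neutral_right[OF finite_submultisets] ballI)
      fix a assume "a \<in> {a. a \<subseteq># m} - {{#}}"
      then have "a \<subseteq># m" "a \<noteq> {#}" by auto
      then have "m - a \<subset># m"
        by (metis Diff_eq_empty_iff_mset diff_subset_eq_self subset_mset.le_imp_less_or_eq submultiset_compl cancel_comm_monoid_add_class.diff_cancel)
      then show "qcoeff f a * (s (m - a) - t (m - a)) = 0" using eq by simp
    qed simp
    finally show "T s m - T t m = qcoeff f {#} * (s m - t m)" by simp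
  next
    show "surj ((*) (qcoeff f {#}))"
      by (rule surjI[of _ "\<lambda>x. c * x"]) (simp add: mult.assoc[symmetric] assms)
  qed
  then obtain s where "\<And>m. T s m = qcoeff 1 m" by blast
  then show ?thesis by (intro exI[of _ "Abs_qseries s"] qseries_eqI) (simp add: T_def)
qed


section \<open>Series bounded on one side\<close>

lemma lam_eqI: "(\<And>k. lam_coeff A k = lam_coeff B k) \<Longrightarrow> A = B"
  by (metis lam_coeff_inject ext)

lemmas lam_coeff_simps [simp] = zero_lam_series.rep_eq plus_lam_series.rep_eq minus_lam_series.rep_eq
  uminus_lam_series.rep_eq one_lam_series.rep_eq plus_part.rep_eq minus_part.rep_eq lam_dx.rep_eq
  time_deriv.rep_eq

lemma lam_coeff_lmonom [simp]: "lam_coeff (lmonom a n) k = (if k = n then a else 0)"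
  by (simp add: lmonom_def Abs_lam_series_inverse)

lemma lam_coeff_lscale [simp]: "lam_coeff (lscale a A) k = a * lam_coeff A k"
  by (simp add: lscale_def Abs_lam_series_inverse)

lemma lam_coeff_mult:
  assumes "finite I" "\<And>i. lam_coeff A i \<noteq> 0 \<Longrightarrow> lam_coeff B (k - i) \<noteq> 0 \<Longrightarrow> i \<in> I"
  shows "lam_coeff (A * B) k = (\<Sum>i\<in>I. lam_coeff A i * translate i (lam_coeff B (k - i)))"
  unfolding times_lam_series.rep_eq using assms
  by (intro sum.mono_neutral_left) auto

lemma lam_coeff_lmonom_mult: "lam_coeff (lmonom a n * B) k = a * translate n (lam_coeff B (k - n))"
  by (subst lam_coeff_mult[where I = "{n}"]) (auto split: if_splits)

lemma lam_coeff_mult_lmonom: "lam_coeff (B * lmonom a n) k = lam_coeff B (k - n) * translate (k - n) a"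
  by (subst lam_coeff_mult[where I = "{k - n}"]) (auto split: if_splits)

lemma lscale_eq_mult: "lscale c A = lmonom c 0 * A"
  by (rule lam_eqI) (simp add: lam_coeff_lmonom_mult)

text \<open>The sign \<open>\<sigma>\<close> selects the side: \<open>\<sigma> = 1\<close> for series in \<open>\<Lambda>\<inverse>\<close>, \<open>\<sigma> = -1\<close> for series in \<open>\<Lambda>\<close>.\<close>
definition one_sided :: "int \<Rightarrow> lam_series \<Rightarrow> bool" where
  "one_sided \<sigma> A \<longleftrightarrow> (\<exists>N. \<forall>k. \<sigma> * k > N \<longrightarrow> lam_coeff A k = 0)"

lemma one_sidedI: "(\<And>k. \<sigma> * k > N \<Longrightarrow> lam_coeff A k = 0) \<Longrightarrow> one_sided \<sigma> A"
  unfolding one_sided_def by blast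

lemma one_sided_common:
  assumes "one_sided \<sigma> A" "one_sided \<sigma> B"
  obtains N where "\<And>k. \<sigma> * k > N \<Longrightarrow> lam_coeff A k = 0" "\<And>k. \<sigma> * k > N \<Longrightarrow> lam_coeff B k = 0"
proof -
  obtain N M where "\<And>k. \<sigma> * k > N \<Longrightarrow> lam_coeff A k = 0" "\<And>k. \<sigma> * k > M \<Longrightarrow> lam_coeff B k = 0"
    using assms unfolding one_sided_def by blast
  then show ?thesis by (intro that[of "max N M"]) auto
qed

lemma finite_sided_interval: "\<sigma> = 1 \<or> \<sigma> = -1 \<Longrightarrow> finite {k::int. a \<le> \<sigma> * k \<and> \<sigma> * k \<le> b}"
proof (elim disjE)
  assume "\<sigma> = -1"
  then have "{k. a \<le> \<sigma> * k \<and> \<sigma> * k \<le> b} \<subseteq> {-b..-a}" by auto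
  then show ?thesis by (rule finite_subset) simp
next
  assume "\<sigma> = 1"
  then have "{k. a \<le> \<sigma> * k \<and> \<sigma> * k \<le> b} \<subseteq> {a..b}" by auto
  then show ?thesis by (rule finite_subset) simp
qed

lemma lam_coeff_mult_interval:
  assumes \<sigma>: "\<sigma> = 1 \<or> \<sigma> = -1"
    and A: "\<And>k. \<sigma> * k > N \<Longrightarrow> lam_coeff A k = 0" and B: "\<And>k. \<sigma> * k > M \<Longrightarrow> lam_coeff B k = 0"
    and "N \<le> N'" "a \<le> \<sigma> * k - M"
  shows "lam_coeff (A * B) k =
    (\<Sum>i | a \<le> \<sigma> * i \<and> \<sigma> * i \<le> N'. lam_coeff A i * translate i (lam_coeff B (k - i)))"
proof (rule lam_coeff_mult[OF finite_sided_interval[OF \<sigma>]])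
  fix i assume i: "lam_coeff A i \<noteq> 0" "lam_coeff B (k - i) \<noteq> 0"
  have "\<not> \<sigma> * i > N" "\<not> \<sigma> * (k - i) > M" using A B i by blast+
  then show "i \<in> {i. a \<le> \<sigma> * i \<and> \<sigma> * i \<le> N'}"
    using assms(4,5) by (simp add: right_diff_distrib)
qed

lemma mult_vanishing:
  assumes \<sigma>: "\<sigma> = 1 \<or> \<sigma> = -1"
    and "\<And>k. \<sigma> * k > N \<Longrightarrow> lam_coeff A k = 0" "\<And>k. \<sigma> * k > M \<Longrightarrow> lam_coeff B k = 0"
    and "\<sigma> * k > N + M"
  shows "lam_coeff (A * B) k = 0"
proof (subst lam_coeff_mult[of "{}"])
  fix i assume "lam_coeff A i \<noteq> 0" "lam_coeff B (k - i) \<noteq> 0"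
  then have "\<not> \<sigma> * i > N" "\<not> \<sigma> * (k - i) > M" using assms(2,3) by blast+
  then show "i \<in> {}" using assms(4) by (simp add: right_diff_distrib)
qed auto

lemma one_sided_mult:
  assumes "\<sigma> = 1 \<or> \<sigma> = -1" "one_sided \<sigma> A" "one_sided \<sigma> B"
  shows "one_sided \<sigma> (A * B)"
  by (rule one_sided_common[OF assms(2,3)], rule one_sidedI) (rule mult_vanishing[OF assms(1)])

lemma one_sided_distrib:
  assumes \<sigma>: "\<sigma> = 1 \<or> \<sigma> = -1" and "one_sided \<sigma> A" "one_sided \<sigma> A'" "one_sided \<sigma> B" "one_sided \<sigma> B'"
  shows "(A + A') * B = A * B + A' * B" "A * (B + B') = A * B + A * B'"
proof -
  obtain N where A: "\<And>k. \<sigma> * k > N \<Longrightarrow> lam_coeff A k = 0" "\<And>k. \<sigma> * k > N \<Longrightarrow> lam_coeff A' k = 0"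
    using one_sided_common assms by metis
  obtain M where B: "\<And>k. \<sigma> * k > M \<Longrightarrow> lam_coeff B k = 0" "\<And>k. \<sigma> * k > M \<Longrightarrow> lam_coeff B' k = 0"
    using one_sided_common assms by metis
  note rule = lam_coeff_mult_interval[OF \<sigma>, of N _ M _ N "\<sigma> * _ - M", OF _ _ order_refl order_refl]
  show "(A + A') * B = A * B + A' * B"
    by (rule lam_eqI) (simp add: rule A B sum.distrib distrib_right)
  show "A * (B + B') = A * B + A * B'"
    by (rule lam_eqI) (simp add: rule A B sum.distrib distrib_left translate_add)
qed

lemma one_sided_assoc:
  assumes \<sigma>: "\<sigma> = 1 \<or> \<sigma> = -1" and "one_sided \<sigma> A" "one_sided \<sigma> B" "one_sided \<sigma> C"
  shows "A * B * C = A * (B * C)"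
proof (rule lam_eqI)
  fix m
  let ?a = "lam_coeff A" and ?b = "lam_coeff B" and ?c = "lam_coeff C"
  obtain NA NB NC where
    A: "\<And>k. \<sigma> * k > NA \<Longrightarrow> ?a k = 0" and B: "\<And>k. \<sigma> * k > NB \<Longrightarrow> ?b k = 0"
    and C: "\<And>k. \<sigma> * k > NC \<Longrightarrow> ?c k = 0"
    using assms unfolding one_sided_def by metis
  define I where "I = {i. \<sigma> * m - NC - NB \<le> \<sigma> * i \<and> \<sigma> * i \<le> NA}"
  define K where "K = {k. \<sigma> * m - NC \<le> \<sigma> * k \<and> \<sigma> * k \<le> NA + NB}"
  have AB: "lam_coeff (A * B) k = (\<Sum>i\<in>I. ?a i * translate i (?b (k - i)))" if "k \<in> K" for k
    unfolding I_def by (rule lam_coeff_mult_interval[OF \<sigma> A B]) (use that in \<open>auto simp: K_def\<close>)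
  have BC: "lam_coeff (B * C) (m - i) = (\<Sum>k\<in>K. ?b (k - i) * translate (k - i) (?c (m - k)))"
    if "i \<in> I" for i
  proof -
    have "lam_coeff (B * C) (m - i) = (\<Sum>j\<in>(\<lambda>k. k - i) ` K. ?b j * translate j (?c (m - i - j)))"
    proof (rule lam_coeff_mult)
      show "finite ((\<lambda>k. k - i) ` K)" unfolding K_def using finite_sided_interval[OF \<sigma>] by simp
      fix j assume "?b j \<noteq> 0" "?c (m - i - j) \<noteq> 0"
      then have "\<not> \<sigma> * j > NB" "\<not> \<sigma> * (m - i - j) > NC" using B C by blast+
      then have "i + j \<in> K" using that by (simp add: K_def I_def algebra_simps)
      then show "j \<in> (\<lambda>k. k - i) ` K" by (intro image_eqI[of _ _ "i + j"]) auto
    qed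
    also have "\<dots> = (\<Sum>k\<in>K. ?b (k - i) * translate (k - i) (?c (m - k)))"
      by (subst sum.reindex) (auto simp: inj_on_def)
    finally show ?thesis .
  qed
  have "lam_coeff (A * B * C) m = (\<Sum>k\<in>K. lam_coeff (A * B) k * translate k (?c (m - k)))"
    unfolding K_def by (rule lam_coeff_mult_interval[OF \<sigma> mult_vanishing[OF \<sigma> A B] C]) auto
  also have "\<dots> = (\<Sum>k\<in>K. \<Sum>i\<in>I. ?a i * translate i (?b (k - i)) * translate k (?c (m - k)))"
    by (simp add: AB sum_distrib_right)
  also have "\<dots> = (\<Sum>i\<in>I. \<Sum>k\<in>K. ?a i * translate i (?b (k - i)) * translate k (?c (m - k)))"
    by (rule sum.swap)
  also have "\<dots> = (\<Sum>i\<in>I. ?a i * translate i (lam_coeff (B * C) (m - i)))"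
    by (simp add: BC translate_sum translate_mult translate_compose sum_distrib_left mult.assoc)
  also have "\<dots> = lam_coeff (A * (B * C)) m"
    unfolding I_def by (rule lam_coeff_mult_interval[OF \<sigma> A mult_vanishing[OF \<sigma> B C], symmetric]) auto
  finally show "lam_coeff (A * B * C) m = lam_coeff (A * (B * C)) m" .
qed

text \<open>Applied with \<open>\<partial>\<^sub>x\<close> and with the time derivatives.\<close>
lemma coef_derivation_mult:
  fixes D :: "coef \<Rightarrow> coef"
  assumes \<sigma>: "\<sigma> = 1 \<or> \<sigma> = -1" and "one_sided \<sigma> A" "one_sided \<sigma> B"
    and D: "\<And>f g. D (f + g) = D f + D g" "\<And>f g. D (f * g) = D f * g + f * D g"
      "\<And>k f. D (translate k f) = translate k (D f)"
    and A': "\<And>k. lam_coeff A' k = D (lam_coeff A k)" and B': "\<And>k. lam_coeff B' k = D (lam_coeff B k)"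
  shows "D (lam_coeff (A * B) k) = lam_coeff (A' * B + A * B') k"
proof -
  obtain N where N: "\<And>k. \<sigma> * k > N \<Longrightarrow> lam_coeff A k = 0" "\<And>k. \<sigma> * k > N \<Longrightarrow> lam_coeff B k = 0"
    using one_sided_common assms by metis
  have D0: "D 0 = 0" using D(1)[of 0 0] by simp
  note rule = lam_coeff_mult_interval[OF \<sigma>, of N _ N _ N "\<sigma> * _ - N", OF _ _ order_refl order_refl]
  show ?thesis
    by (simp add: rule N A' B' D0 additive_sum[of D] D sum.distrib)
qed

text \<open>Which side a series is bounded on is recorded in a phantom type argument. In this way each
  computation is done once for \<open>\<P>\<^sub>L\<close> and \<open>\<P>\<^sub>R\<^sup>#\<close>.\<close>
class side =
  fixes orientation :: "'a itself \<Rightarrow> int"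
  assumes orientation: "orientation x = 1 \<or> orientation x = -1"

typedef (overloaded) ('s::side) dseries = "{A. one_sided (orientation TYPE('s)) A}"
  morphisms ser Abs_dseries
  by (rule exI[of _ 0]) (auto intro: one_sidedI)

setup_lifting type_definition_dseries

lemma ser_one_sided: "one_sided (orientation TYPE('s)) (ser (A :: 's::side dseries))"
  using ser[of A] by simp

lemma one_sided_simple:
  assumes "one_sided \<sigma> A" "one_sided \<sigma> B"
  shows "one_sided \<sigma> (A + B)" "one_sided \<sigma> (A - B)" "one_sided \<sigma> (- A)" "one_sided \<sigma> (lscale c A)"
    "one_sided \<sigma> (lam_dx A)" "one_sided \<sigma> (time_deriv t A)" 
    "one_sided \<sigma> (plus_part A)" "one_sided \<sigma> (minus_part A)"
proof -
  obtain N where N: "\<And>k. \<sigma> * k > N \<Longrightarrow> lam_coeff A k = 0" "\<And>k. \<sigma> * k > N \<Longrightarrow> lam_coeff B k = 0"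
    using one_sided_common assms by metis
  show "one_sided \<sigma> (A + B)" "one_sided \<sigma> (A - B)" "one_sided \<sigma> (- A)" "one_sided \<sigma> (lscale c A)"
    "one_sided \<sigma> (lam_dx A)" "one_sided \<sigma> (time_deriv t A)"
    "one_sided \<sigma> (plus_part A)" "one_sided \<sigma> (minus_part A)"
    by (rule one_sidedI[of N]; simp add: N)+
qed

lemma one_sided_lmonom: "one_sided \<sigma> (lmonom a n)"
  by (rule one_sidedI[of "\<sigma> * n"]) auto

instantiation dseries :: (side) ring_1
begin

lift_definition zero_dseries :: "'a dseries" is 0 by (rule one_sidedI) simp
lift_definition one_dseries :: "'a dseries" is 1 by (rule one_sidedI[of 0]) auto
lift_definition plus_dseries :: "'a dseries \<Rightarrow> 'a dseries \<Rightarrow> 'a dseries" is "(+)"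
  by (rule one_sided_simple)
lift_definition minus_dseries :: "'a dseries \<Rightarrow> 'a dseries \<Rightarrow> 'a dseries" is "(-)"
  by (rule one_sided_simple)
lift_definition uminus_dseries :: "'a dseries \<Rightarrow> 'a dseries" is uminus
  by (rule one_sided_simple)
lift_definition times_dseries :: "'a dseries \<Rightarrow> 'a dseries \<Rightarrow> 'a dseries" is "(*)"
  by (rule one_sided_mult[OF orientation])

instance
proof
  fix A B C :: "'a dseries"
  show "A * B * C = A * (B * C)"
    by transfer (rule one_sided_assoc[OF orientation])
  show "(A + B) * C = A * C + B * C" "A * (B + C) = A * B + A * C"
    by (transfer, use one_sided_distrib[OF orientation] in blast)+
  show "1 * A = A"
  proof transfer
    fix A :: lam_series
    have "1 = lmonom 1 0" by (rule lam_eqI) simp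
    then show "1 * A = A" by (metis lscale_eq_mult lam_eqI lam_coeff_lscale mult_1)
  qed
  show "A * 1 = A"
  proof transfer
    fix A :: lam_series
    have "1 = lmonom 1 0" by (rule lam_eqI) simp
    moreover have "A * lmonom 1 0 = A" by (rule lam_eqI) (simp add: lam_coeff_mult_lmonom)
    ultimately show "A * 1 = A" by simp
  qed
  show "(0 :: 'a dseries) \<noteq> 1"
  proof (transfer, rule notI)
    assume "(0 :: lam_series) = 1"
    then have "lam_coeff 0 0 = lam_coeff 1 0" by simp
    then show False by simp
  qed
qed (transfer; simp add: algebra_simps)+

end

lift_definition dscale :: "coef \<Rightarrow> 's::side dseries \<Rightarrow> 's dseries" is lscale by (rule one_sided_simple)
lift_definition ddx :: "'s::side dseries \<Rightarrow> 's dseries" is lam_dx by (rule one_sided_simple)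
lift_definition dtime :: "time_var \<Rightarrow> 's::side dseries \<Rightarrow> 's dseries" is time_deriv by (rule one_sided_simple)
lift_definition dmon :: "coef \<Rightarrow> int \<Rightarrow> 's::side dseries" is lmonom by (rule one_sided_lmonom)

lemmas ser_simps = zero_dseries.rep_eq one_dseries.rep_eq plus_dseries.rep_eq minus_dseries.rep_eq
  uminus_dseries.rep_eq times_dseries.rep_eq dscale.rep_eq ddx.rep_eq dtime.rep_eq dmon.rep_eq

abbreviation dcoeff :: "'s::side dseries \<Rightarrow> int \<Rightarrow> coef" where
  "dcoeff A k \<equiv> lam_coeff (ser A) k"

lemma ser_power: "ser (A ^ n) = ser A ^ n"
  by (induction n) (simp_all add: ser_simps power.power.power_Suc power.power.power_0)

lemma dseries_eqI: "(\<And>k. dcoeff A k = dcoeff B k) \<Longrightarrow> A = B"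
  by (metis lam_eqI ser_inject)

lemma ddx_add: "ddx (A + B) = ddx A + ddx B"
  by (rule dseries_eqI) (simp add: ser_simps cdx_add)

lemma ddx_mult: "ddx (A * B) = ddx A * B + A * ddx B"
  by (rule dseries_eqI, unfold ser_simps lam_dx.rep_eq)
    (rule coef_derivation_mult[OF orientation ser_one_sided ser_one_sided cdx_add cdx_mult cdx_translate], simp_all)

lemma dtime_add: "dtime t (A + B) = dtime t A + dtime t B"
  by (rule dseries_eqI) (simp add: ser_simps qderiv_add)

lemma dtime_mult: "dtime t (A * B) = dtime t A * B + A * dtime t B"
  by (rule dseries_eqI, unfold ser_simps time_deriv.rep_eq)
    (rule coef_derivation_mult[OF orientation ser_one_sided ser_one_sided qderiv_add qderiv_mult qderiv_translate], simp_all)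

lemma dtime_ddx: "dtime t (ddx A) = ddx (dtime t A)"
  by (rule dseries_eqI) (simp add: ser_simps qderiv_cdx)

lemma dtime_commute: "dtime t (dtime s A) = dtime s (dtime t A)"
  by (rule dseries_eqI) (simp add: ser_simps qderiv_commute)

lemma dscale_mult_left: "dscale c A * B = dscale c (A * B)"
proof -
  have e: "dscale c A = dmon c 0 * A" for A :: "'a dseries"
    by (rule dseries_eqI) (simp add: ser_simps lam_coeff_lmonom_mult)
  show ?thesis by (simp add: e mult.assoc)
qed

lemma dscale_mult_right:
  assumes "const_coef c" shows "A * dscale c B = dscale c (A * B)"
proof -
  have 1: "dscale c A = dmon c 0 * A" for A :: "'a dseries"
    by (rule dseries_eqI) (simp add: ser_simps lam_coeff_lmonom_mult)
  have 2: "dscale c A = A * dmon c 0" for A :: "'a dseries"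
    using assms by (intro dseries_eqI) (simp add: ser_simps lam_coeff_mult_lmonom const_coef_def mult.commute)
  show ?thesis by (metis 1 2 mult.assoc)
qed

lemma dscale_add: "dscale c (A + B) = dscale c A + dscale c B"
  by (rule dseries_eqI) (simp add: ser_simps distrib_left)

lemma dscale_dscale: "dscale c (dscale d A) = dscale (c * d) A"
  by (rule dseries_eqI) (simp add: ser_simps mult.assoc)

lemma dscale_derivation:
  assumes "const_coef c"
  shows "ddx (dscale c A) = dscale c (ddx A)" "dtime t (dscale c A) = dscale c (dtime t A)"
  using assms by (auto intro!: dseries_eqI simp: ser_simps cdx_mult qderiv_mult const_coef_def)

definition edx :: "'s::side dseries \<Rightarrow> 's dseries" where
  "edx A = dscale eps (ddx A)"

lemma edx_add: "edx (A + B) = edx A + edx B"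
  by (simp add: edx_def ddx_add dscale_add)

lemma edx_mult: "edx (A * B) = edx A * B + A * edx B"
  by (simp add: edx_def ddx_mult dscale_add dscale_mult_left dscale_mult_right const_coef_eps)

lemma dtime_edx: "dtime t (edx A) = edx (dtime t A)"
  by (simp add: edx_def dscale_derivation const_coef_eps dtime_ddx)


text \<open>\<open>down\<close> tags the ring of \<open>\<P>\<^sub>L\<close>, \<open>up\<close> the ring of \<open>\<P>\<^sub>R\<^sup>#\<close>.\<close>
datatype down = Down
datatype up = Up

instantiation down :: side
begin
definition orientation_down :: "down itself \<Rightarrow> int" where "orientation_down x = 1"
instance by standard (simp add: orientation_down_def)
end

instantiation up :: side
begin
definition orientation_up :: "up itself \<Rightarrow> int" where "orientation_up x = - 1"
instance by standard (simp add: orientation_up_def)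
end

lemmas orientation_simps [simp] = orientation_down_def orientation_up_def

lemma ser_Abs_down: "one_sided 1 A \<Longrightarrow> ser (Abs_dseries A :: down dseries) = A"
  by (simp add: Abs_dseries_inverse)

lemma ser_Abs_up: "one_sided (- 1) A \<Longrightarrow> ser (Abs_dseries A :: up dseries) = A"
  by (simp add: Abs_dseries_inverse)

section \<open>Inverses and the antiinvolution\<close>

lemma lower_one_sided: "lower A \<Longrightarrow> one_sided 1 A"
  unfolding lower_def by (rule one_sidedI[of 0]) auto

lemma lower_mult: "lower A \<Longrightarrow> lower B \<Longrightarrow> lower (A * B)"
  unfolding lower_def using mult_vanishing[of 1 0 A 0 B] by auto

lemma lower_mult_coeff_0:
  assumes "lower A" "lower B" shows "lam_coeff (A * B) 0 = lam_coeff A 0 * lam_coeff B 0"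
  using assms unfolding lower_def
  by (subst lam_coeff_mult[of "{0}"]) (auto, meson linorder_neqE_linordered_idom neg_0_less_iff_less)

lemma lower_right_inverse:
  assumes A: "lower A" and unit: "lam_coeff A 0 * c = 1"
  shows "\<exists>B. lower B \<and> A * B = 1"
proof -
  define mk where "mk s = Abs_lam_series (\<lambda>k. if k \<le> 0 then s (nat (- k)) else 0)" for s :: "nat \<Rightarrow> coef"
  have mk: "lam_coeff (mk s) k = (if k \<le> 0 then s (nat (- k)) else 0)" for s k
    by (simp add: mk_def Abs_lam_series_inverse)
  have lower_mk: "lower (mk s)" for s by (simp add: lower_def mk)
  define T where "T s k = lam_coeff (A * mk s) (- int k)" for s k
  have T_eq: "T s k = (\<Sum>i\<le>k. lam_coeff A (- int i) * translate (- int i) (s (k - i)))" for s k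
  proof -
    have "T s k = (\<Sum>i\<in>(\<lambda>i. - int i) ` {..k}. lam_coeff A i * translate i (lam_coeff (mk s) (- int k - i)))"
      unfolding T_def
    proof (rule lam_coeff_mult)
      fix i assume "lam_coeff A i \<noteq> 0" "lam_coeff (mk s) (- int k - i) \<noteq> 0"
      then have "i \<le> 0" "- int k \<le> i" using A by (auto simp: lower_def mk not_less[symmetric] split: if_splits)
      then show "i \<in> (\<lambda>i. - int i) ` {..k}" by (intro image_eqI[of _ _ "nat (- i)"]) auto
    qed simp
    also have "\<dots> = (\<Sum>i\<le>k. lam_coeff A (- int i) * translate (- int i) (s (k - i)))"
      by (subst sum.reindex) (auto simp: inj_on_def mk nat_diff_distrib' intro!: sum.cong)
    finally show ?thesis .
  qed
  have "\<exists>s. \<forall>k. T s k = (if k = 0 then 1 else 0)"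
  proof (rule triangular_surj[where R = less_than and d = "\<lambda>k. (*) (lam_coeff A 0)"])
    fix k and s t :: "nat \<Rightarrow> coef" assume eq: "\<And>j. (j, k) \<in> less_than \<Longrightarrow> s j = t j"
    have "T s k - T t k = (\<Sum>i\<le>k. lam_coeff A (- int i) * translate (- int i) (s (k - i) - t (k - i)))"
      by (simp add: T_eq translate_diff right_diff_distrib sum_subtractf)
    also have "\<dots> = (\<Sum>i\<in>{0}. lam_coeff A (- int i) * translate (- int i) (s (k - i) - t (k - i)))"
      using eq by (intro sum.mono_neutral_right) auto
    finally show "T s k - T t k = lam_coeff A 0 * (s k - t k)" by simp
  next
    show "surj ((*) (lam_coeff A 0))"
      by (rule surjI[of _ "\<lambda>x. c * x"]) (simp add: mult.assoc[symmetric] unit)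
  qed simp
  then obtain s where s: "\<And>k. T s k = (if k = 0 then 1 else 0)" by blast
  have "lam_coeff (A * mk s) k = lam_coeff 1 k" for k
  proof (cases "k > 0")
    case True
    then show ?thesis using lower_mult[OF A lower_mk] by (simp add: lower_def)
  next
    case False
    then show ?thesis using s[of "nat (- k)"] by (simp add: T_def)
  qed
  then show ?thesis using lower_mk lam_eqI by blast
qed

lemma lower_mult_assoc: "lower A \<Longrightarrow> lower B \<Longrightarrow> lower C \<Longrightarrow> A * B * C = A * (B * C)"
  using one_sided_assoc[of 1 A B C] lower_one_sided by blast

lemma lam_mult_1 [simp]: "A * (1 :: lam_series) = A" "1 * A = A"
proof -
  have *: "1 = lmonom 1 0" by (rule lam_eqI) simp
  show "A * 1 = A" by (rule lam_eqI) (simp only: * lam_coeff_mult_lmonom, simp)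
  show "1 * A = A" by (rule lam_eqI) (simp only: * lam_coeff_lmonom_mult, simp)
qed

text \<open>Right inverses suffice: the right inverse \<open>B\<close> is again lower with invertible leading
  coefficient, so it has a right inverse too, which must then be \<open>A\<close>.\<close>
lemma lower_invertible_iff:
  "lower A \<Longrightarrow> lower_invertible A \<longleftrightarrow> (\<exists>c. lam_coeff A 0 * c = 1)"
proof
  assume A: "lower A" and "\<exists>c. lam_coeff A 0 * c = 1"
  then obtain B where B: "lower B" "A * B = 1" using lower_right_inverse by blast
  have "lam_coeff B 0 * lam_coeff A 0 = 1"
    using lower_mult_coeff_0[OF A B(1)] B(2) by (simp add: mult.commute)
  then obtain C where C: "lower C" "B * C = 1" using lower_right_inverse[OF B(1)] by blast
  have "C = A" using lower_mult_assoc[OF A B(1) C(1)] B(2) C(2) by simp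
  then show "lower_invertible A" using B C unfolding lower_invertible_def by blast
next
  assume A: "lower A" and "lower_invertible A"
  then obtain B where "lower B" "A * B = 1" unfolding lower_invertible_def by blast
  then show "\<exists>c. lam_coeff A 0 * c = 1" using lower_mult_coeff_0[OF A] by (metis lam_coeff_simps(5))
qed

lemma lower_inv_unique:
  assumes "lower A" "lower B" "A * B = 1" "B * A = 1"
  shows "lower_inv A = B"
  unfolding lower_inv_def
proof (rule the_equality)
  fix C assume C: "lower C \<and> A * C = 1 \<and> C * A = 1"
  then show "C = B" using lower_mult_assoc[of C A B] assms by simp
qed (use assms in blast)

lemma lower_inv:
  assumes "lower A" "lower_invertible A"
  shows "lower (lower_inv A)" "A * lower_inv A = 1" "lower_inv A * A = 1"
  using assms lower_inv_unique unfolding lower_invertible_def by auto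

lemma sharp_coeff [simp]: "lam_coeff (sharp Q A) k = cconst (Q powi (- k)) * translate k (lam_coeff A (- k))"
  by (simp add: sharp.rep_eq)

lemma translate_cconst [simp]: "translate k (cconst c) = cconst c"
  using const_coef_cconst by (simp add: const_coef_def)

lemma sharp_mult:
  assumes "Q \<noteq> 0" "one_sided 1 A" "one_sided 1 B"
  shows "sharp Q (A * B) = sharp Q B * sharp Q A"
proof (rule lam_eqI)
  fix k
  let ?a = "lam_coeff A" and ?b = "lam_coeff B"
  obtain N where N: "\<And>k. 1 * k > N \<Longrightarrow> ?a k = 0" "\<And>k. 1 * k > N \<Longrightarrow> ?b k = 0"
    using one_sided_common assms by metis
  define I where "I = {- k - N..N}"
  have I: "i \<in> I" if "?a i \<noteq> 0" "?b (- k - i) \<noteq> 0" for i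
  proof -
    have "\<not> 1 * i > N" "\<not> 1 * (- k - i) > N" using N that by blast+
    then show ?thesis unfolding I_def by simp
  qed
  have "lam_coeff (sharp Q B * sharp Q A) k = (\<Sum>j\<in>(\<lambda>i. k + i) ` I.
      lam_coeff (sharp Q B) j * translate j (lam_coeff (sharp Q A) (k - j)))"
  proof (rule lam_coeff_mult)
    fix j assume "lam_coeff (sharp Q B) j \<noteq> 0" "lam_coeff (sharp Q A) (k - j) \<noteq> 0"
    then have "?b (- j) \<noteq> 0" "?a (j - k) \<noteq> 0" by auto
    then have "j - k \<in> I" using I[of "j - k"] by simp
    then show "j \<in> (\<lambda>i. k + i) ` I" by (intro image_eqI[of _ _ "j - k"]) auto
  qed (simp add: I_def)
  also have "\<dots> = (\<Sum>i\<in>I. cconst (Q powi (- k)) * translate k (?a i * translate i (?b (- k - i))))"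
  proof (subst sum.reindex)
    have "cconst (Q powi (- k - i)) * (f * (cconst (Q powi i) * g)) = cconst (Q powi (- k)) * (g * f)" for i f g
    proof -
      have "cconst (Q powi (- k - i)) * cconst (Q powi i) = cconst (Q powi (- k))"
        using \<open>Q \<noteq> 0\<close> power_int_add[of Q "- k - i" i] by (simp flip: cconst_mult)
      then show ?thesis by (metis (no_types) mult.assoc mult.commute)
    qed
    then show "sum ((\<lambda>j. lam_coeff (sharp Q B) j * translate j (lam_coeff (sharp Q A) (k - j))) \<circ> (\<lambda>i. k + i)) I =
      (\<Sum>i\<in>I. cconst (Q powi (- k)) * translate k (?a i * translate i (?b (- k - i))))"
      by (simp add: translate_mult translate_compose mult.assoc)
  qed simp
  also have "\<dots> = cconst (Q powi (- k)) * translate k (lam_coeff (A * B) (- k))"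
    by (subst lam_coeff_mult[of I]) (use I in \<open>auto simp: I_def translate_sum sum_distrib_left\<close>)
  finally show "lam_coeff (sharp Q (A * B)) k = lam_coeff (sharp Q B * sharp Q A) k" by simp
qed

lemma sharp_sharp: "Q \<noteq> 0 \<Longrightarrow> sharp Q (sharp Q A) = A"
  by (rule lam_eqI)
    (simp add: translate_mult translate_compose mult.assoc[symmetric] power_int_minus flip: cconst_mult)

lemma sharp_1 [simp]: "sharp Q 1 = 1"
  by (rule lam_eqI) simp

lemma sharp_shift: "sharp Q (lmonom 1 1) = lmonom (cconst Q) (- 1)"
  by (rule lam_eqI) (auto simp: power_int_minus)

lemma sharp_dx: "sharp Q (lam_dx A) = lam_dx (sharp Q A)"
  using const_coef_cconst
  by (intro lam_eqI) (simp add: cdx_mult cdx_translate const_coef_def)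

lemma sharp_one_sided: "one_sided 1 A \<Longrightarrow> one_sided (- 1) (sharp Q A)"
proof -
  assume "one_sided 1 A"
  then obtain N where "\<And>k. 1 * k > N \<Longrightarrow> lam_coeff A k = 0" unfolding one_sided_def by blast
  then show ?thesis by (intro one_sidedI[of N]) simp
qed

section \<open>Dressing operators\<close>

definition dresses :: "'s::side dseries \<Rightarrow> 's dseries \<Rightarrow> 's dseries \<Rightarrow> 's dseries \<Rightarrow> bool" where
  "dresses Z L P P' \<longleftrightarrow> P * P' = 1 \<and> P' * P = 1 \<and> L = P * Z * P'"

lemma dresses_alt:
  assumes "P * P' = 1" "P' * P = 1"
  shows "dresses Z L P P' \<longleftrightarrow> L * P = P * Z"
  using assms unfolding dresses_def by (metis mult.assoc mult_1_right)

text \<open>The last property holds for \<open>\<Lambda>\<close> and \<open>Q\<Lambda>\<inverse>\<close> because the coefficients of an operator that commutes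
  with them are invariant under translation.\<close>
definition rigid :: "'s::side dseries \<Rightarrow> bool" where
  "rigid Z \<longleftrightarrow> edx Z = 0 \<and> (\<forall>t. dtime t Z = 0) \<and> (\<forall>c. c * Z = Z * c \<longrightarrow> edx c = 0)"

lemma edx_0_if_cdx: "(\<And>k. cdx (dcoeff A k) = 0) \<Longrightarrow> edx A = 0"
  by (rule dseries_eqI) (simp add: edx_def ser_simps)

lemma const_coefD: "const_coef c \<Longrightarrow> translate k c = c" "const_coef c \<Longrightarrow> cdx c = 0" "const_coef c \<Longrightarrow> qderiv t c = 0"
  by (simp_all add: const_coef_def)

lemma rigid_dmon:
  assumes c: "const_coef c" "c * d = 1" and n: "n = 1 \<or> n = -1"
  shows "rigid (dmon c n)"
  unfolding rigid_def
proof (intro conjI allI impI)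
  show "edx (dmon c n) = 0" using c by (intro edx_0_if_cdx) (simp add: ser_simps const_coefD)
  show "dtime t (dmon c n) = 0" for t
    using c by (intro dseries_eqI) (simp add: ser_simps const_coefD)
next
  fix A :: "'a dseries" assume *: "A * dmon c n = dmon c n * A"
  have "cdx (dcoeff A k) = 0" for k
  proof -
    have "lam_coeff (ser A * lmonom c n) (k + n) = lam_coeff (lmonom c n * ser A) (k + n)"
      using arg_cong[OF *, of ser] by (simp add: ser_simps)
    then have "dcoeff A k * c * d = translate n (dcoeff A k) * c * d"
      using c by (simp add: lam_coeff_lmonom_mult lam_coeff_mult_lmonom const_coefD mult.commute)
    then have "dcoeff A k = translate n (dcoeff A k)" using c(2) by (simp add: mult.assoc)
    then have "translate 1 (dcoeff A k) = dcoeff A k"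
      using n by (metis translate_compose translate_0 add.right_inverse)
    then show ?thesis by (rule cdx_0_if_translate_1)
  qed
  then show "edx A = 0" by (rule edx_0_if_cdx)
qed

lemma cconst_inverse: "Q \<noteq> 0 \<Longrightarrow> cconst Q * cconst (1 / Q) = 1"
  by (simp flip: cconst_mult)

lemma rigid_shift: "rigid (dmon 1 1)" "Q \<noteq> 0 \<Longrightarrow> rigid (dmon (cconst Q) (- 1))"
  using rigid_dmon[of 1 1 1] rigid_dmon[of "cconst Q" "cconst (1/Q)" "- 1"] cconst_inverse const_coef_cconst
  by auto

text \<open>Since \<open>#\<close> reverses products, \<open>\<L> = (\<P>\<^sub>R\<inverse> \<Lambda> \<P>\<^sub>R)\<^sup>#\<close> says that \<open>\<P>\<^sub>R\<^sup>#\<close> dresses \<open>\<Lambda>\<^sup># = Q\<Lambda>\<inverse>\<close>: both halves of a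
  dressing pair have the same form \<open>\<L> = P Z P\<inverse>\<close>, in two different rings.\<close>
lemma dressing_pair_iff:
  assumes "Q \<noteq> 0" "one_sided 1 L" "one_sided (- 1) L"
  shows "dressing_pair Q L PL PR \<longleftrightarrow>
    lower PL \<and> lam_coeff PL 0 = 1 \<and> lower PR \<and> lower_invertible PR \<and>
    dresses (dmon 1 1) (Abs_dseries L :: down dseries) (Abs_dseries PL) (Abs_dseries (lower_inv PL)) \<and>
    dresses (dmon (cconst Q) (- 1)) (Abs_dseries L :: up dseries) (Abs_dseries (sharp Q PR))
      (Abs_dseries (sharp Q (lower_inv PR)))"
proof -
  have "(L = PL * lmonom 1 1 * lower_inv PL) \<longleftrightarrow>
     dresses (dmon 1 1) (Abs_dseries L :: down dseries) (Abs_dseries PL) (Abs_dseries (lower_inv PL))"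
    if PL: "lower PL" "lam_coeff PL 0 = 1"
  proof -
    have "lower_invertible PL" using PL by (simp add: lower_invertible_iff)
    note PL' = lower_inv[OF PL(1) this]
    show ?thesis
      using PL PL' assms by (auto simp: dresses_def ser_inject[symmetric] ser_simps ser_Abs_down lower_one_sided)
  qed
  moreover have "(L = sharp Q (lower_inv PR * lmonom 1 1 * PR)) \<longleftrightarrow>
    dresses (dmon (cconst Q) (- 1)) (Abs_dseries L :: up dseries) (Abs_dseries (sharp Q PR))
      (Abs_dseries (sharp Q (lower_inv PR)))"
    if PR: "lower PR" "lower_invertible PR"
  proof -
    note PR' = lower_inv[OF PR]
    note os = lower_one_sided[OF PR(1)] lower_one_sided[OF PR'(1)] one_sided_lmonom[of 1]
    note os' = sharp_one_sided[OF os(1)] sharp_one_sided[OF os(2)]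
    have "sharp Q (lower_inv PR * lmonom 1 1 * PR) = sharp Q PR * (lmonom (cconst Q) (- 1) * sharp Q (lower_inv PR))"
      using os assms(1) by (simp add: sharp_mult one_sided_mult sharp_shift)
    also have "\<dots> = sharp Q PR * lmonom (cconst Q) (- 1) * sharp Q (lower_inv PR)"
      using one_sided_assoc[OF _ os'(1) one_sided_lmonom os'(2)] by simp
    finally have "sharp Q (lower_inv PR * lmonom 1 1 * PR) = sharp Q PR * lmonom (cconst Q) (- 1) * sharp Q (lower_inv PR)" .
    moreover have "sharp Q PR * sharp Q (lower_inv PR) = 1" "sharp Q (lower_inv PR) * sharp Q PR = 1"
      using os assms(1) PR' by (simp_all flip: sharp_mult)
    ultimately show ?thesis
      using os' assms by (auto simp: dresses_def ser_inject[symmetric] ser_simps ser_Abs_up)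
  qed
  ultimately show ?thesis unfolding dressing_pair_def by blast
qed

text \<open>\<open>P \<epsilon>\<partial>\<^sub>x P\<inverse> - \<epsilon>\<partial>\<^sub>x\<close>, for \<open>P' = P\<inverse>\<close>.\<close>
definition log_part :: "'s::side dseries \<Rightarrow> 's dseries \<Rightarrow> 's dseries" where
  "log_part P P' = - (edx P * P')"

lemma dresses_commutes:
  assumes "dresses Z L P P'" "X * L = L * X"
  shows "(P' * X * P) * Z = Z * (P' * X * P)"
proof -
  have P: "P' * P = 1" and L: "L * P = P * Z" "P' * L = Z * P'"
    using assms(1) unfolding dresses_def by (metis mult.assoc mult_1_right mult_1_left)+
  have "(P' * X * P) * Z = P' * (X * L) * P" using L(1) by (simp add: mult.assoc)
  also have "\<dots> = Z * (P' * X * P)" using L(2) by (simp add: assms(2)) (metis mult.assoc)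
  finally show ?thesis .
qed

text \<open>Two dressings differ by an operator that commutes with \<open>Z\<close>, hence does not depend on \<open>x\<close> and
  drops out of \<open>P \<epsilon>\<partial>\<^sub>x P\<inverse>\<close>.\<close>
lemma log_part_unique:
  assumes "rigid Z" "dresses Z L P P'" "dresses Z L R R'"
  shows "log_part P P' = log_part R R'"
proof -
  have P: "P * P' = 1" "P' * P = 1" "L = P * Z * P'" and R: "R * R' = 1" "R' * R = 1" "L = R * Z * R'"
    using assms unfolding dresses_def by auto
  have "(P' * R) * Z = P' * (R * Z * R') * R" using R(2) by (simp add: mult.assoc)
  also have "\<dots> = P' * (P * Z * P') * R" using P(3) R(3) by simp
  also have "\<dots> = (P' * P) * Z * (P' * R)" by (simp only: mult.assoc)
  finally have "edx (P' * R) = 0" using assms(1) P(2) by (simp add: rigid_def)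
  moreover have "R = P * (P' * R)" using P(1) by (simp flip: mult.assoc)
  ultimately have "edx R = edx P * (P' * R)" by (metis edx_mult mult_zero_right add.right_neutral)
  then show ?thesis unfolding log_part_def using R(1) by (simp add: mult.assoc)
qed

text \<open>The antiinvolution turns \<open>\<epsilon>\<partial>\<^sub>x\<close> into \<open>log Q - \<epsilon>\<partial>\<^sub>x\<close>, whence the minus sign of the second part.\<close>
lemma dressing_log_eq:
  assumes "Q \<noteq> 0" "one_sided 1 L" "one_sided (- 1) L" "dressing_pair Q L PL PR"
  shows "dressing_log Q logQ PL PR = lscale (cconst (1 / 2)) (lmonom (cconst logQ) 0
    + ser (log_part (Abs_dseries PL :: down dseries) (Abs_dseries (lower_inv PL)))
    - ser (log_part (Abs_dseries (sharp Q PR) :: up dseries) (Abs_dseries (sharp Q (lower_inv PR)))))"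
proof -
  have l: "lower PL" "lower_invertible PL" "lower PR" "lower_invertible PR"
    using assms(4) lower_invertible_iff[of PL] unfolding dressing_pair_def by auto
  note os = l(1,3)[THEN lower_one_sided] lower_inv(1)[OF l(1,2), THEN lower_one_sided]
    lower_inv(1)[OF l(3,4), THEN lower_one_sided]
  have 1: "lscale eps A * B = lscale eps (A * B)" if "one_sided \<sigma> A" "one_sided \<sigma> B" "\<sigma> = 1 \<or> \<sigma> = -1" for \<sigma> A B
    using one_sided_assoc[OF that(3) one_sided_lmonom[of _ eps 0] that(1,2)] by (simp add: lscale_eq_mult)
  have d: "ser (log_part (Abs_dseries PL :: down dseries) (Abs_dseries (lower_inv PL)))
    = - lscale eps (lam_dx PL * lower_inv PL)"
    using os by (simp add: log_part_def edx_def ser_simps ser_Abs_down 1[of 1] one_sided_simple(5)[OF os(1) os(1)])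
  have "lscale eps (lam_dx (sharp Q PR)) * sharp Q (lower_inv PR) =
    lscale eps (lam_dx (sharp Q PR) * sharp Q (lower_inv PR))"
    using os(2,4)[THEN sharp_one_sided] by (intro 1[of "- 1"]) (auto intro: one_sided_simple)
  then have u: "ser (log_part (Abs_dseries (sharp Q PR) :: up dseries) (Abs_dseries (sharp Q (lower_inv PR))))
    = - lscale eps (sharp Q (lower_inv PR * lam_dx PR))"
    using os os(2,4)[THEN sharp_one_sided] assms(1)
    by (simp add: log_part_def edx_def ser_simps ser_Abs_up sharp_mult one_sided_simple(5)[OF os(2) os(2)] sharp_dx)
  show ?thesis unfolding dressing_log_def d u by (rule arg_cong[of _ _ "lscale _"]) simp
qed

lemma lax_log_eq:
  assumes "Q \<noteq> 0" "one_sided 1 L" "one_sided (- 1) L" "dressing_pair Q L PL PR"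
  shows "lax_log Q logQ L = dressing_log Q logQ PL PR"
  unfolding lax_log_def
proof (rule the_equality)
  fix l assume "\<exists>PL PR. dressing_pair Q L PL PR \<and> l = dressing_log Q logQ PL PR"
  then obtain PL2 PR2 where l: "dressing_pair Q L PL2 PR2" "l = dressing_log Q logQ PL2 PR2" by blast
  note iff = dressing_pair_iff[OF assms(1-3), THEN iffD1]
  have "log_part (Abs_dseries PL2 :: down dseries) (Abs_dseries (lower_inv PL2)) =
      log_part (Abs_dseries PL) (Abs_dseries (lower_inv PL))"
    using iff[OF l(1)] iff[OF assms(4)] by (intro log_part_unique[OF rigid_shift(1)]) blast+
  moreover have "log_part (Abs_dseries (sharp Q PR2) :: up dseries) (Abs_dseries (sharp Q (lower_inv PR2))) =
      log_part (Abs_dseries (sharp Q PR)) (Abs_dseries (sharp Q (lower_inv PR)))"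
    using iff[OF l(1)] iff[OF assms(4)] by (intro log_part_unique[OF rigid_shift(2)[OF assms(1)]]) blast+
  ultimately show "l = dressing_log Q logQ PL PR"
    using l assms by (simp add: dressing_log_eq)
qed (use assms in blast)


section \<open>Zero curvature\<close>

lemma dseries_derivation_simps [simp]:
  "edx 0 = 0" "dtime t 0 = 0" "edx (- A) = - edx A" "dtime t (- A) = - dtime t A"
  "edx (A - B) = edx A - edx B" "dtime t (A - B) = dtime t A - dtime t B"
  "edx 1 = 0" "dtime t 1 = 0"
proof -
  show z: "edx 0 = 0" "dtime t 0 = 0"
    using edx_add[of 0 0] dtime_add[of t 0 0] by simp_all
  show m: "edx (- A) = - edx A" "dtime t (- A) = - dtime t A" for A
    using edx_add[of A "- A", symmetric] dtime_add[of t A "- A", symmetric] z by (simp_all add: eq_neg_iff_add_eq_0 add.commute)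
  show "edx (A - B) = edx A - edx B" "dtime t (A - B) = dtime t A - dtime t B"
    using edx_add[of A "- B"] dtime_add[of t A "- B"] m by simp_all
  show "edx 1 = 0" "dtime t 1 = 0"
    using edx_mult[of 1 1] dtime_mult[of t 1 1] by simp_all
qed

text \<open>Read \<open>X\<^sub>t = A\<^sub>t + K\<^sub>t \<epsilon>\<partial>\<^sub>x = K\<^sub>t (a + \<epsilon>\<partial>\<^sub>x) + B\<^sub>t\<close> as an operator. The hypotheses say that the
  operators \<open>K\<^sub>s\<close>, \<open>B\<^sub>s\<close> and \<open>a + \<epsilon>\<partial>\<^sub>x\<close> commute with each other and with all \<open>\<partial>\<^sub>t + M\<^sub>t\<close>; so the \<open>X\<^sub>t\<close> do too,
  and subtracting them from the connection \<open>\<partial>\<^sub>t + M\<^sub>t\<close> does not change its curvature. The right-hand side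
  is the curvature of \<open>\<partial>\<^sub>t + M\<^sub>t - X\<^sub>t = \<partial>\<^sub>t - E\<^sub>t - K\<^sub>t \<epsilon>\<partial>\<^sub>x\<close>, applied to \<open>1\<close>. Its advantage is that \<open>E\<^sub>t\<close> and
  \<open>K\<^sub>t\<close> will turn out to be Laurent polynomials in \<open>\<Lambda>\<close>.\<close>
lemma curvature_of_potentials:
  fixes K B M A E :: "time_var \<Rightarrow> 's::side dseries"
  assumes comm: "K s * K t = K t * K s" "K s * B t = B t * K s" "K t * B s = B s * K t" "B s * B t = B t * B s"
    and a: "\<And>t. a * K t = K t * a - edx (K t)" "\<And>t. a * B t = B t * a - edx (B t)"
    and flow: "\<And>s t. dtime s (K t) = K t * M s - M s * K t" "\<And>s t. dtime s (B t) = B t * M s - M s * B t"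
      "\<And>s. dtime s a = edx (M s) - M s * a + a * M s"
    and A: "\<And>t. A t = K t * a + B t" and E: "\<And>t. E t = A t - M t"
  shows "dtime s (M t) - dtime t (M s) + (M s * M t - M t * M s) =
    dtime t (E s) - dtime s (E t) + (E s * E t - E t * E s) + K s * edx (E t) - K t * edx (E s)"
proof -
  \<comment> \<open>\<open>[\<partial>\<^sub>s + M\<^sub>s, X\<^sub>t] = 0\<close>, the part without \<open>\<epsilon>\<partial>\<^sub>x\<close>\<close>
  have flow_A: "dtime s (A t) = K t * edx (M s) + A t * M s - M s * A t" for s t
    unfolding A dtime_add dtime_mult flow by (simp add: algebra_simps)
  have AA: "A s * A t = K s * K t * a * a - K s * edx (K t) * a + K s * B t * a - K s * edx (B t)
      + B s * K t * a + B s * B t" for s t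
  proof -
    have "A s * A t = K s * (a * K t) * a + K s * (a * B t) + B s * K t * a + B s * B t"
      unfolding A by (simp add: algebra_simps)
    then show ?thesis unfolding a by (simp add: algebra_simps)
  qed
  have edx_A: "edx (A t) = edx (K t) * a + K t * edx a + edx (B t)" for t
    unfolding A by (simp add: edx_add edx_mult)
  \<comment> \<open>\<open>[X\<^sub>s, X\<^sub>t] = 0\<close>, the part without \<open>\<epsilon>\<partial>\<^sub>x\<close>\<close>
  have "A s * A t - A t * A s = K t * edx (A s) - K s * edx (A t)"
    unfolding AA edx_A using comm by (simp add: algebra_simps flip: mult.assoc)
  then have "A s * A t - A t * A s + K s * edx (A t) - K t * edx (A s) = 0" by simp
  moreover have "dtime t (E s) - dtime s (E t) + (E s * E t - E t * E s) + K s * edx (E t) - K t * edx (E s) =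
    dtime s (M t) - dtime t (M s) + (M s * M t - M t * M s) + (A s * A t - A t * A s + K s * edx (A t) - K t * edx (A s))"
    unfolding E by (simp add: flow_A algebra_simps)
  ultimately show ?thesis by simp
qed

lemma edx_inverse:
  assumes "P * P' = 1" "P' * P = 1" shows "edx P' = - (P' * edx P * P')"
proof -
  have "edx P * P' + P * edx P' = 0" using arg_cong[OF assms(1), of edx] by (simp add: edx_mult)
  then have "P * edx P' = - (edx P * P')" by (simp add: eq_neg_iff_add_eq_0 add.commute)
  then have "P' * (P * edx P') = P' * - (edx P * P')" by simp
  then show ?thesis using assms by (simp flip: mult.assoc)
qed

lemma dtime_inverse:
  assumes "P * P' = 1" "P' * P = 1" shows "dtime t P' = - (P' * dtime t P * P')"
proof -
  have "dtime t P * P' + P * dtime t P' = 0" using arg_cong[OF assms(1), of "dtime t"] by (simp add: dtime_mult)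
  then have "P * dtime t P' = - (dtime t P * P')" by (simp add: eq_neg_iff_add_eq_0 add.commute)
  then have "P' * (P * dtime t P') = P' * - (dtime t P * P')" by simp
  then show ?thesis using assms by (simp flip: mult.assoc)
qed

text \<open>\<open>P \<epsilon>\<partial>\<^sub>x P\<inverse>\<close> commutes with \<open>L = P Z P\<inverse>\<close> because \<open>\<epsilon>\<partial>\<^sub>x\<close> commutes with \<open>Z\<close>.\<close>
lemma log_part_commute:
  assumes "rigid Z" "dresses Z L P P'"
  shows "log_part P P' * L = L * log_part P P' - edx L"
proof -
  have P: "P * P' = 1" "P' * P = 1" and L: "L = P * Z * P'" "L * P = P * Z"
    using assms(2) dresses_alt unfolding dresses_def by blast+
  have "edx L = edx P * (Z * P') - P * Z * P' * edx P * P'"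
    using assms(1) by (simp add: L(1) edx_mult edx_inverse[OF P] rigid_def algebra_simps)
  also have "\<dots> = edx P * (P' * P * Z * P') - L * (edx P * P')"
    using L P by (simp add: mult.assoc)
  also have "\<dots> = edx P * P' * L - L * (edx P * P')" using L by (simp add: mult.assoc)
  finally show ?thesis by (simp add: log_part_def)
qed

lemma dtime_dressed:
  assumes "rigid Z" "dresses Z L P P'"
  shows "dtime t L = dtime t P * P' * L - L * (dtime t P * P')"
proof -
  have P: "P * P' = 1" "P' * P = 1" and L: "L = P * Z * P'" "L * P = P * Z"
    using assms(2) dresses_alt unfolding dresses_def by blast+
  have "dtime t L = dtime t P * (Z * P') - P * Z * P' * dtime t P * P'"
    using assms(1) by (simp add: L(1) dtime_mult dtime_inverse[OF P] rigid_def algebra_simps)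
  also have "\<dots> = dtime t P * (P' * P * Z * P') - L * (dtime t P * P')"
    using L P by (simp add: mult.assoc)
  also have "\<dots> = dtime t P * P' * L - L * (dtime t P * P')" using L by (simp add: mult.assoc)
  finally show ?thesis .
qed

text \<open>\<open>P \<epsilon>\<partial>\<^sub>x P\<inverse>\<close> commutes with \<open>\<partial>\<^sub>t + M\<close>, for every dressing \<open>P\<close>, whether or not it satisfies the flow
  itself: \<open>P\<inverse> (\<partial>\<^sub>t + M) P = \<partial>\<^sub>t + c\<close>, and since \<open>L\<close> satisfies its flow, \<open>c\<close> commutes with \<open>Z\<close>, so it does not
  depend on \<open>x\<close> and commutes with \<open>\<epsilon>\<partial>\<^sub>x\<close>.\<close>
lemma log_part_flow:
  assumes "rigid Z" "dresses Z L P P'" and flow: "dtime t L = L * M - M * L"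
  shows "dtime t (log_part P P') = edx M - M * log_part P P' + log_part P P' * M"
proof -
  have P: "P * P' = 1" "P' * P = 1" using assms(2) unfolding dresses_def by blast+
  define X where "X = dtime t P * P' + M"
  define c where "c = P' * X * P"
  have "X * L = L * X"
    using flow dtime_dressed[OF assms(1,2), of t] unfolding X_def by (simp add: algebra_simps)
  then have "edx c = 0"
    using assms(1) dresses_commutes[OF assms(2)] unfolding rigid_def c_def by blast
  have "P * c = X * P" unfolding c_def using P by (simp flip: mult.assoc)
  then have dP: "dtime t P = P * c - M * P" unfolding X_def using P by (simp add: distrib_right mult.assoc)
  have P2: "P' * (P * x) = x" "P * (P' * x) = x" for x using P by (simp_all flip: mult.assoc)
  show ?thesis
    unfolding log_part_def
    by (simp add: dtime_mult dtime_edx dP dtime_inverse[OF P] edx_mult \<open>edx c = 0\<close> algebra_simps P P2)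
qed

section \<open>The decomposition of the flow operators\<close>

text \<open>The operator \<open>H\<^sub>t\<close> with \<open>\<partial>\<^sub>t \<L> = [(H\<^sub>t)\<^sub>+, \<L>]\<close>.\<close>
definition flow_op :: "complex \<Rightarrow> complex \<Rightarrow> lam_series \<Rightarrow> time_var \<Rightarrow> lam_series" where
  "flow_op Q logQ L t = (case t of
     T0 n \<Rightarrow> lscale (2 * eps_inv) (toda_op Q logQ L (T0 n))
   | T1 n \<Rightarrow> lscale eps_inv (toda_op Q logQ L (T1 n)))"

text \<open>\<open>H\<^sub>t\<close> is \<open>\<L>\<^sup>d\<close>, with \<open>d\<close> the \<open>flow_degree\<close>, times a linear expression in the two parts of the logarithm;
  the weights are its coefficients. The constant term is distributed over the two sides in such a
  way that \<open>\<L>\<^bsup>n+1\<^esup>\<close> belongs to the lower side and \<open>log Q\<close> to the upper side.\<close>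
fun flow_degree :: "time_var \<Rightarrow> nat" where
  "flow_degree (T0 n) = n"
| "flow_degree (T1 n) = n + 1"

fun log_weight :: "time_var \<Rightarrow> coef" where
  "log_weight (T0 n) = eps_inv * cconst (1 / fact n)"
| "log_weight (T1 n) = 0"

fun weight_down :: "complex \<Rightarrow> time_var \<Rightarrow> coef" where
  "weight_down logQ (T0 n) = eps_inv * cconst (1 / fact n) * cconst (- C_const logQ n)"
| "weight_down logQ (T1 n) = eps_inv * cconst (1 / fact (n + 1))"

fun weight_up :: "complex \<Rightarrow> time_var \<Rightarrow> coef" where
  "weight_up logQ (T0 n) = eps_inv * cconst (1 / fact n) * cconst (C_const logQ n - logQ)"
| "weight_up logQ (T1 n) = 0"

lemma const_weights: "const_coef (log_weight t)" "const_coef (weight_down logQ t)" "const_coef (weight_up logQ t)"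
  by (cases t; simp add: const_coef_mult const_coef_cconst const_coef_eps_inv)+

definition potential :: "(time_var \<Rightarrow> coef) \<Rightarrow> 's::side dseries \<Rightarrow> 's dseries \<Rightarrow> time_var \<Rightarrow> 's dseries" where
  "potential w L a t = dscale (log_weight t) (L ^ flow_degree t) * a + dscale (w t) (L ^ flow_degree t)"

text \<open>A Laurent polynomial \<open>N\<close> in \<open>\<Lambda>\<close> can be multiplied with any series. This covers all products with
  the logarithm, which is infinite in both directions.\<close>
lemma lam_mult_finite:
  assumes "finite {i. lam_coeff N i \<noteq> 0}"
  shows "N * (X + Y) = N * X + N * Y" "N * (X - Y) = N * X - N * Y"
    "(X + Y) * N = X * N + Y * N" "(X - Y) * N = X * N - Y * N"
    "const_coef c \<Longrightarrow> N * lscale c X = lscale c (N * X)" "lscale c X * N = lscale c (X * N)"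
    "lscale c N * X = lscale c (N * X)"
proof -
  have l: "lam_coeff (A * Y) k = (\<Sum>i | lam_coeff N i \<noteq> 0. lam_coeff A i * translate i (lam_coeff Y (k - i)))"
    if "\<And>i. lam_coeff N i = 0 \<Longrightarrow> lam_coeff A i = 0" for A Y k
    using assms by (rule lam_coeff_mult) (use that in auto)
  have r: "lam_coeff (X * N) k = (\<Sum>i\<in>(\<lambda>i. k - i) ` {i. lam_coeff N i \<noteq> 0}. lam_coeff X i * translate i (lam_coeff N (k - i)))" for X k
    using assms by (intro lam_coeff_mult) (auto intro: rev_image_eqI)
  show "N * (X + Y) = N * X + N * Y" "N * (X - Y) = N * X - N * Y"
    by (rule lam_eqI; simp add: l translate_add translate_diff distrib_left right_diff_distrib sum.distrib sum_subtractf)+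
  show "(X + Y) * N = X * N + Y * N" "(X - Y) * N = X * N - Y * N"
    by (rule lam_eqI; simp add: r distrib_right left_diff_distrib sum.distrib sum_subtractf)+
  show "N * lscale c X = lscale c (N * X)" if "const_coef c"
    using that by (intro lam_eqI) (simp add: l translate_mult const_coefD sum_distrib_left mult.left_commute)
  show "lscale c X * N = lscale c (X * N)"
    by (rule lam_eqI) (simp add: r sum_distrib_left mult.assoc)
  show "lscale c N * X = lscale c (N * X)"
    by (rule lam_eqI) (simp add: l sum_distrib_left mult.assoc)
qed

lemma finite_two_sided:
  assumes "one_sided 1 L" "one_sided (- 1) L"
  shows "finite {i. lam_coeff L i \<noteq> 0}"
proof -
  obtain N M where "\<And>k. 1 * k > N \<Longrightarrow> lam_coeff L k = 0" "\<And>k. - 1 * k > M \<Longrightarrow> lam_coeff L k = 0"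
    using assms unfolding one_sided_def by blast
  then have "{i. lam_coeff L i \<noteq> 0} \<subseteq> {-M..N}" by force
  then show ?thesis by (rule finite_subset) simp
qed

lemma one_sided_power:
  assumes "\<sigma> = 1 \<or> \<sigma> = -1" "one_sided \<sigma> L" shows "one_sided \<sigma> (L ^ n)"
  by (induction n) (use assms one_sided_lmonom[of \<sigma> 1 0] in
    \<open>auto simp: power.power.power_0 power.power.power_Suc one_sided_mult intro!: one_sidedI[of 0]\<close>)

lemma lscale_0_mult: "lscale 0 A * X = 0"
  by (rule lam_eqI) (subst lam_coeff_mult[of "{}"], auto)

text \<open>The weight of the logarithm is the same on both sides, so in the difference the terms with
  \<open>\<epsilon>\<partial>\<^sub>x\<close> cancel: \<open>H\<^sub>t\<close> is the difference of \<open>A\<^sub>t + K\<^sub>t \<epsilon>\<partial>\<^sub>x\<close> on the lower and the upper side.\<close>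
lemma flow_op_decomposition:
  assumes "Q \<noteq> 0" "one_sided 1 L" "one_sided (- 1) L" "dressing_pair Q L PL PR"
  shows "flow_op Q logQ L t =
    ser (potential (weight_down logQ) (Abs_dseries L :: down dseries)
      (log_part (Abs_dseries PL) (Abs_dseries (lower_inv PL))) t) -
    ser (potential (weight_up logQ) (Abs_dseries L :: up dseries)
      (log_part (Abs_dseries (sharp Q PR)) (Abs_dseries (sharp Q (lower_inv PR)))) t)"
proof -
  define a where "a = log_part (Abs_dseries PL :: down dseries) (Abs_dseries (lower_inv PL))"
  define b where "b = log_part (Abs_dseries (sharp Q PR) :: up dseries) (Abs_dseries (sharp Q (lower_inv PR)))"
  have log: "lax_log Q logQ L = lscale (cconst (1 / 2)) (lmonom (cconst logQ) 0 + ser a - ser b)"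
    using lax_log_eq[OF assms] dressing_log_eq[OF assms] by (simp add: a_def b_def)
  note ser_L = ser_Abs_down[OF assms(2)] ser_Abs_up[OF assms(3)]
  show ?thesis
  proof (cases t)
    case (T1 n)
    then show ?thesis
      by (intro lam_eqI) (simp add: flow_op_def potential_def ser_simps ser_L ser_power mult.assoc lscale_0_mult)
  next
    case (T0 n)
    define N where "N = L ^ n"
    have fin: "finite {i. lam_coeff N i \<noteq> 0}"
      unfolding N_def using assms by (intro finite_two_sided one_sided_power) auto
    have mon: "N * lmonom (cconst c) 0 = lscale (cconst c) N" for c
      by (rule lam_eqI) (simp add: lam_coeff_mult_lmonom mult.commute)
    have "flow_op Q logQ L t = lscale (2 * eps_inv) (lscale (cconst (1 / fact n)) (lscale (cconst (1 / 2))
        (lscale (cconst logQ) N + N * ser a - N * ser b) - lscale (cconst (C_const logQ n)) N))"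
      using T0 by (simp add: flow_op_def log N_def[symmetric] lam_mult_finite[OF fin] const_coef_cconst mon)
    also have "\<dots> = ser (potential (weight_down logQ) (Abs_dseries L) a t) - ser (potential (weight_up logQ) (Abs_dseries L) b t)"
    proof (rule lam_eqI)
      fix k
      define h where "h = cconst (1 / 2)"
      have h: "h * 2 = 1" unfolding h_def cconst_numeral[symmetric] by (simp flip: cconst_mult)
      define f where "f = cconst (1 / fact n)"
      have neg: "cconst (- c) = - cconst c" "cconst (c - d) = cconst c - cconst d" for c d
        using cconst_add[of c "- c", symmetric] cconst_add[of "c - d" d, symmetric]
        by (simp_all add: eq_neg_iff_add_eq_0 add.commute eq_diff_eq)
      have "2 * eps_inv * (f * (h * (q * x + y - z) - c * x)) = (h * 2) * (eps_inv * f * (q * x + y - z)) - 2 * eps_inv * f * c * x"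
        for q x y z c by (simp add: algebra_simps)
      then show "lam_coeff (lscale (2 * eps_inv) (lscale (cconst (1 / fact n)) (lscale (cconst (1 / 2))
        (lscale (cconst logQ) N + N * ser a - N * ser b) - lscale (cconst (C_const logQ n)) N))) k =
        lam_coeff (ser (potential (weight_down logQ) (Abs_dseries L) a t) - ser (potential (weight_up logQ) (Abs_dseries L) b t)) k"
        using T0 by (simp add: potential_def ser_simps ser_L ser_power N_def[symmetric] lam_mult_finite[OF fin]
            h_def[symmetric] f_def[symmetric] h neg) (simp add: algebra_simps)
    qed
    finally show ?thesis by (simp add: a_def b_def)
  qed
qed

lemma power_derivation:
  assumes "a * L = L * a - edx (L :: 's::side dseries)"
  shows "a * L ^ n = L ^ n * a - edx (L ^ n)"
proof (induction n)
  case (Suc n)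
  have "a * L ^ Suc n = (L * a - edx L) * L ^ n" using assms by (simp flip: mult.assoc)
  also have "\<dots> = L * (a * L ^ n) - edx L * L ^ n" by (simp add: left_diff_distrib mult.assoc)
  also have "\<dots> = L ^ Suc n * a - edx (L ^ Suc n)" unfolding Suc by (simp add: algebra_simps edx_mult)
  finally show ?case .
qed simp

lemma power_flow:
  assumes "dtime t L = L * M - M * (L :: 's::side dseries)"
  shows "dtime t (L ^ n) = L ^ n * M - M * L ^ n"
proof (induction n)
  case (Suc n)
  have "dtime t (L ^ Suc n) = (L * M - M * L) * L ^ n + L * (L ^ n * M - M * L ^ n)"
    by (simp only: power_Suc dtime_mult assms Suc)
  then show ?case by (simp add: algebra_simps)
qed simp

lemma dscale_edx: "const_coef c \<Longrightarrow> edx (dscale c A) = dscale c (edx A)"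
  by (simp add: edx_def dscale_derivation dscale_dscale mult.commute)

lemma dscale_diff: "dscale c (A - B) = dscale c A - dscale c B"
  by (rule dseries_eqI) (simp add: ser_simps right_diff_distrib)

lemma dscale_power_derivation:
  assumes "a * L = L * a - edx (L :: 's::side dseries)" "const_coef c"
  shows "a * dscale c (L ^ n) = dscale c (L ^ n) * a - edx (dscale c (L ^ n))"
  using assms by (simp add: dscale_mult_left dscale_mult_right dscale_edx power_derivation dscale_diff)

lemma dscale_power_flow:
  assumes "dtime t L = L * M - M * (L :: 's::side dseries)" "const_coef c"
  shows "dtime t (dscale c (L ^ n)) = dscale c (L ^ n) * M - M * dscale c (L ^ n)"
  using assms by (simp add: dscale_mult_left dscale_mult_right dscale_derivation power_flow dscale_diff)

lemma dscale_power_commute: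
  assumes "const_coef c" "const_coef d"
  shows "dscale c (L ^ n) * dscale d (L ^ m) = dscale d (L ^ m) * dscale c (L ^ n)"
  using assms by (simp add: dscale_mult_left dscale_mult_right dscale_dscale mult.commute flip: power_add)
    (simp add: add.commute)

lemma potential_commutator:
  assumes "a * L = L * a - edx (L :: 's::side dseries)" "\<And>t. const_coef (w t)"
  shows "potential w L a t * L - L * potential w L a t = - (dscale (log_weight t) (L ^ flow_degree t) * edx L)"
proof -
  let ?K = "dscale (log_weight t) (L ^ flow_degree t)" and ?B = "dscale (w t) (L ^ flow_degree t)"
  have c: "?K * L = L * ?K" "?B * L = L * ?B"
    using const_weights assms(2) by (simp_all add: dscale_mult_left dscale_mult_right power_commutes)
  have "potential w L a t * L = ?K * (a * L) + ?B * L" by (simp add: potential_def distrib_right mult.assoc)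
  also have "\<dots> = (?K * L) * a - ?K * edx L + L * ?B" unfolding assms(1) c(2) by (simp add: algebra_simps)
  finally show ?thesis unfolding c by (simp add: potential_def algebra_simps)
qed


section \<open>Integration of flat connections\<close>

lemma qcoeff_mult_0:
  assumes "\<And>i. qcoeff (dcoeff A i * translate i (dcoeff X (k - i))) m = 0"
  shows "qcoeff (dcoeff (A * X) k) m = 0"
proof -
  let ?\<sigma> = "orientation TYPE('a)"
  obtain N where N: "\<And>k. ?\<sigma> * k > N \<Longrightarrow> dcoeff A k = 0" "\<And>k. ?\<sigma> * k > N \<Longrightarrow> dcoeff X k = 0"
    using one_sided_common ser_one_sided by metis
  have add: "qcoeff (f + g) m = qcoeff f m + qcoeff g m" for f g :: coef by simp
  have "dcoeff (A * X) k = (\<Sum>i | ?\<sigma> * k - N \<le> ?\<sigma> * i \<and> ?\<sigma> * i \<le> N.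
      dcoeff A i * translate i (dcoeff X (k - i)))"
    unfolding ser_simps by (rule lam_coeff_mult_interval[OF orientation N]) auto
  then show ?thesis by (simp add: additive_sum[of "\<lambda>f. qcoeff f m", OF add] assms)
qed

lemma mult_vanishing_q:
  assumes "\<And>m' k. m' \<subseteq># m \<Longrightarrow> qcoeff (dcoeff X k) m' = 0"
  shows "qcoeff (dcoeff (A * X) k) m = 0"
  by (rule qcoeff_mult_0) (simp add: qcoeff_mult translate_def assms)

text \<open>Left multiplication is triangular for the degree in \<open>q\<close>; this is what makes \<open>\<partial>\<^sub>t P = - M\<^sub>t P\<close> a
  recursion.\<close>
lemma mult_cong_q:
  assumes "\<And>m' k. m' \<subseteq># m \<Longrightarrow> qcoeff (dcoeff X k) m' = qcoeff (dcoeff Y k) m'"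
  shows "qcoeff (dcoeff (A * X) k) m = qcoeff (dcoeff (A * Y) k) m"
  using mult_vanishing_q[of m "X - Y" A k] assms
  by (simp add: right_diff_distrib) (simp add: ser_simps)

lemma of_nat_coef_cancel:
  assumes "of_nat n * f = (0 :: smooth_fun fls)" "n > 0" shows "f = 0"
proof -
  have "of_nat n = fls_const (smooth_const_fun (of_nat n))"
    by (simp add: of_nat_smooth_fun[symmetric] fls_of_nat)
  then have "fls_const (smooth_const_fun (1 / of_nat n)) * (of_nat n * f) = f"
    using \<open>n > 0\<close> by (simp add: mult.assoc[symmetric] fls_const_mult_const smooth_const_fun_mult[symmetric] del: mult_eq_0_iff)
  then show ?thesis using assms by simp
qed

lemma of_nat_coef_surj:
  assumes "n > 0" shows "surj (\<lambda>f. of_nat n * f :: smooth_fun fls)"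
proof (rule surjI)
  fix f :: "smooth_fun fls"
  have "of_nat n = fls_const (smooth_const_fun (of_nat n))"
    by (simp add: of_nat_smooth_fun[symmetric] fls_of_nat)
  then show "of_nat n * (fls_const (smooth_const_fun (1 / of_nat n)) * f) = f"
    using \<open>n > 0\<close> by (simp add: mult.assoc[symmetric] fls_const_mult_const smooth_const_fun_mult[symmetric] del: mult_eq_0_iff)
qed

lemma dcoeff_dtime: "qcoeff (dcoeff (dtime t A) k) m = of_nat (count m t + 1) * qcoeff (dcoeff A k) (add_mset t m)"
  by (simp add: ser_simps qderiv.rep_eq)

text \<open>A flat section is determined by its value at \<open>q = 0\<close>, degree by degree in \<open>q\<close>.\<close>
lemma flat_section_unique:
  assumes "\<And>t. dtime t X = - (M t * X)" "\<And>k. qcoeff (dcoeff X k) {#} = 0"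
  shows "X = 0"
proof -
  have "qcoeff (dcoeff X k) m = 0" for k m
  proof (induction "size m" arbitrary: m k rule: less_induct)
    case less
    show ?case
    proof (cases m)
      case empty
      then show ?thesis using assms(2) by simp
    next
      case (add t m')
      have "qcoeff (dcoeff (M t * X) k) m' = 0"
        using less add by (intro mult_vanishing_q) (simp add: less_Suc_eq_le size_mset_mono)
      then have "of_nat (count m' t + 1) * qcoeff (dcoeff X k) m = 0"
        using arg_cong[OF assms(1)[of t], of "\<lambda>A. qcoeff (dcoeff A k) m'"] add
        by (simp only: dcoeff_dtime) (simp add: ser_simps)
      then show ?thesis by (rule of_nat_coef_cancel) simp
    qed
  qed
  then show ?thesis by (intro dseries_eqI qseries_eqI) (simp add: ser_simps)
qed

definition nonpositive :: "'s::side dseries \<Rightarrow> bool" where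
  "nonpositive A \<longleftrightarrow> (\<forall>k. orientation TYPE('s) * k > 0 \<longrightarrow> dcoeff A k = 0)"

lemma nonpositive_mult: "nonpositive A \<Longrightarrow> nonpositive B \<Longrightarrow> nonpositive (A * B)"
  unfolding nonpositive_def ser_simps
  by (auto intro!: mult_vanishing[OF orientation, where N = 0 and M = 0])

text \<open>Frobenius' theorem for formal power series. The coefficient of the monomial \<open>m\<close> is computed from the
  equation for a single variable of \<open>m\<close>; flatness implies the equations for the other variables.\<close>
lemma flat_section_exists:
  fixes M :: "time_var \<Rightarrow> 's::side dseries" and P0 :: "'s dseries"
  assumes flat: "\<And>s t. dtime s (M t) - dtime t (M s) + (M s * M t - M t * M s) = 0"
    and M: "\<And>t. nonpositive (M t)" and P0: "nonpositive P0"
  shows "\<exists>P. nonpositive P \<and> (\<forall>t. dtime t P = - (M t * P)) \<and>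
    (\<forall>k. qcoeff (dcoeff P k) {#} = qcoeff (dcoeff P0 k) {#})"
proof -
  let ?\<sigma> = "orientation TYPE('s)"
  define mk where "mk s = (Abs_dseries (Abs_lam_series (\<lambda>k.
    if ?\<sigma> * k > 0 then 0 else Abs_qseries (\<lambda>m. s (m, k)))) :: 's dseries)"
    for s :: "time_var multiset \<times> int \<Rightarrow> smooth_fun fls"
  have "one_sided ?\<sigma> (Abs_lam_series (\<lambda>k. if ?\<sigma> * k > 0 then 0 else Abs_qseries (\<lambda>m. s (m, k))))" for s
    by (rule one_sidedI[of 0]) (simp add: Abs_lam_series_inverse)
  then have mk: "qcoeff (dcoeff (mk s) k) m = (if ?\<sigma> * k > 0 then 0 else s (m, k))" for s k m
    by (simp add: mk_def Abs_dseries_inverse Abs_lam_series_inverse Abs_qseries_inverse)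
  have nonpos_mk: "nonpositive (mk s)" for s
    unfolding nonpositive_def by (auto intro!: qseries_eqI simp: mk)
  define pick :: "time_var multiset \<Rightarrow> time_var" where "pick m = (SOME t. t \<in># m)" for m
  have pick: "pick m \<in># m" if "m \<noteq> {#}" for m
    unfolding pick_def using that multiset_nonemptyE[of m] someI_ex[of "\<lambda>t. t \<in># m"] by blast
  \<comment> \<open>the coefficient of \<open>\<partial>\<^sub>t P + M\<^sub>t P\<close> at \<open>m - t\<close>, for the chosen variable \<open>t\<close> of \<open>m\<close>\<close>
  define T where "T s = (\<lambda>(m, k). if m = {#} then s ({#}, k) else
     of_nat (count m (pick m)) * s (m, k) + qcoeff (dcoeff (M (pick m) * mk s) k) (m - {#pick m#}))" for s
  define R where "R = inv_image {(a, b :: time_var multiset). a \<subset># b} (fst :: _ \<times> int \<Rightarrow> _)"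
  have "\<exists>s. \<forall>i. T s i = (\<lambda>(m, k). if m = {#} then qcoeff (dcoeff P0 k) {#} else 0) i"
  proof (rule triangular_surj[where R = R and d = "\<lambda>(m, k) f. if m = {#} then f else of_nat (count m (pick m)) * f"])
    show "wf R" unfolding R_def by (intro wf_inv_image wf_subset_mset)
  next
    fix i and s u :: "time_var multiset \<times> int \<Rightarrow> smooth_fun fls"
    assume eq: "\<And>j. (j, i) \<in> R \<Longrightarrow> s j = u j"
    obtain m k where i: "i = (m, k)" by fastforce
    have "qcoeff (dcoeff (M (pick m) * mk s) k) (m - {#pick m#}) = qcoeff (dcoeff (M (pick m) * mk u) k) (m - {#pick m#})"
      if "m \<noteq> {#}"
    proof (rule mult_cong_q)
      fix m' k assume "m' \<subseteq># m - {#pick m#}"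
      then have "m' \<subset># m" using pick[OF that]
        by (metis diff_subset_eq_self insert_DiffM mset_subset_eq_exists_conv multi_psub_of_add_self subset_mset.le_less_trans)
      then show "qcoeff (dcoeff (mk s) k) m' = qcoeff (dcoeff (mk u) k) m'"
        using eq[of "(m', k)"] by (simp add: mk R_def i)
    qed
    then show "T s i - T u i = (case i of (m, k) \<Rightarrow> \<lambda>f. if m = {#} then f else of_nat (count m (pick m)) * f) (s i - u i)"
      by (simp add: T_def i algebra_simps)
  next
    fix i :: "time_var multiset \<times> int"
    show "surj (case i of (m, k) \<Rightarrow> \<lambda>f :: smooth_fun fls. if m = {#} then f else of_nat (count m (pick m)) * f)"
      using of_nat_coef_surj pick by (cases i) (auto simp: surj_def)
  qed
  then obtain s where s: "\<And>m k. T s (m, k) = (if m = {#} then qcoeff (dcoeff P0 k) {#} else 0)" by auto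
  define P where "P = mk s"
  \<comment> \<open>the defect of \<open>P\<close>, which vanishes by construction at \<open>m - pick m\<close> in the direction \<open>pick m\<close>\<close>
  define X where "X t = dtime t P + M t * P" for t
  have X_nonpos: "nonpositive (X t)" for t
    using nonpositive_mult[OF M nonpos_mk] nonpos_mk unfolding X_def P_def nonpositive_def
    by (simp add: ser_simps)
  have picked: "qcoeff (dcoeff (X (pick m)) k) (m - {#pick m#}) = 0" if "m \<noteq> {#}" for m k
  proof (cases "?\<sigma> * k > 0")
    case True
    then show ?thesis using X_nonpos[of "pick m"] by (simp add: nonpositive_def)
  next
    case False
    have "qcoeff (dcoeff (dtime (pick m) P) k) (m - {#pick m#}) = of_nat (count m (pick m)) * s (m, k)"
      unfolding dcoeff_dtime P_def mk using pick[OF that] False by simp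
    then show ?thesis using s[of m k] that unfolding X_def P_def T_def by (simp add: ser_simps)
  qed
  \<comment> \<open>Flatness relates the defects in two directions; at lowest order the terms with \<open>M\<close> drop out.\<close>
  have sym: "dtime u (X t) + M u * X t = dtime t (X u) + M t * X u" for u t
  proof -
    have "dtime u (M t) * P + M u * (M t * P) = dtime t (M u) * P + M t * (M u * P)"
      using arg_cong[OF flat[of u t], of "\<lambda>A. A * P"] by (simp add: algebra_simps)
    then show ?thesis unfolding X_def
      by (simp add: dtime_add dtime_mult dtime_commute[of u t] algebra_simps)
  qed
  have "qcoeff (dcoeff (X t) k) m = 0" for t k m
  proof (induction "size m" arbitrary: m k t rule: less_induct)
    case less
    define m1 where "m1 = add_mset t m"
    define u where "u = pick m1"
    have u: "u \<in># m1" unfolding u_def by (rule pick) (simp add: m1_def)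
    have Xu: "qcoeff (dcoeff (X u) k) (m1 - {#u#}) = 0" for k
      unfolding u_def by (rule picked) (simp add: m1_def)
    show ?case
    proof (cases "u = t")
      case True
      then show ?thesis using Xu by (simp add: m1_def)
    next
      case False
      then obtain m2 where m2: "m = add_mset u m2"
        using u unfolding m1_def by (metis insert_noteq_member multi_member_split)
      have small: "qcoeff (dcoeff (M u * X v) k) m2 = 0" "qcoeff (dcoeff (M t * X v) k) m2 = 0" for v k
        using less m2 by (intro mult_vanishing_q; simp add: less_Suc_eq_le size_mset_mono)+
      have "qcoeff (dcoeff (dtime u (X t)) k) m2 = qcoeff (dcoeff (dtime t (X u)) k) m2"
        using arg_cong[OF sym[of u t], of "\<lambda>A. qcoeff (dcoeff A k) m2"] small by (simp add: ser_simps(3))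
      also have "\<dots> = 0"
        using Xu[of k] False by (simp add: dcoeff_dtime m1_def m2 add_mset_commute)
      finally have "of_nat (count m2 u + 1) * qcoeff (dcoeff (X t) k) m = 0"
        by (simp only: dcoeff_dtime m2)
      then show ?thesis by (rule of_nat_coef_cancel) simp
    qed
  qed
  then have "X t = 0" for t by (intro dseries_eqI qseries_eqI) (simp add: ser_simps)
  then have "dtime t P = - (M t * P)" for t unfolding X_def by (simp add: eq_neg_iff_add_eq_0)
  moreover have "qcoeff (dcoeff P k) {#} = qcoeff (dcoeff P0 k) {#}" for k
    using s[of "{#}" k] P0 unfolding P_def T_def mk by (simp add: nonpositive_def)
  ultimately show ?thesis using nonpos_mk P_def by blast
qed

text \<open>Both \<open>L P\<close> and \<open>P Z\<close> are flat, so it suffices to compare them at \<open>q = 0\<close>.\<close>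
lemma flat_section_dresses:
  assumes "\<And>t. dtime t L = L * M t - M t * L" "\<And>t. dtime t Z = 0"
    "\<And>t. dtime t P = - (M t * P)" and P0: "L * P0 = P0 * Z"
    and init: "\<And>k. qcoeff (dcoeff P k) {#} = qcoeff (dcoeff P0 k) {#}"
  shows "L * P = P * Z"
proof -
  have "L * P - P * Z = 0"
  proof (rule flat_section_unique[of _ M])
    fix t
    show "dtime t (L * P - P * Z) = - (M t * (L * P - P * Z))"
      by (simp add: dtime_mult assms algebra_simps)
  next
    fix k
    define D where "D = P - P0"
    have D: "qcoeff (dcoeff D k) {#} = 0" for k using init by (simp add: D_def ser_simps)
    have "qcoeff (dcoeff (D * Z) k) {#} = 0" for k
      by (rule qcoeff_mult_0) (simp add: qcoeff_mult D)
    moreover have "qcoeff (dcoeff (L * D) k) {#} = 0" for k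
      by (rule mult_vanishing_q) (simp add: D)
    moreover have "L * P - P * Z = L * D - D * Z" using P0 by (simp add: D_def algebra_simps)
    ultimately show "qcoeff (dcoeff (L * P - P * Z) k) {#} = 0" by (simp add: ser_simps(4))
  qed
  then show ?thesis by simp
qed


section \<open>Existence of dressing operators\<close>

lemma qseries_eps_eqI:
  "(\<And>m n. fls_nth (qcoeff f m) n = fls_nth (qcoeff g m) n) \<Longrightarrow> f = g"
  by (intro qseries_eqI fls_eqI)

lemma qcoeff_1: "qcoeff 1 m = (if m = {#} then 1 else 0)"
  by (simp add: one_qseries.rep_eq)

text \<open>For \<open>a = e\<^sup>v\<close> this is the equation of the leading coefficient of \<open>\<P>\<^sub>R\<close>. Only \<open>a = 1 + \<epsilon> a\<^sub>1 + \<dots>\<close> matters: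
  the terms of order \<open>\<epsilon>\<^bsup>n+1\<^esup>\<close> read \<open>s\<^sub>n' = a\<^sub>1 s\<^sub>n + \<dots>\<close>, with the dots depending on \<open>s\<^sub>0, \<dots>, s\<^bsub>n-1\<^esub>\<close>. Within \<open>s\<^sub>n\<close>, the
  coefficient of a monomial in \<open>q\<close> satisfies a linear ODE in \<open>x\<close> whose inhomogeneity involves the proper
  divisors of the monomial. Choosing a nowhere vanishing solution at the start makes \<open>s\<close> a unit.\<close>
lemma leading_coefficient_exists:
  fixes a :: coef
  assumes a_neg: "\<And>m n. n < 0 \<Longrightarrow> fls_nth (qcoeff a m) n = 0"
    and a_0: "\<And>m. fls_nth (qcoeff a m) 0 = (if m = {#} then 1 else 0)"
  shows "\<exists>s c. s * c = 1 \<and> a * translate (- 1) s = s"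
proof -
  define mk where "mk s = Abs_qseries (\<lambda>m. fps_to_fls (Abs_fps (\<lambda>n. s (m, n))))"
    for s :: "time_var multiset \<times> nat \<Rightarrow> smooth_fun"
  have mk: "qcoeff (mk s) m = fps_to_fls (Abs_fps (\<lambda>n. s (m, n)))" for s m
    by (simp add: mk_def Abs_qseries_inverse)
  define a' where "a' = (\<lambda>(m, n). fls_nth (qcoeff a m) (int n))"
  have a: "a = mk a'" by (rule qseries_eps_eqI) (simp add: mk a'_def a_neg)
  define \<tau> where "\<tau> s = (\<lambda>(m, n). \<Sum>j\<le>n. taylor (- 1) j (s (m, n - j)))"
    for s :: "time_var multiset \<times> nat \<Rightarrow> smooth_fun"
  have tr: "translate (- 1) (mk s) = mk (\<tau> s)" for s
    using fls_translate_shift[of "- 1" 0]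
    by (intro qseries_eqI) (simp add: translate_def mk fps_translate_def \<tau>_def)
  have prod: "fls_nth (qcoeff (mk f * mk g) m) (int n) =
      (\<Sum>b | b \<subseteq># m. \<Sum>i\<le>n. f (b, i) * g (m - b, n - i))" for f g m n
    by (simp add: qcoeff_mult mk fps_mult_nth atLeast0AtMost flip: fls_times_fps_to_fls)
       (simp add: additive_sum[of "\<lambda>f. fls_nth f (int n)"] fps_mult_nth atLeast0AtMost del: fls_times_fps_to_fls)
  \<comment> \<open>The index shift \<open>int n + 1\<close> accounts for the cancellation of \<open>s\<^bsub>n+1\<^esub>\<close> at order \<open>n + 1\<close>.\<close>
  define U where "U s = (\<lambda>(m, n). fls_nth (qcoeff (mk s - a * translate (- 1) (mk s)) m) (int n + 1))" for s
  have U: "U s (m, n) = s (m, Suc n) - (\<Sum>b | b \<subseteq># m. \<Sum>i\<le>Suc n. a' (b, i) * \<tau> s (m - b, Suc n - i))" for s m n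
    using prod[of a' "\<tau> s" m "Suc n"] unfolding U_def tr a by (simp add: mk add.commute nat_add_distrib del: sum.atMost_Suc)
  have U_diff: "U f i - U g i = U (\<lambda>i. f i - g i) i" for f g i
  proof -
    have "mk (\<lambda>i. f i - g i) = mk f - mk g" by (rule qseries_eps_eqI) (simp add: mk)
    then show ?thesis by (simp add: U_def translate_diff right_diff_distrib split: prod.split)
  qed
  define \<alpha> where "\<alpha> = a' ({#}, 1)"
  define R where "R = {((m', n'), (m :: time_var multiset, n :: nat)). n' < n \<or> n' = n \<and> m' \<subset># m}"
  have triangular: "U w (m, n) = smooth_deriv (w (m, n)) - \<alpha> * w (m, n)"
    if w: "\<And>j. (j, (m, n)) \<in> R \<Longrightarrow> w j = 0" for w m n
  proof -
    have w_low: "w (m', n') = 0" if "n' < n" for m' n' using w that by (simp add: R_def)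
    have w_sub: "w (m', n) = 0" if "m' \<subset># m" for m' using w that by (simp add: R_def)
    have \<tau>_low: "\<tau> w (m', n') = 0" if "n' < n" for m' n'
      using that by (auto simp: \<tau>_def w_low intro!: sum.neutral)
    have \<tau>_n: "\<tau> w (m', n) = w (m', n)" for m'
    proof -
      have "\<tau> w (m', n) = (\<Sum>j\<in>{0}. taylor (- 1) j (w (m', n - j)))"
        unfolding \<tau>_def prod.case by (rule sum.mono_neutral_right) (auto simp: w_low)
      then show ?thesis by simp
    qed
    have \<tau>_Suc: "\<tau> w (m', Suc n) = w (m', Suc n) - smooth_deriv (w (m', n))" for m'
    proof -
      have "\<tau> w (m', Suc n) = w (m', Suc n) + (\<Sum>j\<le>n. taylor (- 1) (Suc j) (w (m', n - j)))"
        by (simp add: \<tau>_def sum.atMost_Suc_shift del: sum.atMost_Suc)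
      also have "(\<Sum>j\<le>n. taylor (- 1) (Suc j) (w (m', n - j))) = (\<Sum>j\<in>{0}. taylor (- 1) (Suc j) (w (m', n - j)))"
        by (rule sum.mono_neutral_right) (auto simp: w_low)
      also have "\<dots> = - smooth_deriv (w (m', n))"
      proof -
        have "smooth_const_fun (- 1) = - 1"
          using smooth_const_fun_add[of 1 "- 1"] by (simp add: eq_neg_iff_add_eq_0 add.commute)
        then show ?thesis by simp
      qed
      finally show ?thesis by simp
    qed
    have "(\<Sum>i\<le>Suc n. a' (b, i) * \<tau> w (m - b, Suc n - i)) =
      (if b = {#} then w (m, Suc n) - smooth_deriv (w (m, n)) + \<alpha> * w (m, n) else 0)" if b: "b \<subseteq># m" for b
    proof -
      have "(\<Sum>i\<le>Suc n. a' (b, i) * \<tau> w (m - b, Suc n - i)) =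
        a' (b, 0) * \<tau> w (m - b, Suc n) + (\<Sum>i\<le>n. a' (b, Suc i) * \<tau> w (m - b, n - i))"
        by (simp add: sum.atMost_Suc_shift del: sum.atMost_Suc)
      also have "(\<Sum>i\<le>n. a' (b, Suc i) * \<tau> w (m - b, n - i)) = (\<Sum>i\<in>{0}. a' (b, Suc i) * \<tau> w (m - b, n - i))"
        by (rule sum.mono_neutral_right) (auto simp: \<tau>_low)
      finally have e: "(\<Sum>i\<le>Suc n. a' (b, i) * \<tau> w (m - b, Suc n - i)) =
        a' (b, 0) * \<tau> w (m - b, Suc n) + a' (b, 1) * w (m - b, n)" by (simp add: \<tau>_n)
      show ?thesis
      proof (cases "b = {#}")
        case True
        then show ?thesis unfolding e by (simp add: \<tau>_Suc \<alpha>_def a'_def a_0)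
      next
        case False
        then have "m - b \<subset># m" using b
          by (metis Diff_eq_empty_iff_mset diff_subset_eq_self subset_mset.le_imp_less_or_eq submultiset_compl cancel_comm_monoid_add_class.diff_cancel)
        then show ?thesis unfolding e using False by (simp add: w_sub a'_def a_0)
      qed
    qed
    then have "(\<Sum>b | b \<subseteq># m. \<Sum>i\<le>Suc n. a' (b, i) * \<tau> w (m - b, Suc n - i)) =
      (\<Sum>b\<in>{b. b \<subseteq># m}. if b = {#} then w (m, Suc n) - smooth_deriv (w (m, n)) + \<alpha> * w (m, n) else 0)"
      by (intro sum.cong) auto
    also have "\<dots> = w (m, Suc n) - smooth_deriv (w (m, n)) + \<alpha> * w (m, n)"
      by (subst sum.delta) (auto simp: finite_submultisets)
    finally show ?thesis by (simp add: U)
  qed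
  obtain E E' where E: "E * E' = 1" "smooth_deriv E = \<alpha> * E" using smooth_integrating_factor by blast
  define base where "base = ({#} :: time_var multiset, 0 :: nat)"
  \<comment> \<open>At the lowest index the equation \<open>s' = \<alpha> s\<close> is replaced by prescribing its solution \<open>E\<close>.\<close>
  have "\<exists>s. \<forall>i. (if i = base then s i else U s i) = (if i = base then E else 0)"
  proof (rule triangular_surj[where R = R and d = "\<lambda>i f. if i = base then f else smooth_deriv f - \<alpha> * f"])
    have "R \<subseteq> inv_image (less_than <*lex*> {(a, b). a \<subset># b}) (\<lambda>(m, n). (n, m))"
      by (auto simp: R_def)
    then show "wf R" by (rule wf_subset[rotated]) (intro wf_inv_image wf_lex_prod wf_less_than wf_subset_mset)
  next
    fix i and f g :: "time_var multiset \<times> nat \<Rightarrow> smooth_fun"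
    assume "\<And>j. (j, i) \<in> R \<Longrightarrow> f j = g j"
    then show "(if i = base then f i else U f i) - (if i = base then g i else U g i) =
      (if i = base then f i - g i else smooth_deriv (f i - g i) - \<alpha> * (f i - g i))"
      using triangular[of "fst i" "snd i" "\<lambda>i. f i - g i"] by (simp add: U_diff)
  next
    show "surj (\<lambda>f. if i = base then f else smooth_deriv f - \<alpha> * f)" for i
      using smooth_linear_ode_surj by (auto simp: surj_def) metis
  qed
  then obtain s where s: "\<And>i. (if i = base then s i else U s i) = (if i = base then E else 0)" by blast
  have s_base: "s base = E" using s[of base] by simp
  have "(j, base) \<notin> R" for j by (auto simp: base_def R_def)
  then have "U s base = 0"
    using triangular[of "{#}" 0 s] s_base E(2) by (simp add: base_def)
  then have U0: "U s i = 0" for i using s[of i] by (cases "i = base") auto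
  have "mk s - a * translate (- 1) (mk s) = 0"
  proof (rule qseries_eps_eqI)
    fix m and n :: int
    consider "n < 0" | "n = 0" | k where "n = int k + 1"
      by (metis not_less_iff_gr_or_eq zero_less_imp_eq_int of_nat_Suc gr0_implies_Suc of_nat_0_less_iff add.commute)
    then show "fls_nth (qcoeff (mk s - a * translate (- 1) (mk s)) m) n = fls_nth (qcoeff 0 m) n"
    proof cases
      case 1
      have add: "fls_nth (f + g) n = fls_nth f n + fls_nth g n" for f g :: "smooth_fun fls" by simp
      have "fls_nth (fps_to_fls f * fps_to_fls g) n = 0" for f g :: "smooth_fun fps"
        using 1 by (simp flip: fls_times_fps_to_fls)
      then show ?thesis using 1
        unfolding tr a by (simp add: mk qcoeff_mult additive_sum[of "\<lambda>f. fls_nth f n", OF add])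
    next
      case 2
      have "(\<Sum>b | b \<subseteq># m. a' (b, 0) * \<tau> s (m - b, 0)) = (\<Sum>b\<in>{b. b \<subseteq># m}. if b = {#} then s (m, 0) else 0)"
        by (intro sum.cong) (auto simp: a'_def a_0 \<tau>_def)
      also have "\<dots> = s (m, 0)" by (subst sum.delta) (auto simp: finite_submultisets)
      finally show ?thesis using 2 prod[of a' "\<tau> s" m 0] unfolding tr a by (simp add: mk)
    next
      case 3
      then show ?thesis using U0[of "(m, k)"] by (simp add: U_def)
    qed
  qed
  moreover have "\<exists>c. mk s * c = 1"
  proof (rule qseries_unit)
    let ?F = "Abs_fps (\<lambda>n. s ({#}, n))"
    have "fps_nth ?F 0 * E' = 1" using s_base E(1) by (simp add: base_def)
    then have "?F * fps_right_inverse ?F E' = 1" by (rule fps_right_inverse)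
    then show "qcoeff (mk s) {#} * fps_to_fls (fps_right_inverse ?F E') = 1"
      unfolding mk by (simp only: fls_times_fps_to_fls[symmetric]) simp
  qed
  ultimately show ?thesis by (metis eq_iff_diff_eq_0)
qed

lemma exp_coef_leading:
  assumes "n \<le> 0"
  shows "fls_nth (qcoeff (exp_coef v) m) n = (if n = 0 \<and> m = {#} then 1 else 0)"
proof -
  have "\<forall>\<^sub>\<infinity>k. (if - int k < 0 then 0 else f k) = (0 :: smooth_fun)" for f
    by (auto simp: MOST_nat intro!: exI[of _ 0])
  then have "fls_nth (qcoeff (exp_coef v) m) n =
    (if n < 0 then 0 else fls_nth (qcoeff (\<Sum>k\<le>nat n. cconst (1 / fact k) * v ^ k) m) n)"
    unfolding exp_coef_def by (simp add: Abs_qseries_inverse nth_Abs_fls)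
  then show ?thesis using assms by (auto simp: qcoeff_1)
qed

text \<open>In \<open>L \<P>\<^sub>L = \<P>\<^sub>L \<Lambda>\<close> the coefficient of \<open>\<Lambda>\<^bsup>-j\<^esup>\<close> gives \<open>w\<^bsub>j+1\<^esub>(x + \<epsilon>) - w\<^bsub>j+1\<^esub>(x)\<close> in terms of \<open>w\<^sub>j\<close> and \<open>w\<^bsub>j-1\<^esub>\<close>.\<close>
lemma left_dressing_exists:
  fixes L :: "down dseries"
  assumes L: "L = dmon 1 1 + dmon u 0 + dmon w (- 1)"
  shows "\<exists>PL. lower PL \<and> lam_coeff PL 0 = 1 \<and> L * Abs_dseries PL = Abs_dseries PL * dmon 1 1"
proof -
  let ?T = "\<lambda>s k. case k of 0 \<Rightarrow> s 0
    | Suc j \<Rightarrow> translate 1 (s k) - s k + u * s j + (if j = 0 then 0 else w * translate (- 1) (s (j - 1)))"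
  have "\<exists>s. \<forall>k. ?T s k = (if k = 0 then 1 else 0)"
  proof (rule triangular_surj[where R = less_than and
        d = "\<lambda>k f. if k = 0 then f else translate 1 f - f"])
    fix k and s t :: "nat \<Rightarrow> coef" assume "\<And>j. (j, k) \<in> less_than \<Longrightarrow> s j = t j"
    then show "?T s k - ?T t k = (if k = 0 then s k - t k else translate 1 (s k - t k) - (s k - t k))"
      by (auto simp: translate_diff split: nat.split)
  next
    show "surj (\<lambda>f. if k = 0 then f else translate 1 f - f)" for k :: nat
      using coef_difference_surj by (auto simp: surj_def) metis
  qed simp
  then obtain s where s: "\<And>k. ?T s k = (if k = 0 then 1 else 0)" by blast
  define PL where "PL = Abs_lam_series (\<lambda>k. if k \<le> 0 then s (nat (- k)) else 0)"
  have PL: "lam_coeff PL k = (if k \<le> 0 then s (nat (- k)) else 0)" for k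
    by (simp add: PL_def Abs_lam_series_inverse)
  have s0: "s 0 = 1" using s[of 0] by simp
  have low: "lower PL" by (simp add: lower_def PL)
  have "L * Abs_dseries PL = Abs_dseries PL * dmon 1 1"
  proof (rule dseries_eqI)
    fix k
    have "dcoeff (L * Abs_dseries PL) k = translate 1 (lam_coeff PL (k - 1)) + u * lam_coeff PL k
        + w * translate (- 1) (lam_coeff PL (k + 1))"
      unfolding L distrib_right by (simp add: ser_simps ser_Abs_down[OF lower_one_sided[OF low]] lam_coeff_lmonom_mult)
    moreover have "dcoeff (Abs_dseries PL * dmon 1 1 :: down dseries) k = lam_coeff PL (k - 1)"
      by (simp add: ser_simps ser_Abs_down[OF lower_one_sided[OF low]] lam_coeff_mult_lmonom)
    moreover have "translate 1 (lam_coeff PL (k - 1)) + u * lam_coeff PL k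
        + w * translate (- 1) (lam_coeff PL (k + 1)) = lam_coeff PL (k - 1)"
    proof (cases "k \<le> 0")
      case True
      define j where "j = nat (- k)"
      have k: "k = - int j" using True by (simp add: j_def)
      have "nat (int j + 1) = Suc j" "nat (int j - 1) = j - 1" by simp_all
      then show ?thesis using s[of "Suc j"] by (cases j) (simp_all add: k PL nat_add_distrib algebra_simps)
    next
      case False
      then show ?thesis by (cases "k = 1") (simp_all add: PL s0)
    qed
    ultimately show "dcoeff (L * Abs_dseries PL) k = dcoeff (Abs_dseries PL * dmon 1 1 :: down dseries) k" by simp
  qed
  then show ?thesis using low s0 by (intro exI[of _ PL]) (simp add: PL)
qed

text \<open>The equation for the coefficient \<open>s\<^sub>k\<close> of \<open>S = \<P>\<^sub>R\<^sup>#\<close> prescribes \<open>e\<^sup>v s\<^sub>k(x - \<epsilon>) - s\<^sub>k(x)\<close>. The substitution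
  \<open>s\<^sub>k = s\<^sub>0 r\<close> removes \<open>e\<^sup>v\<close> and leaves a difference equation for \<open>r\<close>.\<close>
lemma right_dressing_exists:
  fixes L :: "up dseries"
  assumes Q: "Q \<noteq> 0" and L: "L = dmon 1 1 + dmon u 0 + dmon (cconst Q * e) (- 1)"
    and s0: "s0 * c = 1" "e * translate (- 1) s0 = s0"
  shows "\<exists>S. (\<forall>k<0. lam_coeff S k = 0) \<and> lam_coeff S 0 = s0 \<and>
    L * Abs_dseries S = Abs_dseries S * dmon (cconst Q) (- 1)"
proof -
  let ?D = "\<lambda>f. cconst Q * (e * translate (- 1) f - f)"
  have surj: "\<exists>f. ?D f = g" for g
  proof -
    obtain h where h: "translate 1 h - h = cconst (1 / Q) * c * g" using coef_difference_surj by blast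
    have "e * translate (- 1) (s0 * (- translate 1 h)) = (e * translate (- 1) s0) * (- h)"
      by (simp add: translate_mult translate_minus translate_compose mult.assoc)
    then have "?D (s0 * (- translate 1 h)) = cconst Q * s0 * (translate 1 h - h)"
      by (simp add: s0(2) algebra_simps)
    also have "\<dots> = (cconst Q * cconst (1 / Q)) * (s0 * c) * g" by (simp add: h algebra_simps)
    finally show ?thesis using s0(1) cconst_inverse[OF Q]
      by (intro exI[of _ "s0 * (- translate 1 h)"]) (simp only: mult_1_left)
  qed
  let ?T = "\<lambda>s k. case k of 0 \<Rightarrow> s 0
    | Suc j \<Rightarrow> ?D (s k) + u * s j + (if j = 0 then 0 else translate 1 (s (j - 1)))"
  have "\<exists>s. \<forall>k. ?T s k = (if k = 0 then s0 else 0)"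
  proof (rule triangular_surj[where R = less_than and d = "\<lambda>k f. if k = 0 then f else ?D f"])
    fix k and s t :: "nat \<Rightarrow> coef" assume "\<And>j. (j, k) \<in> less_than \<Longrightarrow> s j = t j"
    then show "?T s k - ?T t k = (if k = 0 then s k - t k else ?D (s k - t k))"
      by (auto simp: translate_diff algebra_simps split: nat.split)
  next
    show "surj (\<lambda>f. if k = 0 then f else ?D f)" for k :: nat
      using surj by (auto simp: surj_def) metis
  qed simp
  then obtain s where s: "\<And>k. ?T s k = (if k = 0 then s0 else 0)" by blast
  define S where "S = Abs_lam_series (\<lambda>k. if k \<ge> 0 then s (nat k) else 0)"
  have S: "lam_coeff S k = (if k \<ge> 0 then s (nat k) else 0)" for k
    by (simp add: S_def Abs_lam_series_inverse)
  have s_0: "s 0 = s0" using s[of 0] by simp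
  have os: "one_sided (- 1) S" by (rule one_sidedI[of 0]) (simp add: S)
  have "L * Abs_dseries S = Abs_dseries S * dmon (cconst Q) (- 1)"
  proof (rule dseries_eqI)
    fix k
    have "dcoeff (L * Abs_dseries S) k = translate 1 (lam_coeff S (k - 1)) + u * lam_coeff S k
        + cconst Q * e * translate (- 1) (lam_coeff S (k + 1))"
      unfolding L distrib_right by (simp add: ser_simps ser_Abs_up[OF os] lam_coeff_lmonom_mult)
    moreover have "dcoeff (Abs_dseries S * dmon (cconst Q) (- 1) :: up dseries) k = lam_coeff S (k + 1) * cconst Q"
      by (simp add: ser_simps ser_Abs_up[OF os] lam_coeff_mult_lmonom)
    moreover have "translate 1 (lam_coeff S (k - 1)) + u * lam_coeff S k
        + cconst Q * e * translate (- 1) (lam_coeff S (k + 1)) = lam_coeff S (k + 1) * cconst Q"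
    proof (cases "k \<ge> 0")
      case True
      define j where "j = nat k"
      have k: "k = int j" using True by (simp add: j_def)
      have "nat (int j + 1) = Suc j" "nat (int j - 1) = j - 1" by simp_all
      then show ?thesis using s[of "Suc j"]
        by (cases j) (simp_all add: k S nat_add_distrib algebra_simps)
    next
      case False
      show ?thesis
      proof (cases "k = - 1")
        case True
        then have "cconst Q * e * translate (- 1) (lam_coeff S (k + 1)) = cconst Q * (e * translate (- 1) s0)"
          by (simp add: S s_0 mult.assoc)
        then show ?thesis using True by (simp add: s0(2) S s_0 mult.commute)
      next
        case False
        then show ?thesis using \<open>\<not> k \<ge> 0\<close> by (simp add: S)
      qed
    qed
    ultimately show "dcoeff (L * Abs_dseries S) k = dcoeff (Abs_dseries S * dmon (cconst Q) (- 1) :: up dseries) k" by simp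
  qed
  then show ?thesis using s_0 by (intro exI[of _ S]) (simp add: S)
qed


lemma lax_two_sided: "lax_operator Q L \<Longrightarrow> one_sided 1 L \<and> one_sided (- 1) L"
  unfolding lax_operator_def by (auto intro!: one_sided_simple(1) one_sided_lmonom)

lemma dressing_pairI:
  assumes Q: "Q \<noteq> 0" and L: "one_sided 1 L" "one_sided (- 1) L"
    and PL: "lower PL" "lam_coeff PL 0 = 1" "(Abs_dseries L :: down dseries) * Abs_dseries PL = Abs_dseries PL * dmon 1 1"
    and S: "\<And>k. k < 0 \<Longrightarrow> lam_coeff S k = 0" "lam_coeff S 0 * c = 1"
      "(Abs_dseries L :: up dseries) * Abs_dseries S = Abs_dseries S * dmon (cconst Q) (- 1)"
  shows "dressing_pair Q L PL (sharp Q S)"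
proof -
  have PLi: "lower_invertible PL" using PL lower_invertible_iff by simp
  note PL' = lower_inv[OF PL(1) PLi]
  have PR: "lower (sharp Q S)" unfolding lower_def using S(1) by simp
  have PRi: "lower_invertible (sharp Q S)" using S(2) lower_invertible_iff[OF PR] by auto
  note PR' = lower_inv[OF PR PRi]
  note os = PR[THEN lower_one_sided] PR'(1)[THEN lower_one_sided]
  have SS: "sharp Q (sharp Q S) = S" by (rule sharp_sharp[OF Q])
  have SS': "S * sharp Q (lower_inv (sharp Q S)) = 1" "sharp Q (lower_inv (sharp Q S)) * S = 1"
    using PR'(2,3)[THEN arg_cong, of "sharp Q"] Q os by (simp_all add: sharp_mult SS)
  have "dresses (dmon 1 1) (Abs_dseries L :: down dseries) (Abs_dseries PL) (Abs_dseries (lower_inv PL))"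
    using PL PL'
    by (subst dresses_alt) (auto simp: ser_inject[symmetric] ser_simps ser_Abs_down lower_one_sided L)
  moreover have "one_sided (- 1) S" by (rule one_sidedI[of 0]) (simp add: S(1))
  then have "dresses (dmon (cconst Q) (- 1)) (Abs_dseries L :: up dseries) (Abs_dseries S)
      (Abs_dseries (sharp Q (lower_inv (sharp Q S))))"
    using S SS' os sharp_one_sided[OF os(2)]
    by (subst dresses_alt) (auto simp: ser_inject[symmetric] ser_simps ser_Abs_up L)
  ultimately show ?thesis
    using PL PR PRi by (simp add: dressing_pair_iff[OF Q L] SS)
qed

lemma dressing_pair_exists:
  assumes Q: "Q \<noteq> 0" and "lax_operator Q L"
  shows "\<exists>PL PR. dressing_pair Q L PL PR"
proof -
  obtain u v where L: "L = lmonom 1 1 + lmonom u 0 + lmonom (cconst Q * exp_coef v) (- 1)"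
    using assms unfolding lax_operator_def by blast
  note os = lax_two_sided[OF assms(2), THEN conjunct1] lax_two_sided[OF assms(2), THEN conjunct2]
  have Ld: "(Abs_dseries L :: down dseries) = dmon 1 1 + dmon u 0 + dmon (cconst Q * exp_coef v) (- 1)"
    by (simp add: ser_inject[symmetric] ser_simps ser_Abs_down os) (rule L)
  have Lu: "(Abs_dseries L :: up dseries) = dmon 1 1 + dmon u 0 + dmon (cconst Q * exp_coef v) (- 1)"
    by (simp add: ser_inject[symmetric] ser_simps ser_Abs_up os) (rule L)
  obtain s c where s: "s * c = 1" "exp_coef v * translate (- 1) s = s"
    using leading_coefficient_exists[of "exp_coef v"] exp_coef_leading by auto
  obtain PL where PL: "lower PL" "lam_coeff PL 0 = 1"
    "(Abs_dseries L :: down dseries) * Abs_dseries PL = Abs_dseries PL * dmon 1 1"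
    using left_dressing_exists[OF Ld] by blast
  obtain S where S: "\<And>k. k < 0 \<Longrightarrow> lam_coeff S k = 0" "lam_coeff S 0 = s"
    "(Abs_dseries L :: up dseries) * Abs_dseries S = Abs_dseries S * dmon (cconst Q) (- 1)"
    using right_dressing_exists[OF Q Lu s] by blast
  show ?thesis using dressing_pairI[OF Q os PL S(1) _ S(3), of c] s(1) S(2) by auto
qed

section \<open>Lax equations and dressing flows\<close>
lemma dressing_flows_iff:
  "dressing_flows Q logQ L PL PR \<longleftrightarrow> (\<forall>t.
    time_deriv t PL = - (minus_part (flow_op Q logQ L t) * PL) \<and>
    time_deriv t (sharp Q PR) = plus_part (flow_op Q logQ L t) * sharp Q PR)"
proof -
  have all: "(\<forall>t. X t) \<longleftrightarrow> (\<forall>n. X (T1 n) \<and> X (T0 n))" for X by (metis time_var.exhaust)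
  show ?thesis unfolding dressing_flows_def all by (auto simp: flow_op_def Let_def)
qed

lemma extended_toda_iff:
  assumes "one_sided 1 L" "one_sided (- 1) L"
  shows "extended_toda Q logQ L \<longleftrightarrow>
    (\<forall>t. time_deriv t L = commutator (plus_part (flow_op Q logQ L t)) L)"
proof -
  note fin = lam_mult_finite[OF finite_two_sided[OF assms]]
  have c: "lscale c (commutator (plus_part X) L) = commutator (plus_part (lscale c X)) L"
    if "const_coef c" for c X
  proof -
    have "plus_part (lscale c X) = lscale c (plus_part X)" by (rule lam_eqI) simp
    moreover have "lscale c (A - B) = lscale c A - lscale c B" for A B
      by (rule lam_eqI) (simp add: right_diff_distrib)
    ultimately show ?thesis using that by (simp add: commutator_def fin)
  qed
  have all: "(\<forall>t. X t) \<longleftrightarrow> (\<forall>n. X (T1 n) \<and> X (T0 n))" for X by (metis time_var.exhaust)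
  show ?thesis unfolding extended_toda_def all
    by (simp add: flow_op_def c const_coef_mult const_coef_eps_inv del: toda_op.simps)
qed

lemma plus_minus_part: "plus_part H + minus_part H = H"
  by (rule lam_eqI) simp

lemma one_sided_parts: "one_sided 1 (minus_part H)" "one_sided (- 1) (plus_part H)"
  by (rule one_sidedI[of 0]; simp)+

text \<open>On each side the commutator of \<open>\<L>\<close> with \<open>A\<^sub>t + K\<^sub>t \<epsilon>\<partial>\<^sub>x\<close> vanishes, so its commutator with \<open>A\<^sub>t\<close> is
  \<open>- K\<^sub>t \<epsilon> \<partial>\<L>/\<partial>x\<close>, which is the same on both sides.\<close>
lemma flow_op_commutes:
  assumes "Q \<noteq> 0" and L: "one_sided 1 L" "one_sided (- 1) L" and "dressing_pair Q L PL PR"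
  shows "flow_op Q logQ L t * L = L * flow_op Q logQ L t"
proof -
  let ?Ld = "Abs_dseries L :: down dseries" and ?Lu = "Abs_dseries L :: up dseries"
  define a where "a = log_part (Abs_dseries PL :: down dseries) (Abs_dseries (lower_inv PL))"
  define b where "b = log_part (Abs_dseries (sharp Q PR) :: up dseries) (Abs_dseries (sharp Q (lower_inv PR)))"
  define X where "X = potential (weight_down logQ) ?Ld a t"
  define Y where "Y = potential (weight_up logQ) ?Lu b t"
  have H: "flow_op Q logQ L t = ser X - ser Y"
    unfolding X_def Y_def a_def b_def by (rule flow_op_decomposition[OF assms])
  have ser_L: "ser ?Ld = L" "ser ?Lu = L" using L by (simp_all add: ser_Abs_down ser_Abs_up)
  note d = assms(4)[unfolded dressing_pair_iff[OF assms(1) L]]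
  have "a * ?Ld = ?Ld * a - edx ?Ld" "b * ?Lu = ?Lu * b - edx ?Lu"
    unfolding a_def b_def using d assms(1) by (blast intro: log_part_commute rigid_shift)+
  then have "X * ?Ld - ?Ld * X = - (dscale (log_weight t) (?Ld ^ flow_degree t) * edx ?Ld)"
    "Y * ?Lu - ?Lu * Y = - (dscale (log_weight t) (?Lu ^ flow_degree t) * edx ?Lu)"
    unfolding X_def Y_def by (auto intro: potential_commutator const_weights)
  then have "ser (X * ?Ld - ?Ld * X) = ser (Y * ?Lu - ?Lu * Y)"
    by (simp add: ser_simps ser_L ser_power edx_def)
  then show ?thesis
    unfolding H by (simp add: ser_simps ser_L lam_mult_finite[OF finite_two_sided[OF L]] algebra_simps)
qed

text \<open>As \<open>H\<^sub>t\<close> commutes with \<open>\<L>\<close>, the Lax equation is \<open>\<partial>\<^sub>t \<L> = [\<L>, M\<^sub>t]\<close> with \<open>M\<^sub>t = (H\<^sub>t)\<^sub>-\<close> on the lower side and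
  \<open>M\<^sub>t = - (H\<^sub>t)\<^sub>+\<close> on the upper side.\<close>
lemma lax_flow_sides:
  fixes Q logQ :: complex and L PL PR :: lam_series and t :: time_var
  assumes "Q \<noteq> 0" and L: "one_sided 1 L" "one_sided (- 1) L" and "dressing_pair Q L PL PR"
  defines "H \<equiv> flow_op Q logQ L"
  shows "time_deriv t L = commutator (plus_part (H t)) L \<longleftrightarrow>
      dtime t (Abs_dseries L :: down dseries) =
      Abs_dseries L * Abs_dseries (minus_part (H t)) - Abs_dseries (minus_part (H t)) * Abs_dseries L"
    "time_deriv t L = commutator (plus_part (H t)) L \<longleftrightarrow>
      dtime t (Abs_dseries L :: up dseries) =
      Abs_dseries L * (- Abs_dseries (plus_part (H t))) - (- Abs_dseries (plus_part (H t))) * Abs_dseries L"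
proof -
  note fin = lam_mult_finite[OF finite_two_sided[OF L]]
  have "H t * L = L * H t" unfolding H_def by (rule flow_op_commutes[OF assms(1-4)])
  then have "(plus_part (H t) + minus_part (H t)) * L = L * (plus_part (H t) + minus_part (H t))"
    by (simp only: plus_minus_part)
  then have "commutator (plus_part (H t)) L = L * minus_part (H t) - minus_part (H t) * L"
    unfolding commutator_def by (simp add: fin algebra_simps)
  then show "time_deriv t L = commutator (plus_part (H t)) L \<longleftrightarrow>
      dtime t (Abs_dseries L :: down dseries) =
      Abs_dseries L * Abs_dseries (minus_part (H t)) - Abs_dseries (minus_part (H t)) * Abs_dseries L"
    by (simp add: ser_inject[symmetric] ser_simps ser_Abs_down L one_sided_parts)
  show "time_deriv t L = commutator (plus_part (H t)) L \<longleftrightarrow>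
      dtime t (Abs_dseries L :: up dseries) =
      Abs_dseries L * (- Abs_dseries (plus_part (H t))) - (- Abs_dseries (plus_part (H t))) * Abs_dseries L"
    unfolding commutator_def
    by (simp add: ser_inject[symmetric] ser_Abs_up L one_sided_parts) 
      (simp add: ser_inject[symmetric] ser_simps ser_Abs_up L one_sided_parts)
qed

text \<open>By \<open>curvature_of_potentials\<close> both curvatures are the same expression in \<open>E\<^sub>t\<close> and \<open>K\<^sub>t\<close>, which are the
  same series on both sides. But one curvature has only negative powers of \<open>\<Lambda>\<close>, the other one has none.\<close>
lemma zero_curvature:
  fixes Q logQ :: complex and L PL PR :: lam_series and s t :: time_var
  assumes "Q \<noteq> 0" and L: "one_sided 1 L" "one_sided (- 1) L" and "dressing_pair Q L PL PR"
    and "extended_toda Q logQ L"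
  defines "Md \<equiv> \<lambda>t. Abs_dseries (minus_part (flow_op Q logQ L t)) :: down dseries"
    and "Mu \<equiv> \<lambda>t. - (Abs_dseries (plus_part (flow_op Q logQ L t)) :: up dseries)"
  shows "dtime s (Md t) - dtime t (Md s) + (Md s * Md t - Md t * Md s) = 0"
    "dtime s (Mu t) - dtime t (Mu s) + (Mu s * Mu t - Mu t * Mu s) = 0"
proof -
  let ?Ld = "Abs_dseries L :: down dseries" and ?Lu = "Abs_dseries L :: up dseries"
  let ?H = "flow_op Q logQ L"
  define a where "a = log_part (Abs_dseries PL :: down dseries) (Abs_dseries (lower_inv PL))"
  define b where "b = log_part (Abs_dseries (sharp Q PR) :: up dseries) (Abs_dseries (sharp Q (lower_inv PR)))"
  define Kd where "Kd = (\<lambda>t. dscale (log_weight t) (?Ld ^ flow_degree t))"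
  define Ku where "Ku = (\<lambda>t. dscale (log_weight t) (?Lu ^ flow_degree t))"
  define Bd where "Bd = (\<lambda>t. dscale (weight_down logQ t) (?Ld ^ flow_degree t))"
  define Bu where "Bu = (\<lambda>t. dscale (weight_up logQ t) (?Lu ^ flow_degree t))"
  define Ed where "Ed = (\<lambda>t. potential (weight_down logQ) ?Ld a t - Md t)"
  define Eu where "Eu = (\<lambda>t. potential (weight_up logQ) ?Lu b t - Mu t)"
  note d = assms(4)[unfolded dressing_pair_iff[OF assms(1) L]]
  have ser_L: "ser ?Ld = L" "ser ?Lu = L" using L by (simp_all add: ser_Abs_down ser_Abs_up)
  have ser_M: "ser (Md t) = minus_part (?H t)" "ser (Mu t) = - plus_part (?H t)" for t
    by (simp_all add: Md_def Mu_def ser_simps ser_Abs_down ser_Abs_up one_sided_parts)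
  have flow: "dtime t ?Ld = ?Ld * Md t - Md t * ?Ld" "dtime t ?Lu = ?Lu * Mu t - Mu t * ?Lu" for t
    using assms(5) unfolding extended_toda_iff[OF L] Md_def Mu_def
    using lax_flow_sides[OF assms(1-4)] by blast+
  have a: "a * ?Ld = ?Ld * a - edx ?Ld" "b * ?Lu = ?Lu * b - edx ?Lu"
    unfolding a_def b_def using d assms(1) by (blast intro: log_part_commute rigid_shift)+
  have da: "dtime t a = edx (Md t) - Md t * a + a * Md t" "dtime t b = edx (Mu t) - Mu t * b + b * Mu t" for t
    unfolding a_def b_def using d assms(1) flow by (blast intro: log_part_flow rigid_shift)+
  have down: "dtime s (Md t) - dtime t (Md s) + (Md s * Md t - Md t * Md s) =
    dtime t (Ed s) - dtime s (Ed t) + (Ed s * Ed t - Ed t * Ed s) + Kd s * edx (Ed t) - Kd t * edx (Ed s)"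
    by (rule curvature_of_potentials[where B = Bd and a = a and A = "potential (weight_down logQ) ?Ld a"])
      (simp_all add: Kd_def Bd_def potential_def Ed_def dscale_power_commute const_weights da
        dscale_power_derivation[OF a(1)] dscale_power_flow[OF flow(1)])
  have up: "dtime s (Mu t) - dtime t (Mu s) + (Mu s * Mu t - Mu t * Mu s) =
    dtime t (Eu s) - dtime s (Eu t) + (Eu s * Eu t - Eu t * Eu s) + Ku s * edx (Eu t) - Ku t * edx (Eu s)"
    by (rule curvature_of_potentials[where B = Bu and a = b and A = "potential (weight_up logQ) ?Lu b"])
      (simp_all add: Ku_def Bu_def potential_def Eu_def dscale_power_commute const_weights da
        dscale_power_derivation[OF a(2)] dscale_power_flow[OF flow(2)])
  \<comment> \<open>\<open>H\<^sub>+ + H\<^sub>- = A\<^sub>d - A\<^sub>u\<close> rearranged to \<open>A\<^sub>d - H\<^sub>- = A\<^sub>u + H\<^sub>+\<close>\<close>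
  have E: "ser (Ed t) = ser (Eu t)" for t
  proof -
    have "plus_part (?H t) + minus_part (?H t) =
      ser (potential (weight_down logQ) ?Ld a t) - ser (potential (weight_up logQ) ?Lu b t)"
      unfolding plus_minus_part a_def b_def by (rule flow_op_decomposition[OF assms(1-4)])
    then show ?thesis by (simp add: Ed_def Eu_def ser_simps ser_M algebra_simps)
  qed
  have K: "ser (Kd t) = ser (Ku t)" for t by (simp add: Kd_def Ku_def ser_simps ser_L ser_power)
  define Fd where "Fd = dtime s (Md t) - dtime t (Md s) + (Md s * Md t - Md t * Md s)"
  define Fu where "Fu = dtime s (Mu t) - dtime t (Mu s) + (Mu s * Mu t - Mu t * Mu s)"
  have F: "ser Fd = ser Fu"
    unfolding Fd_def Fu_def down up by (simp add: ser_simps edx_def E K)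
  have "lam_coeff (minus_part (?H s) * minus_part (?H t)) k = 0" if "k \<ge> 0" for s t k
    by (rule mult_vanishing[of 1 "- 1" _ "- 1"]) (use that in auto)
  then have Fd: "dcoeff Fd k = 0" if "k \<ge> 0" for k
    using that unfolding Fd_def by (simp add: ser_simps ser_M)
  have "lam_coeff (- plus_part (?H s) * - plus_part (?H t)) k = 0" if "k < 0" for s t k
    by (rule mult_vanishing[of "- 1" 0 _ 0]) (use that in auto)
  then have Fu: "dcoeff Fu k = 0" if "k < 0" for k
    using that unfolding Fu_def by (simp add: ser_simps ser_M)
  have Fd0: "dcoeff Fd k = 0" for k using Fd[of k] Fu[of k] F by (cases "k < 0") auto
  then have Fu0: "dcoeff Fu k = 0" for k using F by simp
  show "dtime s (Md t) - dtime t (Md s) + (Md s * Md t - Md t * Md s) = 0"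
    "dtime s (Mu t) - dtime t (Mu s) + (Mu s * Mu t - Mu t * Mu s) = 0"
    using Fd0 Fu0 unfolding Fd_def[symmetric] Fu_def[symmetric]
    by (auto intro!: dseries_eqI simp: ser_simps(1))
qed

lemma lax_equations_if_dressing_flows:
  assumes "Q \<noteq> 0" and L: "one_sided 1 L" "one_sided (- 1) L"
    and pair: "dressing_pair Q L PL PR" and flows: "dressing_flows Q logQ L PL PR"
  shows "extended_toda Q logQ L"
proof -
  let ?Ld = "Abs_dseries L :: down dseries" and ?P = "Abs_dseries PL :: down dseries"
  note d = pair[unfolded dressing_pair_iff[OF assms(1) L]]
  have "dtime t ?Ld = ?Ld * Abs_dseries (minus_part (flow_op Q logQ L t)) - Abs_dseries (minus_part (flow_op Q logQ L t)) * ?Ld" for t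
  proof -
    let ?M = "Abs_dseries (minus_part (flow_op Q logQ L t)) :: down dseries"
    have dr: "dresses (dmon 1 1) ?Ld ?P (Abs_dseries (lower_inv PL))" using d by blast
    have "dtime t ?P = - (?M * ?P)"
      using flows d unfolding dressing_flows_iff
      by (simp add: ser_inject[symmetric] ser_simps ser_Abs_down one_sided_parts lower_one_sided)
    then have "dtime t ?P * Abs_dseries (lower_inv PL) = - ?M"
      using dr by (simp add: dresses_def mult.assoc)
    then show ?thesis using dtime_dressed[OF rigid_shift(1) dr, of t] by simp
  qed
  then show ?thesis
    unfolding extended_toda_iff[OF L] using lax_flow_sides(1)[OF assms(1) L pair] by blast
qed

lemma qcoeff_eq_initial:
  fixes f :: coef
  assumes "\<And>t. qderiv t f = 0" "m \<noteq> {#}"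
  shows "qcoeff f m = 0"
proof -
  obtain t m' where m: "m = add_mset t m'" using assms(2) by (meson multiset_cases)
  have "of_nat (count m' t + 1) * qcoeff f m = 0"
    using arg_cong[OF assms(1)[of t], of "\<lambda>g. qcoeff g m'"] by (simp only: qderiv.rep_eq m zero_qseries.rep_eq)
  then show ?thesis by (rule of_nat_coef_cancel) simp
qed

text \<open>The dressing pair is transported along the flat connections from \<open>q = 0\<close>, starting with the value of
  an arbitrary dressing pair. The shape of the operators survives: \<open>(H\<^sub>t)\<^sub>-\<close> does not move the leading
  coefficient \<open>1\<close> of \<open>\<P>\<^sub>L\<close>, and the leading coefficient of \<open>\<P>\<^sub>R\<close> stays invertible since it is so at
  \<open>q = 0\<close>.\<close>
lemma dressing_flows_exist:
  assumes Q: "Q \<noteq> 0" and lax: "lax_operator Q L" and toda: "extended_toda Q logQ L"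
  shows "\<exists>PL PR. dressing_pair Q L PL PR \<and> dressing_flows Q logQ L PL PR"
proof -
  note L = lax_two_sided[OF lax, THEN conjunct1] lax_two_sided[OF lax, THEN conjunct2]
  obtain PL0 PR0 where pair: "dressing_pair Q L PL0 PR0" using dressing_pair_exists[OF Q lax] by blast
  note d = pair[unfolded dressing_pair_iff[OF Q L]]
  let ?Ld = "Abs_dseries L :: down dseries" and ?Lu = "Abs_dseries L :: up dseries"
  define Md where "Md = (\<lambda>t. Abs_dseries (minus_part (flow_op Q logQ L t)) :: down dseries)"
  define Mu where "Mu = (\<lambda>t. - (Abs_dseries (plus_part (flow_op Q logQ L t)) :: up dseries))"
  have flat: "dtime s (Md t) - dtime t (Md s) + (Md s * Md t - Md t * Md s) = 0"
    "dtime s (Mu t) - dtime t (Mu s) + (Mu s * Mu t - Mu t * Mu s) = 0" for s t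
    unfolding Md_def Mu_def by (rule zero_curvature[OF Q L pair toda])+
  have ser_M: "ser (Md t) = minus_part (flow_op Q logQ L t)" "ser (Mu t) = - plus_part (flow_op Q logQ L t)" for t
    by (simp_all add: Md_def Mu_def ser_simps ser_Abs_down ser_Abs_up one_sided_parts)
  have flow: "dtime t ?Ld = ?Ld * Md t - Md t * ?Ld" "dtime t ?Lu = ?Lu * Mu t - Mu t * ?Lu" for t
    using toda unfolding extended_toda_iff[OF L] Md_def Mu_def
    using lax_flow_sides[OF Q L pair] by blast+
  define P0 where "P0 = (Abs_dseries PL0 :: down dseries)"
  define S0 where "S0 = (Abs_dseries (sharp Q PR0) :: up dseries)"
  have ser0: "ser P0 = PL0" "ser S0 = sharp Q PR0"
    using d by (simp_all add: P0_def S0_def ser_Abs_down ser_Abs_up lower_one_sided sharp_one_sided)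
  have nonpos: "nonpositive (Md t)" "nonpositive (Mu t)" "nonpositive P0" "nonpositive S0" for t
    using d by (auto simp: nonpositive_def ser_M ser0 lower_def)
  obtain P where P: "nonpositive P" "\<And>t. dtime t P = - (Md t * P)"
      "\<And>k. qcoeff (dcoeff P k) {#} = qcoeff (dcoeff P0 k) {#}"
    using flat_section_exists[OF flat(1) nonpos(1,3)] by blast
  obtain S where S: "nonpositive S" "\<And>t. dtime t S = - (Mu t * S)"
      "\<And>k. qcoeff (dcoeff S k) {#} = qcoeff (dcoeff S0 k) {#}"
    using flat_section_exists[OF flat(2) nonpos(2,4)] by blast
  have dP0: "?Ld * P0 = P0 * dmon 1 1" and dS0: "?Lu * S0 = S0 * dmon (cconst Q) (- 1)"
    using d dresses_alt unfolding P0_def S0_def dresses_def by blast+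
  have dP: "?Ld * P = P * dmon 1 1"
    using flat_section_dresses[OF flow(1) _ P(2) dP0 P(3)] rigid_shift(1) unfolding rigid_def by blast
  have dS: "?Lu * S = S * dmon (cconst Q) (- 1)"
    using flat_section_dresses[OF flow(2) _ S(2) dS0 S(3)] rigid_shift(2)[OF Q] unfolding rigid_def by blast
  have lower_P: "lower (ser P)" and upper_S: "\<And>k. k < 0 \<Longrightarrow> dcoeff S k = 0"
    using P(1) S(1) by (auto simp: nonpositive_def lower_def)
  have "dcoeff P 0 = 1"
  proof (rule qseries_eqI)
    fix m
    have "lam_coeff (minus_part (flow_op Q logQ L t) * ser P) 0 = 0" for t
      by (rule mult_vanishing[of 1 "- 1" _ 0]) (use lower_P in \<open>auto simp: lower_def\<close>)
    then have "qderiv t (dcoeff P 0) = 0" for t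
      using arg_cong[OF P(2)[of t], of "\<lambda>A. dcoeff A 0"] by (simp add: ser_simps ser_M)
    then have "qcoeff (dcoeff P 0) m = 0" if "m \<noteq> {#}" using qcoeff_eq_initial that by blast
    then show "qcoeff (dcoeff P 0) m = qcoeff 1 m"
      using P(3)[of 0] d by (cases "m = {#}") (simp_all add: qcoeff_1 ser0)
  qed
  moreover have "\<exists>c. dcoeff S 0 * c = 1"
  proof -
    obtain c where c: "lam_coeff PR0 0 * c = 1" using d lower_invertible_iff[of PR0] by blast
    have "qcoeff (dcoeff S 0) {#} * qcoeff c {#} = 1"
      using arg_cong[OF c, of "\<lambda>f. qcoeff f {#}"] by (simp add: S(3) ser0 qcoeff_mult qcoeff_1)
    then show ?thesis by (rule qseries_unit)
  qed
  then obtain c where "dcoeff S 0 * c = 1" by blast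
  ultimately have "dressing_pair Q L (ser P) (sharp Q (ser S))"
    using lower_P upper_S dP dS by (intro dressing_pairI[OF Q L]) (simp_all add: ser_inverse)
  moreover have "dressing_flows Q logQ L (ser P) (sharp Q (ser S))"
    unfolding dressing_flows_iff
  proof (intro allI conjI)
    fix t
    show "time_deriv t (ser P) = - (minus_part (flow_op Q logQ L t) * ser P)"
      using arg_cong[OF P(2)[of t], of ser] by (simp add: ser_simps ser_M)
    have "ser (dtime t S) = ser ((- Mu t) * S)" using S(2) by simp
    also have "\<dots> = plus_part (flow_op Q logQ L t) * ser S"
      by (simp only: times_dseries.rep_eq uminus_dseries.rep_eq ser_M minus_minus)
    finally show "time_deriv t (sharp Q (sharp Q (ser S))) = plus_part (flow_op Q logQ L t) * sharp Q (sharp Q (ser S))"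
      by (simp add: sharp_sharp[OF Q] dtime.rep_eq)
  qed
  ultimately show ?thesis by blast
qed

theorem proposition2p2:
  fixes Q logQ :: complex and L :: lam_series
  assumes "Q \<noteq> 0" and "exp logQ = Q" and "lax_operator Q L"
  shows "extended_toda Q logQ L \<longleftrightarrow>
    (\<exists>PL PR. dressing_pair Q L PL PR \<and> dressing_flows Q logQ L PL PR)"
  using dressing_flows_exist[OF assms(1,3)] lax_equations_if_dressing_flows[OF assms(1)]
    lax_two_sided[OF assms(3)] by blast

end
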